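(* Let $G$ be a locally compact second countable group, $\mu$ a Borel probability measure on $G$, $E$ a Banach space with a separable predual $E_*$, and $\pi$ a representation of $G$ in $E$ which is the adjoint of a strongly continuous representation $\pi_*$ of $G$ by isometries in $E_*$. Then $R_\pi$ is an isometric weak* homeomorphism of $L_{\mu\pi}$ onto $\mathcal{H}_{\mu\pi}=\{x\in E:\pi(\mu)x=x\}$, where $R_\pi:L_{\mu\pi}\to\mathcal{H}_{\mu\pi}$ is the map determined by $$R_\pi[f]_{Q_\lambda}=\int_{G^\infty}f(\omega)\,Q_e(d\omega)\qquad\text{for every } f\in\mathbb{B}_{i\pi}.$$
   Context: Representation: $\langle x_*,x\rangle$ is the duality between $E_*$ and $E=(E_* )^*$; $\pi(g)=[\pi_*(g^{-1})]^*$. For $\sigma\in M(G)$, $\pi(\sigma)$ is the bounded operator on $E$ with $\langle x_*,\pi(\sigma)x\rangle=\int_G\langle x_*,\pi(g)x\rangle\,\sigma(dg)$. Random walk: $G^\infty=\prod_{n=0}^\infty G$ with product Borel $\sigma$-algebra $\mathcal{B}^\infty$; points are $\omega=\{\omega_n\}_{n=0}^\infty$. For $g\in G$, $Q_g$ is the law on $(G^\infty,\mathcal{B}^\infty)$ of the Markov chain with transition probability $\Pi(g',A)=\mu(g'^{-1}A)$ started at $g$; for a measure $\nu$ on $G$, $Q_\nu(A)=\int_G Q_g(A)\,\nu(dg)$; $\lambda$ is the left Haar measure, $e$ the identity. $G$ acts on $G^\infty$ by $g\{\omega_n\}=\{g\omega_n\}$. With the shift $\vartheta(\{\omega_n\}_{n=0}^\infty)=\{\omega_{n+1}\}_{n=0}^\infty$,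 $\mathcal{B}^{(i)}=\{A\in\mathcal{B}^\infty:\vartheta^{-1}(A)=A\}$. $E$ carries the Borel structure of the weak* topology; integrals of bounded Borel $E$-valued functions are weak* integrals. $L^\infty_i(\mu,E)=L^\infty(G^\infty,\mathcal{B}^{(i)},Q_\lambda,E)$ is the space of $Q_\lambda$-essentially bounded $\mathcal{B}^{(i)}$-measurable functions $G^\infty\to E$ modulo $Q_\lambda$-a.e. equality, and it is the dual of $L^1(G^\infty,\mathcal{B}^{(i)},Q_\beta,E_* )$ where $\beta$ is any fixed finite measure equivalent to $\lambda$. $L_{\mu\pi}=\{f\in L^\infty_i(\mu,E):\text{for every } g\in G,\ f(g\omega)=\pi(g)f(\omega)\ \text{for } Q_\lambda\text{-a.e. }\omega\}$, a weakly* closed subspace of $L_i^\infty(\mu,E)$, with the relative weak* topology; $\mathcal{H}_{\mu\pi}$ is a weakly* closed subspace of $E$, with the relative weak* topology. $\mathbb{B}_{i\pi}$ is the set of bounded $\mathcal{B}^{(i)}$-measurable $f:G^\infty\to E$ with $f(g\omega)=\pi(g)f(\omega)$ for every $g\in G$, $\omega\in G^\infty$, and $[f]_{Q_\lambda}$ is the class of $f$ modulo $Q_\lambda$. Every element of $L_{\mu\pi}$ is of the form $[f]_{Q_\lambda}$ with $f\in\mathbb{B}_{i\pi}$, and elements of $\mathbb{B}_{i\pi}$ that agree $Q_\lambda$-a.e. agree $Q_e$-a.e., so $R_\pi$ is well defined. *)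

theory Defs
  imports "HOL-Probability.Probability"
begin

section \<open>Banach spaces with a predual, and adjoint representations\<close>

text \<open>
  Banach spaces are taken over a scalar field \<open>'k\<close> of class \<open>{real_normed_field, euclidean_space}\<close>,
  i.e. a finite-dimensional real field with multiplicative norm. Its instances \<open>real\<close> and \<open>complex\<close>
  are, by Frobenius' theorem, the only ones up to isomorphism. The predual is a type
  \<open>'a :: {banach, second_countable_topology}\<close> (for a metric space, second countable is separable)
  with a scalar multiplication \<open>smul :: 'k \<Rightarrow> 'a \<Rightarrow> 'a\<close> extending the real one. For
  \<open>'k = real\<close> necessarily \<open>smul = scaleR\<close>, and then the dual is the whole type of bounded linear functionals.
\<close>

definition normed_space_over :: "('k::real_normed_field \<Rightarrow> 'a::real_normed_vector \<Rightarrow> 'a) \<Rightarrow> bool"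
  where "normed_space_over smul \<longleftrightarrow>
    vector_space smul \<and>
    (\<forall>r x. smul (of_real r) x = r *\<^sub>R x) \<and>
    (\<forall>c x. norm (smul c x) = norm c * norm x)"

definition dual_space :: "('k::real_normed_field \<Rightarrow> 'a::real_normed_vector \<Rightarrow> 'a) \<Rightarrow> ('a \<Rightarrow>\<^sub>L 'k) set"
  where "dual_space smul = {x. \<forall>c y. blinfun_apply x (smul c y) = c * blinfun_apply x y}"

lemma normed_space_over_real: "normed_space_over ((*\<^sub>R) :: real \<Rightarrow> 'a::real_normed_vector \<Rightarrow> 'a)"
  by (simp add: normed_space_over_def real_vector.vector_space_axioms)

lemma dual_space_real: "dual_space ((*\<^sub>R) :: real \<Rightarrow> 'a::real_normed_vector \<Rightarrow> 'a) = UNIV"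
  by (simp add: dual_space_def blinfun.scaleR_right)

text \<open>For scalar-valued operators the strong operator topology is the topology of pointwise
  convergence on the predual, that is, the weak* topology.\<close>

definition weak_star_topology ::
    "('k::real_normed_field \<Rightarrow> 'a::real_normed_vector \<Rightarrow> 'a) \<Rightarrow> ('a \<Rightarrow>\<^sub>L 'k) topology"
  where "weak_star_topology smul = subtopology strong_operator_topology (dual_space smul)"

definition weak_star_borel ::
    "('k::real_normed_field \<Rightarrow> 'a::real_normed_vector \<Rightarrow> 'a) \<Rightarrow> ('a \<Rightarrow>\<^sub>L 'k) measure"
  where "weak_star_borel smul = sigma (dual_space smul) {U. openin (weak_star_topology smul) U}"

definition weak_star_integral ::
    "'w measure \<Rightarrow> ('w \<Rightarrow> 'a::real_normed_vector \<Rightarrow>\<^sub>L 'k::{real_normed_field, euclidean_space}) \<Rightarrow> 'a \<Rightarrow>\<^sub>L 'k"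
  where "weak_star_integral M f = Blinfun (\<lambda>y. \<integral>w. blinfun_apply (f w) y \<partial>M)"

text \<open>Groups are written additively, since the library's class \<open>topological_group_add\<close>
  (which is not assumed commutative) is the one for topological groups: \<open>g + h\<close>, \<open>- g\<close>, \<open>0\<close> are
  the product, the inverse and the identity.\<close>

definition isometric_representation ::
    "('k::real_normed_field \<Rightarrow> 'a::real_normed_vector \<Rightarrow> 'a) \<Rightarrow> ('g::topological_group_add \<Rightarrow> 'a \<Rightarrow>\<^sub>L 'a) \<Rightarrow> bool"
  where "isometric_representation smul \<rho> \<longleftrightarrow>
    \<rho> 0 = id_blinfun \<and>
    (\<forall>g h. \<rho> (g + h) = \<rho> g o\<^sub>L \<rho> h) \<and>
    (\<forall>g c y. blinfun_apply (\<rho> g) (smul c y) = smul c (blinfun_apply (\<rho> g) y)) \<and>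
    (\<forall>g y. norm (blinfun_apply (\<rho> g) y) = norm y) \<and>
    (\<forall>y. continuous_on UNIV (\<lambda>g. blinfun_apply (\<rho> g) y))"

text \<open>\<open>\<pi>(g) = [\<pi>\<^sub>*(g\<^sup>-\<^sup>1)]\<^sup>*\<close>: the adjoint of an operator \<open>T\<close> is precomposition with \<open>T\<close>.\<close>

definition adjoint_representation ::
    "('g::group_add \<Rightarrow> 'a::real_normed_vector \<Rightarrow>\<^sub>L 'a) \<Rightarrow> 'g \<Rightarrow> ('a \<Rightarrow>\<^sub>L 'k::real_normed_field) \<Rightarrow> 'a \<Rightarrow>\<^sub>L 'k"
  where "adjoint_representation \<rho> g x = x o\<^sub>L \<rho> (- g)"

definition convolution_operator ::
    "('g::group_add \<Rightarrow> 'a::real_normed_vector \<Rightarrow>\<^sub>L 'a) \<Rightarrow> 'g measure \<Rightarrow>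
      ('a \<Rightarrow>\<^sub>L 'k::{real_normed_field, euclidean_space}) \<Rightarrow> 'a \<Rightarrow>\<^sub>L 'k"
  where "convolution_operator \<rho> \<sigma> x = weak_star_integral \<sigma> (\<lambda>g. adjoint_representation \<rho> g x)"

definition harmonic_elements ::
    "('k::{real_normed_field, euclidean_space} \<Rightarrow> 'a::real_normed_vector \<Rightarrow> 'a) \<Rightarrow>
      'g::group_add measure \<Rightarrow> ('g \<Rightarrow> 'a \<Rightarrow>\<^sub>L 'a) \<Rightarrow> ('a \<Rightarrow>\<^sub>L 'k) set"
  where "harmonic_elements smul \<mu> \<rho> = {x \<in> dual_space smul. convolution_operator \<rho> \<mu> x = x}"

definition harmonic_topology ::
    "('k::{real_normed_field, euclidean_space} \<Rightarrow> 'a::real_normed_vector \<Rightarrow> 'a) \<Rightarrow>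
      'g::group_add measure \<Rightarrow> ('g \<Rightarrow> 'a \<Rightarrow>\<^sub>L 'a) \<Rightarrow> ('a \<Rightarrow>\<^sub>L 'k) topology"
  where "harmonic_topology smul \<mu> \<rho> =
    subtopology (weak_star_topology smul) (harmonic_elements smul \<mu> \<rho>)"


section \<open>Haar measure and the random walk\<close>

text \<open>Regularity is not listed: it is automatic for locally finite Borel measures on
  locally compact second countable Hausdorff spaces.\<close>

definition left_haar_measure :: "'g::topological_group_add measure \<Rightarrow> bool"
  where "left_haar_measure M \<longleftrightarrow>
    sets M = sets borel \<and>
    emeasure M UNIV \<noteq> 0 \<and>
    (\<forall>K. compact K \<longrightarrow> emeasure M K < \<infinity>) \<and>
    (\<forall>g. \<forall>A\<in>sets borel. emeasure M ((+) g ` A) = emeasure M A)"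

abbreviation path_space :: "(nat \<Rightarrow> 'g::topological_space) measure"
  where "path_space \<equiv> Pi\<^sub>M UNIV (\<lambda>_. borel)"

definition path_shift :: "(nat \<Rightarrow> 'g) \<Rightarrow> nat \<Rightarrow> 'g"
  where "path_shift \<omega> = (\<lambda>n. \<omega> (Suc n))"

definition path_translate :: "'g::plus \<Rightarrow> (nat \<Rightarrow> 'g) \<Rightarrow> nat \<Rightarrow> 'g"
  where "path_translate g \<omega> = (\<lambda>n. g + \<omega> n)"

text \<open>The sets \<open>A\<close> with \<open>\<theta>\<^sup>-\<^sup>1(A) = A\<close> already form a \<open>\<sigma>\<close>-algebra.\<close>

definition invariant_algebra :: "(nat \<Rightarrow> 'g::topological_space) measure"
  where "invariant_algebra = sigma UNIV {A \<in> sets path_space. path_shift -` A = A}"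

text \<open>\<open>\<Pi>(g', A) = \<mu>(g'\<^sup>-\<^sup>1A)\<close>\<close>

definition walk_transition :: "'g::{topological_space, plus} measure \<Rightarrow> 'g \<Rightarrow> 'g measure"
  where "walk_transition \<mu> g' = distr \<mu> borel (\<lambda>h. g' + h)"

text \<open>Conditional law of the \<open>n\<close>-th position given the positions \<open>0, \<dots>, n - 1\<close>.\<close>

definition walk_kernel :: "'g::{topological_space, plus} measure \<Rightarrow> 'g \<Rightarrow> nat \<Rightarrow> (nat \<Rightarrow> 'g) \<Rightarrow> 'g measure"
  where "walk_kernel \<mu> g n \<omega> = (case n of 0 \<Rightarrow> return borel g | Suc m \<Rightarrow> walk_transition \<mu> (\<omega> m))"

text \<open>\<open>Q\<^sub>g\<close>, by the Ionescu-Tulcea construction. This is the constant \<open>PF.lim\<close> of locale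
  \<open>Ionescu_Tulcea\<close> for the kernels above.\<close>

definition walk_law :: "'g::{topological_space, plus} measure \<Rightarrow> 'g \<Rightarrow> (nat \<Rightarrow> 'g) measure"
  where "walk_law \<mu> g =
    projective_family.lim UNIV (Ionescu_Tulcea.CI (walk_kernel \<mu> g) (\<lambda>_. borel)) (\<lambda>_. borel)"

text \<open>\<open>Q\<^sub>\<nu>(A) = \<integral> Q\<^sub>g(A) \<nu>(dg)\<close>; the initial measure need not be finite.\<close>

definition walk_measure :: "'g::{topological_space, plus} measure \<Rightarrow> 'g measure \<Rightarrow> (nat \<Rightarrow> 'g) measure"
  where "walk_measure \<mu> \<nu> = Giry_Monad.bind \<nu> (walk_law \<mu>)"

lemma Ionescu_Tulcea_walk_kernel:
  fixes \<mu> :: "'g::{topological_group_add, second_countable_topology} measure"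
  assumes "prob_space \<mu>" and [measurable_cong]: "sets \<mu> = sets borel"
  shows "Ionescu_Tulcea (walk_kernel \<mu> g) (\<lambda>_. borel)"
proof -
  interpret prob_space \<mu> by fact
  have \<mu>: "\<mu> \<in> space (subprob_algebra borel)"
    using assms by (simp add: space_subprob_algebra prob_space_imp_subprob_space)
  have 1: "walk_kernel \<mu> g i \<in> Pi\<^sub>M {0..<i} (\<lambda>_. borel) \<rightarrow>\<^sub>M subprob_algebra borel" for i
  proof (cases i)
    case 0
    have "return borel g \<in> space (subprob_algebra borel)"
      by (simp add: space_subprob_algebra prob_space_imp_subprob_space prob_space_return)
    then show ?thesis
      by (simp add: 0 walk_kernel_def[abs_def])
  next
    case (Suc m)
    have "(\<lambda>\<omega>. distr \<mu> borel (\<lambda>h. \<omega> m + h)) \<in> Pi\<^sub>M {0..<Suc m} (\<lambda>_. borel) \<rightarrow>\<^sub>M subprob_algebra borel"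
    proof (rule measurable_distr2[where M = borel])
      show "(\<lambda>(\<omega>, h). \<omega> m + h) \<in> Pi\<^sub>M {0..<Suc m} (\<lambda>_. borel) \<Otimes>\<^sub>M borel \<rightarrow>\<^sub>M (borel :: 'g measure)"
        by measurable
      show "(\<lambda>\<omega>. \<mu>) \<in> Pi\<^sub>M {0..<Suc m} (\<lambda>_. borel) \<rightarrow>\<^sub>M subprob_algebra borel"
        using \<mu> by simp
    qed
    then show ?thesis
      by (simp add: Suc walk_kernel_def[abs_def] walk_transition_def)
  qed
  have 2: "prob_space (walk_kernel \<mu> g i \<omega>)" for i \<omega>
  proof (cases i)
    case 0
    then show ?thesis
      by (simp add: walk_kernel_def prob_space_return)
  next
    case (Suc m)
    have "(\<lambda>h. \<omega> m + h) \<in> \<mu> \<rightarrow>\<^sub>M borel"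
      by measurable
    then show ?thesis
      by (simp add: Suc walk_kernel_def walk_transition_def prob_space_distr)
  qed
  show ?thesis
    using 1 2 by (intro Ionescu_Tulcea.intro)
qed


section \<open>The space \<open>L\<^sup>\<infinity>\<^sub>i(\<mu>, E)\<close>\<close>

text \<open>In the following \<open>h\<close> is the left Haar measure and \<open>\<beta>\<close> a finite measure equivalent to it.\<close>

definition Linf_functions ::
    "('k::real_normed_field \<Rightarrow> 'a::real_normed_vector \<Rightarrow> 'a) \<Rightarrow> 'g::topological_group_add measure \<Rightarrow> 'g measure \<Rightarrow>
      ((nat \<Rightarrow> 'g) \<Rightarrow> 'a \<Rightarrow>\<^sub>L 'k) set"
  where "Linf_functions smul \<mu> h =
    {f \<in> invariant_algebra \<rightarrow>\<^sub>M weak_star_borel smul.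
      \<exists>C. AE \<omega> in walk_measure \<mu> h. norm (f \<omega>) \<le> C}"

definition ae_relation ::
    "('k::real_normed_field \<Rightarrow> 'a::real_normed_vector \<Rightarrow> 'a) \<Rightarrow> 'g::topological_group_add measure \<Rightarrow> 'g measure \<Rightarrow>
      (((nat \<Rightarrow> 'g) \<Rightarrow> 'a \<Rightarrow>\<^sub>L 'k) \<times> ((nat \<Rightarrow> 'g) \<Rightarrow> 'a \<Rightarrow>\<^sub>L 'k)) set"
  where "ae_relation smul \<mu> h =
    {(f, f'). f \<in> Linf_functions smul \<mu> h \<and> f' \<in> Linf_functions smul \<mu> h \<and>
      (AE \<omega> in walk_measure \<mu> h. f \<omega> = f' \<omega>)}"

definition Linf_class ::
    "('k::real_normed_field \<Rightarrow> 'a::real_normed_vector \<Rightarrow> 'a) \<Rightarrow> 'g::topological_group_add measure \<Rightarrow> 'g measure \<Rightarrow>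
      ((nat \<Rightarrow> 'g) \<Rightarrow> 'a \<Rightarrow>\<^sub>L 'k) \<Rightarrow> ((nat \<Rightarrow> 'g) \<Rightarrow> 'a \<Rightarrow>\<^sub>L 'k) set"
  where "Linf_class smul \<mu> h f = ae_relation smul \<mu> h `` {f}"

definition Linf ::
    "('k::real_normed_field \<Rightarrow> 'a::real_normed_vector \<Rightarrow> 'a) \<Rightarrow> 'g::topological_group_add measure \<Rightarrow> 'g measure \<Rightarrow>
      ((nat \<Rightarrow> 'g) \<Rightarrow> 'a \<Rightarrow>\<^sub>L 'k) set set"
  where "Linf smul \<mu> h = Linf_functions smul \<mu> h // ae_relation smul \<mu> h"

definition representative :: "'f set \<Rightarrow> 'f"
  where "representative c = (SOME f. f \<in> c)"

text \<open>The metric of the norm of \<open>L\<^sup>\<infinity>\<^sub>i(\<mu>, E)\<close>.\<close>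

definition Linf_dist ::
    "'g::topological_group_add measure \<Rightarrow> 'g measure \<Rightarrow>
      ((nat \<Rightarrow> 'g) \<Rightarrow> 'a::real_normed_vector \<Rightarrow>\<^sub>L 'k::real_normed_field) set \<Rightarrow> ((nat \<Rightarrow> 'g) \<Rightarrow> 'a \<Rightarrow>\<^sub>L 'k) set \<Rightarrow> ereal"
  where "Linf_dist \<mu> h c c' =
    esssup (walk_measure \<mu> h) (\<lambda>\<omega>. ereal (norm (representative c \<omega> - representative c' \<omega>)))"

definition predual_functions ::
    "'g::topological_group_add measure \<Rightarrow> 'g measure \<Rightarrow>
      ((nat \<Rightarrow> 'g) \<Rightarrow> 'a::{banach, second_countable_topology}) set"
  where "predual_functions \<mu> \<beta> =
    {\<phi>. integrable (restr_to_subalg (walk_measure \<mu> \<beta>) invariant_algebra) \<phi>}"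

definition Linf_pairing ::
    "'g::topological_group_add measure \<Rightarrow> 'g measure \<Rightarrow> ((nat \<Rightarrow> 'g) \<Rightarrow> 'a::real_normed_vector) \<Rightarrow>
      ((nat \<Rightarrow> 'g) \<Rightarrow> 'a \<Rightarrow>\<^sub>L 'k::{real_normed_field, euclidean_space}) set \<Rightarrow> 'k"
  where "Linf_pairing \<mu> \<beta> \<phi> c =
    (\<integral>\<omega>. blinfun_apply (representative c \<omega>) (\<phi> \<omega>) \<partial>restr_to_subalg (walk_measure \<mu> \<beta>) invariant_algebra)"

text \<open>The coarsest topology on \<open>L\<^sup>\<infinity>\<^sub>i(\<mu>, E)\<close> making all pairings with
  \<open>L\<^sup>1(G\<^sup>\<infinity>, B\<^sup>(\<^sup>i\<^sup>), Q\<^sub>\<beta>, E\<^sub>*)\<close> continuous.\<close>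

definition Linf_weak_star_topology ::
    "('k::{real_normed_field, euclidean_space} \<Rightarrow> 'a::{banach, second_countable_topology} \<Rightarrow> 'a) \<Rightarrow>
      'g::topological_group_add measure \<Rightarrow> 'g measure \<Rightarrow> 'g measure \<Rightarrow> ((nat \<Rightarrow> 'g) \<Rightarrow> 'a \<Rightarrow>\<^sub>L 'k) set topology"
  where "Linf_weak_star_topology smul \<mu> h \<beta> =
    pullback_topology (Linf smul \<mu> h)
      (\<lambda>c. \<lambda>\<phi>\<in>predual_functions \<mu> \<beta>. Linf_pairing \<mu> \<beta> \<phi> c)
      (product_topology (\<lambda>_. euclidean) (predual_functions \<mu> \<beta>))"


section \<open>The equivariant subspace and the map \<open>R\<^sub>\<pi>\<close>\<close>

definition equivariant_Linf ::
    "('k::real_normed_field \<Rightarrow> 'a::real_normed_vector \<Rightarrow> 'a) \<Rightarrow> 'g::topological_group_add measure \<Rightarrow> 'g measure \<Rightarrow>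
      ('g \<Rightarrow> 'a \<Rightarrow>\<^sub>L 'a) \<Rightarrow> ((nat \<Rightarrow> 'g) \<Rightarrow> 'a \<Rightarrow>\<^sub>L 'k) set set"
  where "equivariant_Linf smul \<mu> h \<rho> =
    {Linf_class smul \<mu> h f | f. f \<in> Linf_functions smul \<mu> h \<and>
      (\<forall>g. AE \<omega> in walk_measure \<mu> h. f (path_translate g \<omega>) = adjoint_representation \<rho> g (f \<omega>))}"

definition equivariant_Linf_topology ::
    "('k::{real_normed_field, euclidean_space} \<Rightarrow> 'a::{banach, second_countable_topology} \<Rightarrow> 'a) \<Rightarrow>
      'g::topological_group_add measure \<Rightarrow> 'g measure \<Rightarrow> 'g measure \<Rightarrow> ('g \<Rightarrow> 'a \<Rightarrow>\<^sub>L 'a) \<Rightarrow>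
      ((nat \<Rightarrow> 'g) \<Rightarrow> 'a \<Rightarrow>\<^sub>L 'k) set topology"
  where "equivariant_Linf_topology smul \<mu> h \<beta> \<rho> =
    subtopology (Linf_weak_star_topology smul \<mu> h \<beta>) (equivariant_Linf smul \<mu> h \<rho>)"

definition strict_equivariant_functions ::
    "('k::real_normed_field \<Rightarrow> 'a::real_normed_vector \<Rightarrow> 'a) \<Rightarrow> ('g::topological_group_add \<Rightarrow> 'a \<Rightarrow>\<^sub>L 'a) \<Rightarrow>
      ((nat \<Rightarrow> 'g) \<Rightarrow> 'a \<Rightarrow>\<^sub>L 'k) set"
  where "strict_equivariant_functions smul \<rho> =
    {f \<in> invariant_algebra \<rightarrow>\<^sub>M weak_star_borel smul. bounded (range f) \<and>
      (\<forall>g \<omega>. f (path_translate g \<omega>) = adjoint_representation \<rho> g (f \<omega>))}"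

text \<open>The value of \<open>R\<^sub>\<pi>\<close> at a class is computed from an arbitrarily chosen strictly equivariant
  representative.\<close>

definition boundary_map ::
    "('k::{real_normed_field, euclidean_space} \<Rightarrow> 'a::real_normed_vector \<Rightarrow> 'a) \<Rightarrow>
      'g::topological_group_add measure \<Rightarrow> 'g measure \<Rightarrow> ('g \<Rightarrow> 'a \<Rightarrow>\<^sub>L 'a) \<Rightarrow>
      ((nat \<Rightarrow> 'g) \<Rightarrow> 'a \<Rightarrow>\<^sub>L 'k) set \<Rightarrow> 'a \<Rightarrow>\<^sub>L 'k"
  where "boundary_map smul \<mu> h \<rho> c =
    weak_star_integral (walk_law \<mu> 0)
      (SOME f. f \<in> strict_equivariant_functions smul \<rho> \<and> Linf_class smul \<mu> h f = c)"

end

theory Submission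
  imports Defs
begin

text \<open>
  A harmonic element \<open>x\<close> is the mean of its \<open>\<mu>\<close>-translates, so \<open>\<pi>(w\<^sub>n)x\<close> is a bounded martingale along
  the random walk \<open>w\<close>, tested against any vector of the predual. It converges almost surely, and
  since the predual is separable there is almost surely a weak* limit \<open>boundary_fun x w\<close>. Set to
  \<open>0\<close> where there is no limit, this is a strictly equivariant, shift-invariant function of the path,
  bounded by \<open>\<parallel>x\<parallel>\<close>, and its mean under \<open>Q\<^sub>e\<close> is \<open>x\<close>. So it is a right inverse of \<open>R\<^sub>\<pi>\<close>.

  That it is also a left inverse is \<open>equivariant_eq_boundary_fun\<close>. The means \<open>F(g)\<close> of an
  equivariant \<open>f\<close> under \<open>Q\<^sub>g\<close> satisfy \<open>F(gh) = \<pi>(g)F(h)\<close> almost everywhere, and Fubini's theorem turns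
  this into \<open>F(g) = \<pi>(g)x\<close> with a single \<open>x\<close>, harmonic because \<open>f\<close> is shift-invariant. By the Markov
  property \<open>F(w\<^sub>n)\<close> is the conditional expectation of \<open>f\<close> given the first \<open>n\<close> steps, and \<open>f\<close> is
  recovered as the limit of \<open>F(w\<^sub>n) = \<pi>(w\<^sub>n)x\<close>. The same lemma supplies every class of \<open>L\<^sub>\<mu>\<^sub>\<pi>\<close> with a
  strictly equivariant representative. The norm of such a function is constant along translates of a
  path, so its essential supremum is the same under all \<open>Q\<^sub>g\<close>; hence \<open>R\<^sub>\<pi>\<close> is isometric.

  For the topologies it is shown that, on harmonic \<open>x\<close>, evaluations at vectors \<open>y\<close> of the predual and
  pairings of \<open>boundary_fun x\<close> with integrable \<open>\<phi>\<close> are the same functionals. Both inclusions rest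
  on \<open>integral_boundary_fun\<close>: for \<open>Z\<close> depending on the path up to time \<open>n\<close>, the pairing with \<open>Z\<close> is
  the evaluation at the mean of \<open>\<pi>\<^sub>*(w\<^sub>n\<^sup>-\<^sup>1)Z\<close>. A general \<open>\<phi>\<close> is approximated by such \<open>Z\<close>, and a vector \<open>y\<close>
  by means of \<open>\<pi>\<^sub>*(g\<^sup>-\<^sup>1)y\<close> over small neighbourhoods of the identity; each time the error is fed back
  into the construction and the corrections form an absolutely convergent series.
\<close>

section \<open>The random walk as a function of independent increments\<close>

primrec walk_path :: "'g::monoid_add \<Rightarrow> (nat \<Rightarrow> 'g) \<Rightarrow> nat \<Rightarrow> 'g" where
  "walk_path g \<xi> 0 = g"
| "walk_path g \<xi> (Suc n) = walk_path g \<xi> n + \<xi> n"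

lemma walk_path_translate: "path_translate k (walk_path g \<xi>) = walk_path (k + g) \<xi>"
proof
  fix n
  show "path_translate k (walk_path g \<xi>) n = walk_path (k + g) \<xi> n"
    by (induction n) (simp_all add: path_translate_def add.assoc[symmetric])
qed

lemma walk_path_cong: "(\<And>i. i < n \<Longrightarrow> \<xi> i = \<xi>' i) \<Longrightarrow> walk_path g \<xi> n = walk_path g \<xi>' n"
  by (induction n) simp_all

lemma walk_path_comb_seq_le: "j \<le> n \<Longrightarrow> walk_path g (comb_seq n \<xi> \<xi>') j = walk_path g \<xi> j"
  by (rule walk_path_cong) (simp add: comb_seq_less)

lemma walk_path_comb_seq_add:
  "walk_path g (comb_seq n \<xi> \<xi>') (n + j) = walk_path (walk_path g \<xi> n) \<xi>' j"
  by (induction j) (simp_all add: walk_path_comb_seq_le comb_seq_add[of n, simplified add.commute[of _ n]])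

lemma path_shift_walk_path_case_nat: "path_shift (walk_path g (case_nat k \<xi>)) = walk_path (g + k) \<xi>"
proof
  show "path_shift (walk_path g (case_nat k \<xi>)) n = walk_path (g + k) \<xi> n" for n
    by (induction n) (simp_all add: path_shift_def)
qed

lemma walk_path_eq_add: "walk_path g \<xi> n = g + walk_path 0 \<xi> n" for g :: "'g::monoid_add"
  using fun_cong[OF walk_path_translate[of g 0 \<xi>], of n] by (simp add: path_translate_def)

lemma measurable_walk_path[measurable]:
  "(\<lambda>(g, \<xi>). walk_path g \<xi>) \<in> (borel \<Otimes>\<^sub>M path_space) \<rightarrow>\<^sub>M
    (path_space :: (nat \<Rightarrow> 'g::{topological_group_add, second_countable_topology}) measure)"
proof (rule measurable_PiM_single')
  fix n :: nat
  show "(\<lambda>x. (case x of (g, \<xi>) \<Rightarrow> walk_path g \<xi>) n) \<in>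
      (borel \<Otimes>\<^sub>M (path_space :: (nat \<Rightarrow> 'g) measure)) \<rightarrow>\<^sub>M (borel :: 'g measure)"
  proof (induction n)
    case 0
    then show ?case by (simp add: split_beta')
  next
    case (Suc n)
    then show ?case by (simp add: split_beta')
  qed
qed simp_all

lemma measurable_walk_path'[measurable (raw)]:
  fixes f :: "'w \<Rightarrow> 'g::{topological_group_add, second_countable_topology}"
  assumes "f \<in> M \<rightarrow>\<^sub>M borel" "h \<in> M \<rightarrow>\<^sub>M path_space"
  shows "(\<lambda>w. walk_path (f w) (h w)) \<in> M \<rightarrow>\<^sub>M path_space"
  using measurable_compose[OF measurable_Pair[OF assms] measurable_walk_path] by simp

lemma measurable_walk_path_component[measurable (raw)]:
  fixes f :: "'w \<Rightarrow> 'g::{topological_group_add, second_countable_topology}"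
  assumes "f \<in> M \<rightarrow>\<^sub>M borel" "h \<in> M \<rightarrow>\<^sub>M path_space"
  shows "(\<lambda>w. walk_path (f w) (h w) n) \<in> M \<rightarrow>\<^sub>M borel"
  using measurable_compose[OF measurable_walk_path'[OF assms] measurable_component_singleton[of n UNIV]]
  by simp

lemma space_path_space[simp]: "space path_space = UNIV"
  by (simp add: space_PiM)

locale random_walk = prob_space \<mu>
  for \<mu> :: "'g::{topological_group_add, t2_space, second_countable_topology} measure" +
  assumes sets_\<mu>[measurable_cong]: "sets \<mu> = sets borel"
begin

abbreviation increments :: "(nat \<Rightarrow> 'g) measure"
  where "increments \<equiv> Pi\<^sub>M UNIV (\<lambda>_. \<mu>)"

lemma sets_increments[measurable_cong]: "sets increments = sets path_space"
  by (intro sets_PiM_cong) (simp_all add: sets_\<mu>)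

lemma space_\<mu>[simp]: "space \<mu> = UNIV"
  using sets_eq_imp_space_eq[OF sets_\<mu>] by simp

lemma space_increments[simp]: "space increments = UNIV"
  by (simp add: space_PiM)

sublocale inc: sequence_space \<mu>
  by (auto simp: sequence_space_def intro!: product_prob_spaceI prob_space_axioms)

sublocale inc: prob_space increments
  by (rule prob_space_PiM) (rule prob_space_axioms)

lemma measure_increments_UNIV[simp]: "measure increments UNIV = 1"
  by (simp add: measure_def inc.emeasure_space_1[simplified])

text \<open>The increments from time \<open>n\<close> on are an independent copy of the whole sequence.\<close>

lemma nn_integral_increments_split:
  assumes [measurable]: "f \<in> borel_measurable path_space"
  shows "(\<integral>\<^sup>+\<xi>. f \<xi> \<partial>increments) = (\<integral>\<^sup>+\<xi>. \<integral>\<^sup>+\<xi>'. f (comb_seq n \<xi> \<xi>') \<partial>increments \<partial>increments)"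
proof -
  have "(\<integral>\<^sup>+\<xi>. f \<xi> \<partial>increments)
      = (\<integral>\<^sup>+\<xi>. f \<xi> \<partial>distr (increments \<Otimes>\<^sub>M increments) increments (\<lambda>(\<xi>, \<xi>'). comb_seq n \<xi> \<xi>'))"
    by (simp add: inc.PiM_comb_seq)
  also have "\<dots> = (\<integral>\<^sup>+z. f (comb_seq n (fst z) (snd z)) \<partial>(increments \<Otimes>\<^sub>M increments))"
    by (subst nn_integral_distr) (simp_all add: split_beta')
  also have "\<dots> = (\<integral>\<^sup>+\<xi>. \<integral>\<^sup>+\<xi>'. f (comb_seq n \<xi> \<xi>') \<partial>increments \<partial>increments)"
    by (subst inc.nn_integral_fst[symmetric]) simp_all
  finally show ?thesis .
qed

lemma nn_integral_increments_first:
  assumes [measurable]: "f \<in> borel_measurable borel"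
  shows "(\<integral>\<^sup>+\<xi>. f (\<xi> 0) \<partial>increments) = (\<integral>\<^sup>+k. f k \<partial>\<mu>)"
proof -
  have "(\<integral>\<^sup>+k. f k \<partial>\<mu>) = (\<integral>\<^sup>+k. f k \<partial>distr increments \<mu> (\<lambda>\<xi>. \<xi> 0))"
    by (simp add: inc.PiM_component)
  then show ?thesis
    by (simp add: nn_integral_distr)
qed

text \<open>The kernels of the Ionescu-Tulcea construction look only at the last position and add an
  independent increment. Hence both measures have the same marginals on the first \<open>n\<close> coordinates, by
  induction on \<open>n\<close>, and these determine a measure on path space.\<close>

lemma walk_law_eq: "walk_law \<mu> g = distr increments path_space (walk_path g)"
proof -
  interpret IT: Ionescu_Tulcea "walk_kernel \<mu> g" "\<lambda>_. borel"
    by (rule Ionescu_Tulcea_walk_kernel[OF prob_space_axioms sets_\<mu>])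
  let ?B = "\<lambda>n. Pi\<^sub>M {0..<n} (\<lambda>_. borel) :: (nat \<Rightarrow> 'g) measure"
  have [measurable]: "(\<lambda>\<xi>. restrict (walk_path g \<xi>) {0..<n}) \<in> path_space \<rightarrow>\<^sub>M ?B n" for n
    by measurable
  have C: "IT.C 0 n (\<lambda>_. undefined) = distr increments (?B n) (\<lambda>\<xi>. restrict (walk_path g \<xi>) {0..<n})" for n
  proof (induction n)
    case 0
    have "distr increments (?B 0) (\<lambda>\<xi>. \<lambda>_. undefined) = return (?B 0) (\<lambda>_. undefined)"
      by (rule measure_eqI) (auto simp: emeasure_distr inc.emeasure_space_1[simplified] space_PiM
          split: split_indicator)
    then show ?case by (simp add: restrict_def)
  next
    case (Suc n)
    let ?L = "IT.C 0 (Suc n) (\<lambda>_. undefined)"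
    let ?R = "distr increments (?B (Suc n)) (\<lambda>\<xi>. restrict (walk_path g \<xi>) {0..<Suc n})"
    have sets_L: "sets ?L = sets (?B (Suc n))"
      using IT.sets_C[of "\<lambda>_. undefined" 0 "Suc n"] by simp
    show ?case
    proof (rule measure_eqI)
      show "sets ?L = sets ?R" using sets_L by simp
      fix A assume "A \<in> sets ?L"
      then have A[measurable]: "A \<in> sets (?B (Suc n))" using sets_L by simp
      let ?f = "indicator A :: (nat \<Rightarrow> 'g) \<Rightarrow> ennreal"
      have upd: "(\<lambda>(w, k). w(n := k)) \<in> ?B n \<Otimes>\<^sub>M borel \<rightarrow>\<^sub>M ?B (Suc n)"
        unfolding split_beta' by (rule measurable_fun_upd[where J="{0..<n}"]) auto
      have [measurable]: "(\<lambda>w. \<integral>\<^sup>+k. ?f (w(n := k)) \<partial>walk_kernel \<mu> g n w) \<in> borel_measurable (?B n)"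
        using nn_integral_measurable_subprob_algebra2[of "\<lambda>w k. ?f (w(n := k))" "?B n" borel,
            OF _ IT.P[of n]] measurable_compose[OF upd borel_measurable_indicator[OF A]]
        by (simp add: split_beta')
      have L: "emeasure ?L A = (\<integral>\<^sup>+\<xi>. \<integral>\<^sup>+k. ?f ((restrict (walk_path g \<xi>) {0..<n})(n := k))
          \<partial>walk_kernel \<mu> g n (restrict (walk_path g \<xi>) {0..<n}) \<partial>increments)"
      proof -
        have "emeasure ?L A = (\<integral>\<^sup>+w. emeasure (IT.eP n w) A \<partial>IT.C 0 n (\<lambda>_. undefined))"
          by (simp, subst emeasure_bind[of _ _ "?B (Suc n)"])
            (auto simp: Suc.IH space_PiM intro: IT.measurable_eP[simplified])
        also have "\<dots> = (\<integral>\<^sup>+w. \<integral>\<^sup>+k. ?f (w(n := k)) \<partial>walk_kernel \<mu> g n w \<partial>IT.C 0 n (\<lambda>_. undefined))"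
        proof (intro nn_integral_cong)
          fix w assume "w \<in> space (IT.C 0 n (\<lambda>_. undefined))"
          then have w: "w \<in> space (?B n)" by (simp add: Suc.IH)
          have "emeasure (IT.eP n w) A = (\<integral>\<^sup>+v. ?f v \<partial>IT.eP n w)"
            using IT.sets_eP[OF w] by (subst nn_integral_indicator) auto
          then show "emeasure (IT.eP n w) A = (\<integral>\<^sup>+k. ?f (w(n := k)) \<partial>walk_kernel \<mu> g n w)"
            using IT.nn_integral_eP[OF w, of ?f] by simp
        qed
        also have "\<dots> = (\<integral>\<^sup>+\<xi>. \<integral>\<^sup>+k. ?f ((restrict (walk_path g \<xi>) {0..<n})(n := k))
          \<partial>walk_kernel \<mu> g n (restrict (walk_path g \<xi>) {0..<n}) \<partial>increments)"
          unfolding Suc.IH by (subst nn_integral_distr) simp_all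
        finally show ?thesis .
      qed
      have fu: "(restrict w {0..<n})(n := w n) = restrict w {0..<Suc n}" for w :: "nat \<Rightarrow> 'g"
        by auto
      have fu': "(restrict w {0..<n})(n := k) = restrict (w(n := k)) {0..<Suc n}" for w :: "nat \<Rightarrow> 'g" and k
        by auto
      have R: "emeasure ?R A = (\<integral>\<^sup>+\<xi>. ?f (restrict (walk_path g \<xi>) {0..<Suc n}) \<partial>increments)"
        by (subst nn_integral_indicator[symmetric]) (simp_all add: nn_integral_distr del: nn_integral_indicator)
      show "emeasure ?L A = emeasure ?R A"
      proof (cases n)
        case 0
        have "emeasure ?R A = ?f (\<lambda>i\<in>{0..<Suc 0}. g)"
        proof -
          have "restrict (walk_path g \<xi>) {0..<Suc 0} = (\<lambda>i\<in>{0..<Suc 0}. g)" for \<xi>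
            by auto
          with R show ?thesis unfolding 0
            by (simp add: inc.emeasure_space_1[simplified] del: atLeastLessThan_singleton One_nat_def)
        qed
        moreover have "emeasure ?L A = ?f (\<lambda>i\<in>{0..<Suc 0}. g)"
        proof -
          have "(restrict (walk_path g \<xi>) {0..<0})(0 := k) = (\<lambda>i\<in>{0..<Suc 0}. k)" for \<xi> k
            by auto
          moreover have "(\<lambda>k. ?f (\<lambda>i\<in>{0..<Suc 0}. k)) \<in> borel_measurable borel"
          proof -
            have "(\<lambda>k. \<lambda>i\<in>{0..<Suc 0}. k) \<in> borel \<rightarrow>\<^sub>M ?B (Suc 0)"
              by measurable
            from measurable_compose[OF this borel_measurable_indicator, of A] show ?thesis
              using A 0 by simp
          qed
          ultimately show ?thesis using L unfolding 0
            by (simp del: atLeastLessThan_singleton IT.C.simps add: walk_kernel_def nn_integral_return inc.emeasure_space_1[simplified])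
        qed
        ultimately show ?thesis by simp
      next
        case (Suc m)
        let ?w = "\<lambda>\<xi> h. restrict ((walk_path g \<xi>)(n := walk_path g \<xi> m + h)) {0..<Suc n}"
        have split: "?f (restrict (walk_path g (comb_seq m \<xi> \<xi>')) {0..<Suc n}) = ?f (?w \<xi> (\<xi>' 0))" for \<xi> \<xi>'
        proof (rule arg_cong[where f = ?f], rule ext)
          fix j
          show "restrict (walk_path g (comb_seq m \<xi> \<xi>')) {0..<Suc n} j = ?w \<xi> (\<xi>' 0) j"
          proof (cases "j = n")
            case True
            then show ?thesis
              using walk_path_comb_seq_add[of g m \<xi> \<xi>' 1] by (simp add: Suc)
          next
            case False
            then show ?thesis
              by (auto simp: Suc walk_path_comb_seq_le)
          qed
        qed
        have m1: "(\<lambda>h. ?f (?w \<xi> h)) \<in> borel_measurable borel" for \<xi>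
        proof -
          have "(\<lambda>h. ?w \<xi> h) \<in> borel \<rightarrow>\<^sub>M ?B (Suc n)"
            by (intro measurable_restrict) (auto simp: fun_upd_def)
          from measurable_compose[OF this borel_measurable_indicator[OF A]] show ?thesis by simp
        qed
        have "emeasure ?R A = (\<integral>\<^sup>+\<xi>. \<integral>\<^sup>+\<xi>'. ?f (?w \<xi> (\<xi>' 0)) \<partial>increments \<partial>increments)"
        proof -
          have "(\<lambda>\<xi>. ?f (restrict (walk_path g \<xi>) {0..<Suc n})) \<in> borel_measurable path_space"
            by measurable
          from nn_integral_increments_split[OF this, of m] show ?thesis
            unfolding R split .
        qed
        also have "\<dots> = (\<integral>\<^sup>+\<xi>. \<integral>\<^sup>+h. ?f (?w \<xi> h) \<partial>\<mu> \<partial>increments)"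
          using nn_integral_increments_first[OF m1] by simp
        also have "\<dots> = emeasure ?L A"
          unfolding L fu'
        proof (intro nn_integral_cong)
          fix \<xi>
          have m2: "(\<lambda>k. ?f (restrict ((walk_path g \<xi>)(n := k)) {0..<Suc n})) \<in> borel_measurable borel"
          proof -
            have "(\<lambda>h. restrict ((walk_path g \<xi>)(n := h)) {0..<Suc n}) \<in> borel \<rightarrow>\<^sub>M ?B (Suc n)"
              by (intro measurable_restrict) (auto simp: fun_upd_def)
            from measurable_compose[OF this borel_measurable_indicator[OF A]] show ?thesis by simp
          qed
          show "(\<integral>\<^sup>+h. ?f (?w \<xi> h) \<partial>\<mu>) = (\<integral>\<^sup>+k. ?f (restrict ((walk_path g \<xi>)(n := k)) {0..<Suc n})
             \<partial>walk_kernel \<mu> g n (restrict (walk_path g \<xi>) {0..<n}))"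
            using m2 by (simp add: walk_kernel_def Suc walk_transition_def nn_integral_distr)
        qed
        finally show ?thesis by simp
      qed
    qed
  qed
  have sets_law: "sets (walk_law \<mu> g) = sets path_space"
    unfolding walk_law_def by simp
  show ?thesis
  proof (rule sym, rule measure_eqI_PiM_infinite[where I = UNIV and M = "\<lambda>_. borel"])
    show "sets (walk_law \<mu> g) = sets path_space" by (rule sets_law)
    show "finite_measure (distr increments path_space (walk_path g))"
      by (rule inc.finite_measure_distr) simp
    fix A :: "nat \<Rightarrow> 'g set" and J :: "nat set"
    assume J: "finite J" "J \<subseteq> UNIV" and A: "\<And>i. i \<in> J \<Longrightarrow> A i \<in> sets borel"
    let ?E = "prod_emb UNIV (\<lambda>_. borel) J (Pi\<^sub>E J A)"
    have PE: "Pi\<^sub>E J A \<in> sets (Pi\<^sub>M J (\<lambda>_. borel))"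
      using J A by (intro sets_PiM_I_finite) auto
    obtain n where n: "J \<subseteq> {0..<n}"
      using J(1) finite_nat_set_iff_bounded[of J] by (metis atLeastLessThan_iff subsetI zero_le)
    have E': "prod_emb {0..<n} (\<lambda>_. borel) J (Pi\<^sub>E J A) \<in> sets (?B n)"
      using n PE by (intro measurable_prod_emb) auto
    have "emeasure (walk_law \<mu> g) ?E = emeasure (IT.CI J) (Pi\<^sub>E J A)"
      unfolding walk_law_def by (rule IT.lim[OF J(1) PE])
    also have "\<dots> = emeasure (IT.C 0 n (\<lambda>_. undefined)) (prod_emb {0..<n} (\<lambda>_. borel) J (Pi\<^sub>E J A))"
      by (rule IT.emeasure_CI[OF n PE])
    also have "\<dots> = emeasure increments ((\<lambda>\<xi>. restrict (walk_path g \<xi>) {0..<n}) -`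
        prod_emb {0..<n} (\<lambda>_. borel) J (Pi\<^sub>E J A))"
      unfolding C using E' by (subst emeasure_distr) simp_all
    also have "(\<lambda>\<xi>. restrict (walk_path g \<xi>) {0..<n}) -` prod_emb {0..<n} (\<lambda>_. borel) J (Pi\<^sub>E J A)
        = walk_path g -` ?E"
      using n by (auto simp: prod_emb_def PiE_iff restrict_restrict Int_absorb1 space_PiM)
    also have "emeasure increments (walk_path g -` ?E) = emeasure (distr increments path_space (walk_path g)) ?E"
      using J A by (subst emeasure_distr) (auto intro!: sets_PiM_I)
    finally show "emeasure (distr increments path_space (walk_path g)) ?E = emeasure (walk_law \<mu> g) ?E" by simp
  qed simp_all
qed

lemma measurable_walk_law[measurable]: "walk_law \<mu> \<in> borel \<rightarrow>\<^sub>M subprob_algebra path_space"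
proof -
  have "increments \<in> space (subprob_algebra path_space)"
    by (simp add: space_subprob_algebra sets_increments prob_space_imp_subprob_space inc.prob_space_axioms)
  then have "(\<lambda>g. distr increments path_space (walk_path g)) \<in> borel \<rightarrow>\<^sub>M subprob_algebra path_space"
    by (intro measurable_distr2[where M = path_space]) simp_all
  then show ?thesis
    by (simp add: walk_law_eq[abs_def])
qed

lemma sets_walk_law[simp, measurable_cong]: "sets (walk_law \<mu> g) = sets path_space"
  by (simp add: walk_law_eq)

lemma sets_walk_measure:
  assumes "sets \<nu> = sets borel"
  shows "sets (walk_measure \<mu> \<nu>) = sets path_space"
  unfolding walk_measure_def using sets_eq_imp_space_eq[OF assms]
  by (intro sets_bind) auto

lemma emeasure_walk_measure:
  assumes \<nu>[measurable_cong]: "sets \<nu> = sets borel" and A: "A \<in> sets path_space"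
  shows "emeasure (walk_measure \<mu> \<nu>) A = (\<integral>\<^sup>+g. emeasure (walk_law \<mu> g) A \<partial>\<nu>)"
  unfolding walk_measure_def using sets_eq_imp_space_eq[OF \<nu>]
  by (intro emeasure_bind[where N = path_space] A) auto

lemma walk_measure_return: "walk_measure \<mu> (return borel g) = walk_law \<mu> g"
  unfolding walk_measure_def by (rule bind_return[OF measurable_walk_law]) simp

end

section \<open>The Markov property\<close>

text \<open>The functions \<open>f\<close> determined by the path up to time \<open>n\<close> are those with
  \<open>f (stopped n w) = f w\<close>; this condition expresses adaptedness.\<close>

definition stopped :: "nat \<Rightarrow> (nat \<Rightarrow> 'g) \<Rightarrow> nat \<Rightarrow> 'g"
  where "stopped n w = (\<lambda>i. w (min i n))"

definition after :: "nat \<Rightarrow> (nat \<Rightarrow> 'g) \<Rightarrow> nat \<Rightarrow> 'g"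
  where "after n w = (\<lambda>i. w (n + i))"

lemma measurable_stopped[measurable]:
  "stopped n \<in> path_space \<rightarrow>\<^sub>M (path_space :: (nat \<Rightarrow> 'g::topological_space) measure)"
  unfolding stopped_def[abs_def] by (rule measurable_PiM_single') (auto intro: measurable_component_singleton)

lemma measurable_after[measurable]:
  "after n \<in> path_space \<rightarrow>\<^sub>M (path_space :: (nat \<Rightarrow> 'g::topological_space) measure)"
  unfolding after_def[abs_def] by (rule measurable_PiM_single') (auto intro: measurable_component_singleton)

lemma stopped_apply: "i \<le> n \<Longrightarrow> stopped n w i = w i"
  by (simp add: stopped_def min_def)

lemma stopped_stopped: "m \<le> n \<Longrightarrow> stopped m (stopped n w) = stopped m w"
  by (auto simp: stopped_def fun_eq_iff min.assoc min.absorb1)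

lemma after_Suc: "after (Suc n) w = path_shift (after n w)"
  by (simp add: after_def path_shift_def)

lemma shift_invariant_after: "f \<circ> path_shift = f \<Longrightarrow> f (after n w) = f w"
  by (induction n) (simp_all add: after_def[of 0] after_Suc fun_eq_iff)

text \<open>The law of the walk is needed for two initial measures, the point mass at the identity and a finite
  measure equivalent to Haar measure.\<close>

locale random_walk_start = random_walk \<mu> + init: finite_measure \<nu>
  for \<mu> :: "'g::{topological_group_add, t2_space, second_countable_topology} measure"
    and \<nu> :: "'g measure" +
  assumes sets_\<nu>[measurable_cong]: "sets \<nu> = sets borel"
begin

abbreviation Q :: "(nat \<Rightarrow> 'g) measure" where "Q \<equiv> walk_measure \<mu> \<nu>"

lemma space_\<nu>[simp]: "space \<nu> = UNIV"
  using sets_eq_imp_space_eq[OF sets_\<nu>] by simp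

lemma sets_Q[measurable_cong]: "sets Q = sets path_space"
  by (rule sets_walk_measure[OF sets_\<nu>])

lemma space_Q[simp]: "space Q = UNIV"
  using sets_eq_imp_space_eq[OF sets_Q] by simp

lemma Q_eq: "Q = distr (\<nu> \<Otimes>\<^sub>M increments) path_space (\<lambda>(g, \<xi>). walk_path g \<xi>)" (is "_ = ?R")
proof (rule measure_eqI)
  show "sets Q = sets ?R" by (simp add: sets_Q)
  fix A assume "A \<in> sets Q"
  then have A[measurable]: "A \<in> sets path_space" by (simp add: sets_Q)
  have "emeasure ?R A = (\<integral>\<^sup>+z. indicator A (walk_path (fst z) (snd z)) \<partial>(\<nu> \<Otimes>\<^sub>M increments))"
    by (subst nn_integral_indicator[symmetric]) (simp_all add: nn_integral_distr split_beta' del: nn_integral_indicator)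
  also have "\<dots> = (\<integral>\<^sup>+g. \<integral>\<^sup>+\<xi>. indicator A (walk_path g \<xi>) \<partial>increments \<partial>\<nu>)"
    by (subst inc.nn_integral_fst[symmetric]) simp_all
  also have "\<dots> = (\<integral>\<^sup>+g. emeasure (walk_law \<mu> g) A \<partial>\<nu>)"
    by (intro nn_integral_cong, subst nn_integral_indicator[symmetric])
       (simp_all add: walk_law_eq nn_integral_distr del: nn_integral_indicator)
  also have "\<dots> = emeasure Q A"
    by (simp add: emeasure_walk_measure[OF sets_\<nu> A])
  finally show "emeasure Q A = emeasure ?R A" by simp
qed

sublocale inc_pair: pair_sigma_finite \<nu> increments ..

sublocale Q: finite_measure Q
proof -
  interpret P: finite_measure "\<nu> \<Otimes>\<^sub>M increments"
    by (rule finite_measure_pair_measure) unfold_locales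
  show "finite_measure Q"
    unfolding Q_eq by (rule P.finite_measure_distr) simp
qed

lemma AE_Q_walk_path:
  assumes "AE w in Q. P w"
  shows "AE g in \<nu>. AE \<xi> in increments. P (walk_path g \<xi>)"
proof -
  have "AE z in \<nu> \<Otimes>\<^sub>M increments. P (case z of (g, \<xi>) \<Rightarrow> walk_path g \<xi>)"
    using assms unfolding Q_eq by (rule AE_distrD[rotated]) simp
  from inc_pair.AE_pair[OF this] show ?thesis by simp
qed

lemma nn_integral_Q:
  assumes [measurable]: "f \<in> borel_measurable path_space"
  shows "(\<integral>\<^sup>+w. f w \<partial>Q) = (\<integral>\<^sup>+g. \<integral>\<^sup>+\<xi>. f (walk_path g \<xi>) \<partial>increments \<partial>\<nu>)"
  unfolding Q_eq by (simp add: nn_integral_distr split_beta' inc.nn_integral_fst[symmetric])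

lemma AE_Q_iff:
  assumes [measurable]: "Measurable.pred path_space P"
  shows "(AE w in Q. P w) \<longleftrightarrow> (AE g in \<nu>. AE \<xi> in increments. P (walk_path g \<xi>))"
proof -
  have "{w \<in> space path_space. P w} \<in> sets path_space"
    by measurable
  from AE_distr_iff[OF _ this, of "\<lambda>(g, \<xi>). walk_path g \<xi>" "\<nu> \<Otimes>\<^sub>M increments"]
  have "(AE w in Q. P w) \<longleftrightarrow> (AE z in \<nu> \<Otimes>\<^sub>M increments. P (walk_path (fst z) (snd z)))"
    unfolding Q_eq by (simp add: split_beta')
  also have "\<dots> \<longleftrightarrow> (AE g in \<nu>. AE \<xi> in increments. P (walk_path g \<xi>))"
    by (rule inc_pair.AE_pair_iff[symmetric]) measurable
  finally show ?thesis .
qed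

lemma integral_Q:
  fixes f :: "(nat \<Rightarrow> 'g) \<Rightarrow> 'b::{banach, second_countable_topology}"
  assumes f: "integrable Q f"
  shows "(\<integral>w. f w \<partial>Q) = (\<integral>g. \<integral>\<xi>. f (walk_path g \<xi>) \<partial>increments \<partial>\<nu>)"
proof -
  have [measurable]: "f \<in> borel_measurable path_space"
    using borel_measurable_integrable[OF f] by simp
  have "integrable (\<nu> \<Otimes>\<^sub>M increments) (\<lambda>(g, \<xi>). f (walk_path g \<xi>))"
    using f unfolding Q_eq by (subst (asm) integrable_distr_eq) (simp_all add: split_beta')
  from inc_pair.integral_fst'[OF this] show ?thesis
    unfolding Q_eq by (simp add: integral_distr split_beta')
qed

text \<open>After time \<open>n\<close> the path is a walk from its position at that time driven by fresh increments.\<close>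

lemma markov_property:
  "distr Q (path_space \<Otimes>\<^sub>M path_space) (\<lambda>w. (stopped n w, after n w))
    = distr (Q \<Otimes>\<^sub>M increments) (path_space \<Otimes>\<^sub>M path_space) (\<lambda>(w, \<xi>). (stopped n w, walk_path (w n) \<xi>))"
  (is "?L = ?R")
proof (rule measure_eqI)
  show "sets ?L = sets ?R" by simp
  fix A assume "A \<in> sets ?L"
  then have A[measurable]: "A \<in> sets (path_space \<Otimes>\<^sub>M path_space)" by simp
  let ?f = "indicator A :: _ \<Rightarrow> ennreal"
  have stop: "stopped n (walk_path g (comb_seq n \<xi> \<xi>')) = stopped n (walk_path g \<xi>)" for g :: 'g and \<xi> \<xi>'
    by (simp add: stopped_def walk_path_comb_seq_le)
  have aft: "after n (walk_path g (comb_seq n \<xi> \<xi>')) = walk_path (walk_path g \<xi> n) \<xi>'" for g :: 'g and \<xi> \<xi>'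
    by (simp add: after_def walk_path_comb_seq_add)
  have "emeasure ?L A = (\<integral>\<^sup>+w. ?f (stopped n w, after n w) \<partial>Q)"
    by (subst nn_integral_indicator[symmetric]) (simp_all add: nn_integral_distr del: nn_integral_indicator)
  also have "\<dots> = (\<integral>\<^sup>+g. \<integral>\<^sup>+\<xi>. ?f (stopped n (walk_path g \<xi>), after n (walk_path g \<xi>)) \<partial>increments \<partial>\<nu>)"
    by (rule nn_integral_Q) simp
  also have "\<dots> = (\<integral>\<^sup>+g. \<integral>\<^sup>+\<xi>. \<integral>\<^sup>+\<xi>'. ?f (stopped n (walk_path g \<xi>), walk_path (walk_path g \<xi> n) \<xi>')
      \<partial>increments \<partial>increments \<partial>\<nu>)"
  proof (rule nn_integral_cong)
    fix g :: 'g
    have "(\<lambda>\<xi>. ?f (stopped n (walk_path g \<xi>), after n (walk_path g \<xi>))) \<in> borel_measurable path_space"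
      by measurable
    from nn_integral_increments_split[OF this, of n]
    show "(\<integral>\<^sup>+\<xi>. ?f (stopped n (walk_path g \<xi>), after n (walk_path g \<xi>)) \<partial>increments)
      = (\<integral>\<^sup>+\<xi>. \<integral>\<^sup>+\<xi>'. ?f (stopped n (walk_path g \<xi>), walk_path (walk_path g \<xi> n) \<xi>') \<partial>increments \<partial>increments)"
      by (simp add: stop aft)
  qed
  also have "\<dots> = (\<integral>\<^sup>+w. \<integral>\<^sup>+\<xi>'. ?f (stopped n w, walk_path (w n) \<xi>') \<partial>increments \<partial>Q)"
    by (rule nn_integral_Q[symmetric]) measurable
  also have "\<dots> = (\<integral>\<^sup>+z. ?f (stopped n (fst z), walk_path (fst z n) (snd z)) \<partial>(Q \<Otimes>\<^sub>M increments))"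
    by (subst inc.nn_integral_fst[symmetric]) simp_all
  also have "\<dots> = emeasure ?R A"
    by (subst nn_integral_indicator[symmetric]) (simp_all add: nn_integral_distr split_beta' del: nn_integral_indicator)
  finally show "emeasure ?L A = emeasure ?R A" .
qed

lemma markov_integral:
  fixes H :: "(nat \<Rightarrow> 'g) \<times> (nat \<Rightarrow> 'g) \<Rightarrow> 'b::{banach, second_countable_topology}"
  assumes [measurable]: "H \<in> borel_measurable (path_space \<Otimes>\<^sub>M path_space)"
    and int: "integrable Q (\<lambda>w. H (stopped n w, after n w))"
  shows "(\<integral>w. H (stopped n w, after n w) \<partial>Q) = (\<integral>w. \<integral>\<xi>. H (stopped n w, walk_path (w n) \<xi>) \<partial>increments \<partial>Q)"
proof -
  interpret P: pair_sigma_finite Q increments ..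
  have "integrable (distr Q (path_space \<Otimes>\<^sub>M path_space) (\<lambda>w. (stopped n w, after n w))) H"
    using int by (subst integrable_distr_eq) simp_all
  then have "integrable (Q \<Otimes>\<^sub>M increments) (\<lambda>(w, \<xi>). H (stopped n w, walk_path (w n) \<xi>))"
    unfolding markov_property by (subst (asm) integrable_distr_eq) (simp_all add: split_beta')
  from P.integral_fst'[OF this] have "(\<integral>w. \<integral>\<xi>. H (stopped n w, walk_path (w n) \<xi>) \<partial>increments \<partial>Q)
      = (\<integral>z. H z \<partial>distr (Q \<Otimes>\<^sub>M increments) (path_space \<Otimes>\<^sub>M path_space)
          (\<lambda>(w, \<xi>). (stopped n w, walk_path (w n) \<xi>)))"
    by (simp add: integral_distr split_beta')
  also have "\<dots> = (\<integral>w. H (stopped n w, after n w) \<partial>Q)"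
    unfolding markov_property[symmetric] by (simp add: integral_distr)
  finally show ?thesis by simp
qed

end

section \<open>Functions of finitely many positions\<close>

text \<open>The sets that can be approximated form a \<open>\<sigma>\<close>-algebra, and this contains the generating cylinders.\<close>

lemma set_approx_stopped:
  fixes M :: "(nat \<Rightarrow> 'g::topological_space) measure"
  assumes M: "finite_measure M" and sets_M[measurable_cong]: "sets M = sets path_space"
    and A: "A \<in> sets path_space" and "\<epsilon> > 0"
  shows "\<exists>n B. B \<in> sets path_space \<and> (\<forall>w. stopped n w \<in> B \<longleftrightarrow> w \<in> B) \<and> measure M (sym_diff A B) < \<epsilon>"
proof -
  interpret finite_measure M by fact
  have space_M: "space M = UNIV"
    using sets_eq_imp_space_eq[OF sets_M] by simp
  have "A \<in> sigma_sets UNIV {{f. f i \<in> A} | i A. A \<in> sets (borel :: 'g measure)}"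
    using A by (simp add: sets_PiM_single)
  then show ?thesis
    using \<open>\<epsilon> > 0\<close>
  proof (induction arbitrary: \<epsilon>)
    case (Basic a)
    then obtain i A where a: "a = {f. f i \<in> A}" and [measurable]: "A \<in> sets borel"
      by auto
    have "a \<in> sets path_space"
      using measurable_sets[OF measurable_component_singleton[of i UNIV "\<lambda>_. borel"] \<open>A \<in> sets borel\<close>]
      by (simp add: a vimage_def)
    then show ?case
      using Basic(2) by (intro exI[of _ i] exI[of _ a]) (simp add: a stopped_apply)
  next
    case Empty
    then show ?case by (intro exI[of _ 0] exI[of _ "{}"]) simp
  next
    case (Compl a)
    from Compl.IH[OF Compl.prems] obtain n B where B: "B \<in> sets path_space"
      "\<forall>w. stopped n w \<in> B \<longleftrightarrow> w \<in> B" "measure M (sym_diff a B) < \<epsilon>" by blast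
    have "sym_diff (UNIV - a) (UNIV - B) = sym_diff a B" by auto
    moreover have "UNIV - B \<in> sets path_space"
      using sets.compl_sets[OF B(1)] by simp
    ultimately show ?case
      using B by (intro exI[of _ n] exI[of _ "UNIV - B"]) simp
  next
    case (Union a)
    have a[measurable]: "a i \<in> sets M" for i
      using Union(1)[of i] sets_M by (simp add: sets_PiM_single)
    let ?U = "\<lambda>N. \<Union>i<N. a i"
    have "(\<lambda>N. measure M (?U N)) \<longlonglongrightarrow> measure M (\<Union>N. ?U N)"
      by (intro finite_Lim_measure_incseq) (auto simp: incseq_def, meson lessThan_iff order_less_le_trans)
    moreover have "(\<Union>N. ?U N) = (\<Union>i. a i)" by auto
    ultimately have lim: "(\<lambda>N. measure M (?U N)) \<longlonglongrightarrow> measure M (\<Union>i. a i)" by simp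
    have "\<epsilon> / 2 > 0" using Union by simp
    from LIMSEQ_D[OF lim this] obtain N where "\<bar>measure M (?U N) - measure M (\<Union>i. a i)\<bar> < \<epsilon> / 2"
      by auto
    moreover have "measure M ((\<Union>i. a i) - ?U N) = measure M (\<Union>i. a i) - measure M (?U N)"
      by (intro finite_measure_Diff) auto
    ultimately have N: "measure M ((\<Union>i. a i) - ?U N) < \<epsilon> / 2" by linarith
    \<comment> \<open>the error of \<open>\<epsilon> / 2\<close> left for the finite union is shared by its \<open>N\<close> members\<close>
    define \<delta> where "\<delta> = \<epsilon> / (2 * (real N + 1))"
    have \<delta>: "\<delta> > 0" using Union by (simp add: \<delta>_def)
    from Union.IH[OF this] obtain n B where B: "\<And>i. B i \<in> sets path_space"
      "\<And>i w. stopped (n i) w \<in> B i \<longleftrightarrow> w \<in> B i" "\<And>i. measure M (sym_diff (a i) (B i)) < \<delta>"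
      by metis
    have [measurable]: "B i \<in> sets M" for i using B(1) sets_M by simp
    define m where "m = Max (n ` {..<N})"
    have m: "n i \<le> m" if "i < N" for i
      unfolding m_def using that by (intro Max_ge) auto
    let ?B = "\<Union>i<N. B i"
    have "measure M (sym_diff (\<Union>i. a i) ?B) \<le> measure M (((\<Union>i. a i) - ?U N) \<union> (\<Union>i<N. sym_diff (a i) (B i)))"
    proof (rule finite_measure_mono)
      show "sym_diff (\<Union>i. a i) ?B \<subseteq> ((\<Union>i. a i) - ?U N) \<union> (\<Union>i<N. sym_diff (a i) (B i))"
        by blast
    qed measurable
    also have "\<dots> \<le> measure M ((\<Union>i. a i) - ?U N) + measure M (\<Union>i<N. sym_diff (a i) (B i))"
      by (intro measure_subadditive) auto
    also have "measure M (\<Union>i<N. sym_diff (a i) (B i)) \<le> (\<Sum>i<N. measure M (sym_diff (a i) (B i)))"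
      by (intro finite_measure_subadditive_finite) auto
    also have "\<dots> \<le> (\<Sum>i<N. \<delta>)"
      using B(3) by (intro sum_mono) (simp add: less_imp_le)
    also have "\<dots> \<le> \<epsilon> / 2"
      using Union(3) by (simp add: \<delta>_def field_simps)
    finally have "measure M (sym_diff (\<Union>i. a i) ?B) < \<epsilon>" using N by simp
    moreover have "stopped m w \<in> ?B \<longleftrightarrow> w \<in> ?B" for w
    proof -
      have "stopped m w \<in> B i \<longleftrightarrow> w \<in> B i" if "i < N" for i
        using B(2)[of i "stopped m w"] B(2)[of i w] stopped_stopped[OF m[OF that], of w] by simp
      then show ?thesis by auto
    qed
    moreover have "?B \<in> sets path_space" using B(1) by auto
    ultimately show ?case by blast
  qed
qed

text \<open>Integrable functions are limits of step functions, and the sets of a step function can be approximated.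
  Identities between pairings hence need to be checked only against functions of finitely many positions.\<close>

lemma L1_approx_stopped:
  fixes M :: "(nat \<Rightarrow> 'g::topological_space) measure" and \<phi> :: "_ \<Rightarrow> 'b::{banach, second_countable_topology}"
  assumes M: "finite_measure M" and sets_M[measurable_cong]: "sets M = sets path_space"
    and \<phi>: "integrable M \<phi>" and "\<epsilon> > 0"
  shows "\<exists>n Z. Z \<in> borel_measurable path_space \<and> (\<forall>w. Z (stopped n w) = Z w) \<and> integrable M Z \<and>
    (\<integral>w. norm (\<phi> w - Z w) \<partial>M) < \<epsilon>"
  using \<phi> \<open>\<epsilon> > 0\<close>
proof (induction arbitrary: \<epsilon> rule: integrable_induct)
  case (base A c)
  interpret finite_measure M by fact
  have "\<epsilon> / (norm c + 1) > 0" using base by (simp add: add_nonneg_pos)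
  from set_approx_stopped[OF M sets_M _ this, of A] obtain n B where B: "B \<in> sets path_space"
    "\<forall>w. stopped n w \<in> B \<longleftrightarrow> w \<in> B" "measure M (sym_diff A B) < \<epsilon> / (norm c + 1)"
    using base sets_M by blast
  have [measurable]: "B \<in> sets M" "A \<in> sets M" using B sets_M base by auto
  let ?Z = "\<lambda>w. indicator B w *\<^sub>R c"
  have "integrable M ?Z"
    by (intro integrable_scaleR_left) (simp add: less_top[symmetric])
  moreover have "(\<integral>w. norm (indicator A w *\<^sub>R c - ?Z w) \<partial>M) = (\<integral>w. indicator (sym_diff A B) w * norm c \<partial>M)"
    by (intro Bochner_Integration.integral_cong) (auto simp: indicator_def)
  moreover have "\<dots> = measure M (sym_diff A B) * norm c"
    by simp
  moreover have "\<dots> < \<epsilon>"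
  proof -
    have "measure M (sym_diff A B) * norm c \<le> measure M (sym_diff A B) * (norm c + 1)"
      by (intro mult_left_mono) auto
    also have "\<dots> < \<epsilon>"
      using B(3) by (subst (asm) pos_less_divide_eq) (simp_all add: add_nonneg_pos)
    finally show ?thesis .
  qed
  moreover have "?Z (stopped n w) = ?Z w" for w
    using B(2) by (simp add: indicator_def)
  moreover have "?Z \<in> borel_measurable path_space" using B(1) by measurable
  ultimately show ?case by (intro exI[of _ n] exI[of _ ?Z]) simp
next
  case (add f g)
  have "\<epsilon> / 2 > 0" using add by simp
  from add.IH(1)[OF this] obtain n Z where Z: "Z \<in> borel_measurable path_space"
    "\<forall>w. Z (stopped n w) = Z w" "integrable M Z" "(\<integral>w. norm (f w - Z w) \<partial>M) < \<epsilon> / 2" by blast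
  from add.IH(2)[OF \<open>\<epsilon> / 2 > 0\<close>] obtain n' Z' where Z': "Z' \<in> borel_measurable path_space"
    "\<forall>w. Z' (stopped n' w) = Z' w" "integrable M Z'" "(\<integral>w. norm (g w - Z' w) \<partial>M) < \<epsilon> / 2" by blast
  let ?n = "max n n'" and ?Z = "\<lambda>w. Z w + Z' w"
  have "?Z (stopped ?n w) = ?Z w" for w
    using Z(2)[rule_format, of "stopped ?n w"] Z(2)[rule_format, of w]
      Z'(2)[rule_format, of "stopped ?n w"] Z'(2)[rule_format, of w]
    by (simp add: stopped_stopped)
  moreover have "(\<integral>w. norm (f w + g w - ?Z w) \<partial>M) \<le> (\<integral>w. norm (f w - Z w) + norm (g w - Z' w) \<partial>M)"
    using add Z Z' by (intro integral_mono) (auto simp: norm_diff_triangle_ineq)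
  moreover have "\<dots> = (\<integral>w. norm (f w - Z w) \<partial>M) + (\<integral>w. norm (g w - Z' w) \<partial>M)"
    using add Z Z' by (intro Bochner_Integration.integral_add) auto
  ultimately show ?case
    using Z Z' by (intro exI[of _ ?n] exI[of _ ?Z]) (auto intro: borel_measurable_add)
next
  case (lim f s)
  have "(\<lambda>i. \<integral>w. norm (f w - s i w) \<partial>M) \<longlonglongrightarrow> (\<integral>w. 0 \<partial>M)"
  proof (rule integral_dominated_convergence[where w = "\<lambda>w. 3 * norm (f w)"])
    show "AE w in M. (\<lambda>i. norm (f w - s i w)) \<longlonglongrightarrow> 0"
    proof (rule AE_I2)
      fix w assume "w \<in> space M"
      from tendsto_norm[OF tendsto_diff[OF tendsto_const lim.hyps(2)[OF this]], of "f w"]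
      show "(\<lambda>i. norm (f w - s i w)) \<longlonglongrightarrow> 0" by simp
    qed
    show "AE w in M. norm (norm (f w - s i w)) \<le> 3 * norm (f w)" for i
    proof (rule AE_I2)
      fix w assume "w \<in> space M"
      from lim.hyps(3)[OF this, of i] norm_triangle_ineq4[of "f w" "s i w"]
      show "norm (norm (f w - s i w)) \<le> 3 * norm (f w)" by simp
    qed
  qed (use lim.hyps in \<open>auto intro: borel_measurable_integrable\<close>)
  then have "(\<lambda>i. \<integral>w. norm (f w - s i w) \<partial>M) \<longlonglongrightarrow> 0" by simp
  moreover have "\<epsilon> / 2 > 0" using lim.prems by simp
  ultimately obtain i where "norm ((\<integral>w. norm (f w - s i w) \<partial>M) - 0) < \<epsilon> / 2"
    using LIMSEQ_D[of _ 0 "\<epsilon> / 2"] by blast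
  then have i: "(\<integral>w. norm (f w - s i w) \<partial>M) < \<epsilon> / 2" by simp
  from lim.IH[OF \<open>\<epsilon> / 2 > 0\<close>, of i] obtain n Z where Z: "Z \<in> borel_measurable path_space"
    "\<forall>w. Z (stopped n w) = Z w" "integrable M Z" "(\<integral>w. norm (s i w - Z w) \<partial>M) < \<epsilon> / 2" by blast
  have "(\<integral>w. norm (f w - Z w) \<partial>M) \<le> (\<integral>w. norm (f w - s i w) + norm (s i w - Z w) \<partial>M)"
    using lim Z by (intro integral_mono) (auto intro: norm_diff_triangle_le)
  also have "\<dots> = (\<integral>w. norm (f w - s i w) \<partial>M) + (\<integral>w. norm (s i w - Z w) \<partial>M)"
    using lim Z by (intro Bochner_Integration.integral_add) auto
  finally show ?case using i Z by (intro exI[of _ n] exI[of _ Z]) simp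
qed

section \<open>Almost sure convergence of bounded martingales\<close>

text \<open>Increments over disjoint time intervals are orthogonal, so \<open>E(X\<^sub>n - X\<^sub>m)\<^sup>2 = E X\<^sub>n\<^sup>2 - E X\<^sub>m\<^sup>2\<close>, and these
  second moments increase to a finite limit. Kolmogorov's maximal inequality bounds the probability of an
  excursion larger than \<open>\<epsilon>\<close> after time \<open>m\<close> by what remains of the second moment, divided by \<open>\<epsilon>\<^sup>2\<close>.
  Almost surely the sequence is therefore Cauchy.\<close>

lemma bounded_martingale_converges:
  fixes M :: "(nat \<Rightarrow> 'g::topological_space) measure" and X :: "nat \<Rightarrow> (nat \<Rightarrow> 'g) \<Rightarrow> real"
  assumes M: "finite_measure M" and sets_M[measurable_cong]: "sets M = sets path_space"
    and X[measurable]: "\<And>n. X n \<in> borel_measurable path_space"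
    and bound: "\<And>n w. \<bar>X n w\<bar> \<le> C"
    and adapted: "\<And>n w. X n (stopped n w) = X n w"
    and martingale: "\<And>n Z B. Z \<in> borel_measurable path_space \<Longrightarrow> (\<And>w. Z (stopped n w) = Z w) \<Longrightarrow>
      (\<And>w. \<bar>Z w\<bar> \<le> B) \<Longrightarrow> (\<integral>w. Z w * X (Suc n) w \<partial>M) = (\<integral>w. Z w * X n w \<partial>M)"
  shows "AE w in M. convergent (\<lambda>n. X n w)"
proof -
  interpret finite_measure M by fact
  have space_M[simp]: "space M = UNIV"
    using sets_eq_imp_space_eq[OF sets_M] by simp
  have C: "C \<ge> 0" using bound[of 0 undefined] by linarith
  have bint: "integrable M f" if "f \<in> borel_measurable path_space" "\<And>w. \<bar>f w\<bar> \<le> B" for f :: "_ \<Rightarrow> real" and B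
    using that by (intro integrable_const_bound[of _ B]) (auto simp: measurable_cong_sets[OF sets_M refl])
  have adapted': "X m (stopped n w) = X m w" if "m \<le> n" for m n w
    using adapted[of m "stopped n w"] adapted[of m w] stopped_stopped[OF that, of w] by simp
  have mart: "(\<integral>w. Z w * X m w \<partial>M) = (\<integral>w. Z w * X n w \<partial>M)"
    if "n \<le> m" and [measurable]: "Z \<in> borel_measurable path_space" and Z: "\<And>w. Z (stopped n w) = Z w" "\<And>w. \<bar>Z w\<bar> \<le> B"
    for n m Z B
    using \<open>n \<le> m\<close>
  proof (induction rule: dec_induct)
    case (step k)
    have "Z (stopped k w) = Z w" for w
      using Z(1)[of "stopped k w"] Z(1)[of w] stopped_stopped[OF step(1), of w] by simp
    with step martingale[of Z k B] Z(2) show ?case by simp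
  qed simp
  have d: "\<bar>X i w - X j w\<bar> \<le> 2 * C" for i j w
    using bound[of i w] bound[of j w] by linarith
  have sq_int: "integrable M (\<lambda>w. indicator A w * (X i w - X j w)\<^sup>2)"
    if [measurable]: "A \<in> sets path_space" for A i j
  proof (rule bint[of _ "(2 * C)\<^sup>2"])
    fix w
    have "(X i w - X j w)\<^sup>2 \<le> (2 * C)\<^sup>2"
      using d[of i w j] C by (intro abs_le_square_iff[THEN iffD1]) simp
    then show "\<bar>indicator A w * (X i w - X j w)\<^sup>2\<bar> \<le> (2 * C)\<^sup>2"
      by (auto simp: indicator_def)
  qed measurable
  have increment: "\<epsilon>\<^sup>2 * measure M A \<le> (\<integral>w. indicator A w * (X n w - X m w)\<^sup>2 \<partial>M)"
    if mk: "m \<le> k" "k \<le> n" and [measurable]: "A \<in> sets path_space" and A: "\<And>w. stopped k w \<in> A \<longleftrightarrow> w \<in> A"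
      and big: "\<And>w. w \<in> A \<Longrightarrow> \<epsilon> \<le> \<bar>X k w - X m w\<bar>" and "\<epsilon> \<ge> 0"
    for m k n A \<epsilon>
  proof -
    let ?Z = "\<lambda>w. indicator A w * (X k w - X m w)"
    have Zb: "\<bar>?Z w\<bar> \<le> 2 * C" for w
      using d[of k w m] C by (auto simp: indicator_def)
    have "?Z (stopped k w) = ?Z w" for w
      using A mk by (simp add: adapted adapted' indicator_def)
    from mart[where Z = ?Z and B = "2 * C", OF mk(2) _ this Zb] have orth: "(\<integral>w. ?Z w * X n w \<partial>M) = (\<integral>w. ?Z w * X k w \<partial>M)"
      by simp
    have i1: "integrable M (\<lambda>w. ?Z w * X i w)" for i
    proof (rule bint[of _ "2 * C * C"])
      fix w
      show "\<bar>?Z w * X i w\<bar> \<le> 2 * C * C"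
        unfolding abs_mult[of "?Z w"] using Zb bound C by (intro mult_mono) auto
    qed measurable
    note i2 = sq_int[OF \<open>A \<in> sets path_space\<close>]
    have "\<epsilon>\<^sup>2 * measure M A = (\<integral>w. indicator A w * \<epsilon>\<^sup>2 \<partial>M)"
      by simp
    also have "\<dots> \<le> (\<integral>w. indicator A w * (X k w - X m w)\<^sup>2 \<partial>M)"
    proof (intro integral_mono i2)
      show "integrable M (\<lambda>w. indicator A w * \<epsilon>\<^sup>2)"
        by (rule bint[of _ "\<epsilon>\<^sup>2"]) (auto simp: indicator_def)
      show "indicator A w * \<epsilon>\<^sup>2 \<le> indicator A w * (X k w - X m w)\<^sup>2" for w
        using big[of w] \<open>\<epsilon> \<ge> 0\<close> by (auto simp: indicator_def abs_le_square_iff[symmetric])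
    qed
    also have "\<dots> \<le> (\<integral>w. indicator A w * (X k w - X m w)\<^sup>2 \<partial>M) + (\<integral>w. indicator A w * (X n w - X k w)\<^sup>2 \<partial>M)"
      by simp
    also have "\<dots> = (\<integral>w. indicator A w * (X k w - X m w)\<^sup>2 + indicator A w * (X n w - X k w)\<^sup>2
        + 2 * (?Z w * X n w - ?Z w * X k w) \<partial>M)"
      using i1[of n] i1[of k] i2 orth by simp
    also have "\<dots> = (\<integral>w. indicator A w * (X n w - X m w)\<^sup>2 \<partial>M)"
      by (intro Bochner_Integration.integral_cong) (auto simp: power2_eq_square algebra_simps)
    finally show ?thesis .
  qed
  define a where "a n = (\<integral>w. (X n w)\<^sup>2 \<partial>M)" for n
  have sq: "(\<integral>w. (X n w - X m w)\<^sup>2 \<partial>M) = a n - a m" if "m \<le> n" for m n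
  proof -
    have i: "integrable M (\<lambda>w. X i w * X j w)" for i j
      by (rule bint[of _ "C * C"]) (auto simp: abs_mult intro!: mult_mono bound C)
    have "(\<integral>w. (X n w - X m w)\<^sup>2 \<partial>M) = (\<integral>w. X n w * X n w - 2 * (X m w * X n w) + X m w * X m w \<partial>M)"
      by (intro Bochner_Integration.integral_cong) (auto simp: power2_eq_square algebra_simps)
    also have "\<dots> = (\<integral>w. X n w * X n w \<partial>M) - 2 * (\<integral>w. X m w * X n w \<partial>M) + (\<integral>w. X m w * X m w \<partial>M)"
      using i by simp
    also have "(\<integral>w. X m w * X n w \<partial>M) = (\<integral>w. X m w * X m w \<partial>M)"
      using that by (rule mart[where B = C]) (auto simp: adapted bound)
    finally show ?thesis by (simp add: a_def power2_eq_square)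
  qed
  have "incseq a"
  proof (rule incseq_SucI)
    fix n
    have "0 \<le> (\<integral>w. (X (Suc n) w - X n w)\<^sup>2 \<partial>M)" by simp
    then show "a n \<le> a (Suc n)" using sq[of n "Suc n"] by simp
  qed
  moreover have "a n \<le> C\<^sup>2 * measure M UNIV" for n
  proof -
    have "a n \<le> (\<integral>w. C\<^sup>2 \<partial>M)"
      unfolding a_def
    proof (rule integral_mono)
      show "integrable M (\<lambda>w. (X n w)\<^sup>2)"
        by (rule bint[of _ "C\<^sup>2"]) (use bound C in \<open>auto simp: abs_le_square_iff[symmetric]\<close>)
      show "(X n w)\<^sup>2 \<le> C\<^sup>2" for w
        using bound[of n w] C by (simp add: abs_le_square_iff[symmetric])
    qed simp
    then show ?thesis by (simp add: mult.commute)
  qed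
  ultimately obtain a' where a': "a \<longlonglongrightarrow> a'" and le_a': "\<And>n. a n \<le> a'"
    using incseq_convergent[of a "C\<^sup>2 * measure M UNIV"] by metis
  have maximal: "\<epsilon>\<^sup>2 * measure M {w. \<exists>k\<in>{m..n}. \<epsilon> < \<bar>X k w - X m w\<bar>} \<le> a n - a m" if "m \<le> n" "\<epsilon> \<ge> 0" for m n \<epsilon>
  proof -
    \<comment> \<open>\<open>A k\<close>: the first excursion larger than \<open>\<epsilon>\<close> happens at time \<open>k\<close>\<close>
    define A where "A k = {w. \<epsilon> < \<bar>X k w - X m w\<bar> \<and> (\<forall>j\<in>{m..<k}. \<not> \<epsilon> < \<bar>X j w - X m w\<bar>)}" for k
    have A_sets[measurable]: "A k \<in> sets path_space" for k
    proof -
      have "{w \<in> space path_space. \<epsilon> < \<bar>X k w - X m w\<bar> \<and> (\<forall>j\<in>{m..<k}. \<not> \<epsilon> < \<bar>X j w - X m w\<bar>)} \<in> sets path_space"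
        by measurable
      then show ?thesis by (simp add: A_def)
    qed
    have A_M[measurable]: "A k \<in> sets M" for k
      by (simp add: sets_M)
    have disj: "disjoint_family_on A {m..n}"
    proof -
      have False if "w \<in> A i" "w \<in> A j" "m \<le> i" "i < j" for w i j
        using that unfolding A_def by auto
      then have "A i \<inter> A j = {}" if "m \<le> i" "m \<le> j" "i \<noteq> j" for i j
        using that by (cases i j rule: linorder_cases) auto
      then show ?thesis
        by (auto simp: disjoint_family_on_def)
    qed
    have U: "{w. \<exists>k\<in>{m..n}. \<epsilon> < \<bar>X k w - X m w\<bar>} = (\<Union>k\<in>{m..n}. A k)"
    proof (intro equalityI subsetI)
      fix w assume "w \<in> {w. \<exists>k\<in>{m..n}. \<epsilon> < \<bar>X k w - X m w\<bar>}"
      then obtain k where k: "k \<in> {m..n}" "\<epsilon> < \<bar>X k w - X m w\<bar>" by auto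
      define l where "l = (LEAST l. m \<le> l \<and> \<epsilon> < \<bar>X l w - X m w\<bar>)"
      have "m \<le> l \<and> \<epsilon> < \<bar>X l w - X m w\<bar>" "l \<le> k"
        unfolding l_def using k by (auto intro: LeastI2 Least_le)
      moreover have "\<not> \<epsilon> < \<bar>X j w - X m w\<bar>" if "j \<in> {m..<l}" for j
        using that not_less_Least[of j "\<lambda>l. m \<le> l \<and> \<epsilon> < \<bar>X l w - X m w\<bar>"] by (auto simp: l_def)
      ultimately have "w \<in> A l" "l \<in> {m..n}" using k(1) by (auto simp: A_def)
      then show "w \<in> (\<Union>k\<in>{m..n}. A k)" by blast
    qed (auto simp: A_def)
    note int = sq_int[OF A_sets]
    have "\<epsilon>\<^sup>2 * measure M {w. \<exists>k\<in>{m..n}. \<epsilon> < \<bar>X k w - X m w\<bar>} = (\<Sum>k\<in>{m..n}. \<epsilon>\<^sup>2 * measure M (A k))"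
      unfolding U by (subst finite_measure_finite_Union[OF _ _ disj]) (auto simp: sum_distrib_left)
    also have "\<dots> \<le> (\<Sum>k\<in>{m..n}. \<integral>w. indicator (A k) w * (X n w - X m w)\<^sup>2 \<partial>M)"
    proof (intro sum_mono increment)
      fix k w assume "k \<in> {m..n}"
      then show "stopped k w \<in> A k \<longleftrightarrow> w \<in> A k"
        by (auto simp: A_def adapted')
    next
      fix k w assume "w \<in> A k"
      then show "\<epsilon> \<le> \<bar>X k w - X m w\<bar>" by (simp add: A_def)
    qed (use that A_sets in auto)
    also have "\<dots> = (\<integral>w. (\<Sum>k\<in>{m..n}. indicator (A k) w * (X n w - X m w)\<^sup>2) \<partial>M)"
      using int by (intro Bochner_Integration.integral_sum[symmetric]) auto
    also have "\<dots> \<le> (\<integral>w. (X n w - X m w)\<^sup>2 \<partial>M)"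
    proof (rule integral_mono)
      show "integrable M (\<lambda>w. \<Sum>k\<in>{m..n}. indicator (A k) w * (X n w - X m w)\<^sup>2)"
        using int by (intro Bochner_Integration.integrable_sum) auto
      show "integrable M (\<lambda>w. (X n w - X m w)\<^sup>2)"
        using sq_int[of UNIV n m] sets.top[of path_space] by simp
      fix w
      have "(\<Sum>k\<in>{m..n}. indicator (A k) w * (X n w - X m w)\<^sup>2)
          = indicator (\<Union>k\<in>{m..n}. A k) w * (X n w - X m w)\<^sup>2"
        by (subst indicator_UN_disjoint[OF _ disj]) (auto simp: sum_distrib_right)
      also have "\<dots> \<le> (X n w - X m w)\<^sup>2"
        by (simp add: indicator_def)
      finally show "(\<Sum>k\<in>{m..n}. indicator (A k) w * (X n w - X m w)\<^sup>2) \<le> (X n w - X m w)\<^sup>2" .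
    qed
    finally show ?thesis using sq[OF that(1)] by simp
  qed
  have null: "AE w in M. \<exists>m. \<forall>k\<ge>m. \<bar>X k w - X m w\<bar> \<le> \<epsilon>" if "\<epsilon> > 0" for \<epsilon>
  proof -
    let ?B = "\<lambda>m n. {w. \<exists>k\<in>{m..n}. \<epsilon> < \<bar>X k w - X m w\<bar>}"
    have [measurable]: "?B m n \<in> sets path_space" for m n
    proof -
      have "{w \<in> space path_space. \<exists>k\<in>{m..n}. \<epsilon> < \<bar>X k w - X m w\<bar>} \<in> sets path_space"
        by measurable
      then show ?thesis by simp
    qed
    have B_M[measurable]: "?B m n \<in> sets M" for m n
      by (simp add: sets_M)
    \<comment> \<open>\<open>?D\<close>: after every time there is an excursion larger than \<open>\<epsilon>\<close>\<close>
    let ?D = "\<Inter>m. \<Union>n. ?B m n"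
    have "\<epsilon>\<^sup>2 * measure M ?D \<le> a' - a m" for m
    proof -
      have "(\<lambda>n. measure M (?B m n)) \<longlonglongrightarrow> measure M (\<Union>n. ?B m n)"
        by (intro finite_Lim_measure_incseq) (auto simp: incseq_def)
      then have "(\<lambda>n. \<epsilon>\<^sup>2 * measure M (?B m n)) \<longlonglongrightarrow> \<epsilon>\<^sup>2 * measure M (\<Union>n. ?B m n)"
        by (rule tendsto_mult_left)
      moreover have "\<epsilon>\<^sup>2 * measure M (?B m n) \<le> a' - a m" if "m \<le> n" for n
        using maximal[OF that, of \<epsilon>] \<open>\<epsilon> > 0\<close> le_a'[of n] by linarith
      ultimately have "\<epsilon>\<^sup>2 * measure M (\<Union>n. ?B m n) \<le> a' - a m"
        by (intro LIMSEQ_le_const2) auto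
      moreover have "measure M ?D \<le> measure M (\<Union>n. ?B m n)"
        by (intro finite_measure_mono) auto
      ultimately show ?thesis
        by (meson mult_left_mono order_trans zero_le_power2)
    qed
    moreover have "(\<lambda>m. a' - a m) \<longlonglongrightarrow> a' - a'"
      by (intro tendsto_intros a')
    ultimately have "\<epsilon>\<^sup>2 * measure M ?D \<le> 0"
      by (intro LIMSEQ_le_const[of "\<lambda>m. a' - a m"]) auto
    then have "measure M ?D = 0"
      using \<open>\<epsilon> > 0\<close> by (simp add: mult_le_0_iff measure_le_0_iff)
    then have "?D \<in> null_sets M"
      by (intro null_setsI) (auto simp: emeasure_eq_measure)
    then have "AE w in M. w \<notin> ?D"
      by (rule AE_not_in)
    then show ?thesis
      by eventually_elim (auto simp: not_less, metis atLeastAtMost_iff order_refl)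
  qed
  have "AE w in M. \<forall>j. \<exists>m. \<forall>k\<ge>m. \<bar>X k w - X m w\<bar> \<le> 1 / real (Suc j)"
    unfolding AE_all_countable by (intro allI null) simp
  then show ?thesis
  proof eventually_elim
    case (elim w)
    have "Cauchy (\<lambda>n. X n w)"
    proof (rule metric_CauchyI)
      fix e :: real assume "e > 0"
      then obtain j where j: "1 / real (Suc j) < e / 2"
        using reals_Archimedean[of "e / 2"] by (auto simp: inverse_eq_divide)
      from elim obtain m where m: "\<And>k. k \<ge> m \<Longrightarrow> \<bar>X k w - X m w\<bar> \<le> 1 / real (Suc j)" by blast
      have "dist (X k w) (X l w) < e" if "k \<ge> m" "l \<ge> m" for k l
        using m[OF that(1)] m[OF that(2)] j unfolding dist_real_def by linarith
      then show "\<exists>m. \<forall>k\<ge>m. \<forall>l\<ge>m. dist (X k w) (X l w) < e" by blast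
    qed
    then show ?case by (simp add: Cauchy_convergent_iff)
  qed
qed

section \<open>Weak* measurable functions\<close>

definition dense_seq :: "nat \<Rightarrow> 'a::{real_normed_vector, second_countable_topology}"
  where "dense_seq = (SOME d. \<forall>y. \<forall>\<epsilon>>0. \<exists>i. norm (y - d i) < \<epsilon>)"

lemma dense_seq: "\<epsilon> > 0 \<Longrightarrow> \<exists>i. norm (y - dense_seq i) < \<epsilon>"
  for y :: "'a::{real_normed_vector, second_countable_topology}"
proof -
  obtain D :: "'a set" where D: "countable D" "\<And>X. open X \<Longrightarrow> X \<noteq> {} \<Longrightarrow> \<exists>d\<in>D. d \<in> X"
    using countable_dense_setE by blast
  have "D \<noteq> {}" using D(2)[of UNIV] by auto
  have "\<exists>i. norm (y - from_nat_into D i) < \<epsilon>" if "\<epsilon> > 0" for y \<epsilon>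
  proof -
    from D(2)[of "ball y \<epsilon>"] that obtain d where "d \<in> D" "d \<in> ball y \<epsilon>" by auto
    then show ?thesis
      using from_nat_into_surj[OF D(1)] by (metis dist_norm mem_ball)
  qed
  then have "\<exists>d::nat \<Rightarrow> 'a. \<forall>y. \<forall>\<epsilon>>0. \<exists>i. norm (y - d i) < \<epsilon>" by blast
  from someI_ex[OF this] show "\<epsilon> > 0 \<Longrightarrow> \<exists>i. norm (y - dense_seq i) < \<epsilon>"
    unfolding dense_seq_def by blast
qed

lemma norm_blinfun_le_iff_dense:
  fixes x :: "'a::{real_normed_vector, second_countable_topology} \<Rightarrow>\<^sub>L 'b::real_normed_vector"
  assumes "c \<ge> 0"
  shows "norm x \<le> c \<longleftrightarrow> (\<forall>i. norm (x (dense_seq i)) \<le> c * norm (dense_seq i :: 'a))"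
proof
  assume "norm x \<le> c"
  then show "\<forall>i. norm (x (dense_seq i)) \<le> c * norm (dense_seq i :: 'a)"
    by (meson mult_right_mono norm_blinfun norm_ge_zero order_trans)
next
  assume *: "\<forall>i. norm (x (dense_seq i)) \<le> c * norm (dense_seq i :: 'a)"
  show "norm x \<le> c"
  proof (rule norm_blinfun_bound[OF \<open>c \<ge> 0\<close>])
    fix y
    show "norm (x y) \<le> c * norm y"
    proof (rule field_le_epsilon)
      fix e :: real assume "e > 0"
      define \<delta> where "\<delta> = e / (norm x + c + 1)"
      have pos: "norm x + c + 1 > 0" using assms by (simp add: add_nonneg_pos)
      then have "\<delta> > 0" using \<open>e > 0\<close> by (simp add: \<delta>_def)
      from dense_seq[OF this, of y] obtain i where i: "norm (y - dense_seq i) < \<delta>" by blast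
      have "norm (x y) \<le> norm (x (dense_seq i)) + norm (x (y - dense_seq i))"
        using norm_triangle_ineq[of "x (dense_seq i)" "x (y - dense_seq i)"] by (simp add: blinfun.diff_right)
      also have "\<dots> \<le> c * norm (dense_seq i :: 'a) + norm x * \<delta>"
        using * norm_blinfun[of x "y - dense_seq i"] mult_left_mono[OF less_imp_le[OF i] norm_ge_zero[of x]]
        by (intro add_mono) (auto intro: order_trans)
      also have "norm (dense_seq i :: 'a) \<le> norm y + \<delta>"
        using i norm_triangle_ineq2[of "dense_seq i" y] by (simp add: norm_minus_commute)
      then have "c * norm (dense_seq i :: 'a) \<le> c * (norm y + \<delta>)"
        using assms by (rule mult_left_mono)
      finally have "norm (x y) \<le> c * norm y + (norm x + c) * \<delta>" by (simp add: algebra_simps)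
      also have "(norm x + c) * \<delta> \<le> (norm x + c + 1) * \<delta>"
        using \<open>\<delta> > 0\<close> by simp
      also have "\<dots> = e" using pos by (simp add: \<delta>_def)
      finally show "norm (x y) \<le> c * norm y + e" by simp
    qed
  qed
qed

lemma blinfun_eq_iff_dense:
  fixes x x' :: "'a::{real_normed_vector, second_countable_topology} \<Rightarrow>\<^sub>L 'b::real_normed_vector"
  shows "x = x' \<longleftrightarrow> (\<forall>i. x (dense_seq i) = x' (dense_seq i))"
  using norm_blinfun_le_iff_dense[of 0 "x - x'"] by (auto simp: blinfun.diff_left)

definition weakly_measurable ::
    "'w measure \<Rightarrow> ('w \<Rightarrow> 'a::real_normed_vector \<Rightarrow>\<^sub>L 'k::real_normed_vector) \<Rightarrow> bool"
  where "weakly_measurable M f \<longleftrightarrow> (\<forall>y. (\<lambda>w. blinfun_apply (f w) y) \<in> borel_measurable M)"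

lemma weakly_measurableD[measurable_dest]:
  "weakly_measurable M f \<Longrightarrow> (\<lambda>w. blinfun_apply (f w) y) \<in> borel_measurable M"
  by (simp add: weakly_measurable_def)

lemma weakly_measurable_norm:
  fixes f :: "'w \<Rightarrow> 'a::{real_normed_vector, second_countable_topology} \<Rightarrow>\<^sub>L 'k::{real_normed_vector, second_countable_topology}"
  assumes [measurable]: "weakly_measurable M f"
  shows "(\<lambda>w. norm (f w)) \<in> borel_measurable M"
proof (rule borel_measurableI_le)
  fix a :: real
  show "{w \<in> space M. norm (f w) \<le> a} \<in> sets M"
  proof (cases "a \<ge> 0")
    case True
    have "{w \<in> space M. \<forall>i. norm (f w (dense_seq i)) \<le> a * norm (dense_seq i :: 'a)} \<in> sets M"
      by measurable
    then show ?thesis by (simp add: norm_blinfun_le_iff_dense[OF True])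
  next
    case False
    then have "\<not> norm (f w) \<le> a" for w
      using norm_ge_zero[of "f w"] by linarith
    then show ?thesis by simp
  qed
qed

text \<open>The vector \<open>y w\<close> is replaced by the first member of a dense sequence that is close to it; only
  countably many evaluations are then involved.\<close>

lemma weakly_measurable_eval:
  fixes f :: "'w \<Rightarrow> 'a::{real_normed_vector, second_countable_topology} \<Rightarrow>\<^sub>L 'k::{real_normed_vector, second_countable_topology}"
  assumes [measurable]: "weakly_measurable M f" "y \<in> borel_measurable M"
  shows "(\<lambda>w. f w (y w)) \<in> borel_measurable M"
proof -
  define k where "k n w = (LEAST i. norm (y w - dense_seq i) < 1 / real (Suc n))" for n w
  have [measurable]: "k n \<in> M \<rightarrow>\<^sub>M count_space UNIV" for n
    unfolding k_def by measurable
  have k: "norm (y w - dense_seq (k n w)) < 1 / real (Suc n)" for n w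
    unfolding k_def by (rule LeastI_ex) (rule dense_seq, simp)
  show ?thesis
  proof (rule borel_measurable_LIMSEQ_metric)
    show "(\<lambda>w. f w (dense_seq (k n w))) \<in> borel_measurable M" for n
      by (rule measurable_compose_countable[where f = "\<lambda>i w. f w (dense_seq i)"]) measurable
    fix w
    have "(\<lambda>n. dense_seq (k n w)) \<longlonglongrightarrow> y w"
    proof (rule LIMSEQ_I)
      fix r :: real assume "r > 0"
      then obtain N where N: "1 / real (Suc N) < r"
        using reals_Archimedean[of r] by (auto simp: inverse_eq_divide)
      have "norm (dense_seq (k n w) - y w) < r" if "n \<ge> N" for n
      proof -
        have "1 / real (Suc n) \<le> 1 / real (Suc N)" using that by (simp add: frac_le)
        then show ?thesis using k[of w n] N by (simp add: norm_minus_commute)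
      qed
      then show "\<exists>N. \<forall>n\<ge>N. norm (dense_seq (k n w) - y w) < r" by blast
    qed
    then show "(\<lambda>n. f w (dense_seq (k n w))) \<longlonglongrightarrow> f w (y w)"
      by (rule blinfun.tendsto[OF tendsto_const])
  qed
qed

lemma weakly_measurable_compose:
  "weakly_measurable N f \<Longrightarrow> g \<in> M \<rightarrow>\<^sub>M N \<Longrightarrow> weakly_measurable M (\<lambda>w. f (g w))"
  unfolding weakly_measurable_def
  by (auto intro: measurable_compose[where f = g and g = "\<lambda>v. f v _"])

lemma sets_Collect_weakly_measurable_eq:
  fixes f g :: "'w \<Rightarrow> 'a::{real_normed_vector, second_countable_topology} \<Rightarrow>\<^sub>L 'k::{real_normed_vector, second_countable_topology}"
  assumes [measurable]: "weakly_measurable M f" "weakly_measurable M g"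
  shows "{w \<in> space M. f w = g w} \<in> sets M"
  unfolding blinfun_eq_iff_dense by measurable

text \<open>On bounded sets the values on a dense sequence of vectors determine the weak* topology, which there is
  a subspace of a countable power of the scalars.\<close>

lemma weak_star_open_on_ball:
  fixes smul :: "'k::{real_normed_field, euclidean_space} \<Rightarrow> 'a::{banach, second_countable_topology} \<Rightarrow> 'a"
  assumes "openin (weak_star_topology smul) U"
  obtains W :: "(nat \<Rightarrow> 'k) set" where "open W"
    "\<And>x. x \<in> dual_space smul \<Longrightarrow> norm x \<le> c \<Longrightarrow> x \<in> U \<longleftrightarrow> (\<lambda>i. x (dense_seq i)) \<in> W"
proof -
  obtain V where V: "open (V :: ('a \<Rightarrow> 'k) set)" and U: "U = blinfun_apply -` V \<inter> dual_space smul"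
    using assms unfolding weak_star_topology_def openin_subtopology strong_operator_topology_def
      openin_pullback_topology by auto
  define \<W> where "\<W> = {W :: (nat \<Rightarrow> 'k) set. open W \<and>
    (\<forall>x :: 'a \<Rightarrow>\<^sub>L 'k. norm x \<le> c \<longrightarrow> (\<lambda>i. blinfun_apply x (dense_seq i)) \<in> W \<longrightarrow> blinfun_apply x \<in> V)}"
  have "\<exists>W\<in>\<W>. (\<lambda>i. blinfun_apply x (dense_seq i)) \<in> W"
    if x: "norm x \<le> c" "blinfun_apply x \<in> V" for x
  proof -
    have "openin (product_topology (\<lambda>_. euclidean) UNIV) V"
      using V by (simp add: open_fun_def)
    from product_topology_open_contains_basis[OF this x(2)]
    obtain X where X: "blinfun_apply x \<in> (\<Pi>\<^sub>E i\<in>UNIV. X i)" "\<And>i. open (X i)" "finite {i. X i \<noteq> UNIV}"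
      "(\<Pi>\<^sub>E i\<in>UNIV. X i) \<subseteq> V"
      by auto
    let ?F = "{i. X i \<noteq> UNIV}"
    have "\<exists>e>0. ball (x y) e \<subseteq> X y" for y
      using X(1,2) open_contains_ball by (fastforce simp: PiE_iff)
    then obtain e where e: "\<And>y. e y > 0" "\<And>y. ball (x y) (e y) \<subseteq> X y" by metis
    have c: "c \<ge> 0" using x(1) norm_ge_zero order_trans by blast
    have "\<exists>i. norm (y - dense_seq i) < e y / (4 * (c + 1))" for y
      using e(1)[of y] c by (intro dense_seq) simp
    then obtain i where i: "\<And>y. norm (y - dense_seq (i y)) < e y / (4 * (c + 1))" by metis
    \<comment> \<open>nearby dense vectors stand in for the finitely many \<open>y\<close> that matter; the bound \<open>c\<close> controls the change\<close>
    define W where "W = (\<Inter>y\<in>?F. {z :: nat \<Rightarrow> 'k. dist (z (i y)) (x (dense_seq (i y))) < e y / 2})"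
    have "open W"
      unfolding W_def using X(3)
      by (intro open_INT ballI open_Collect_less continuous_intros continuous_on_product_coordinates) auto
    moreover have "blinfun_apply x' \<in> V" if x': "norm x' \<le> c" "(\<lambda>i. x' (dense_seq i)) \<in> W" for x' :: "'a \<Rightarrow>\<^sub>L 'k"
    proof -
      have "x' y \<in> X y" for y
      proof (cases "y \<in> ?F")
        case True
        let ?d = "dense_seq (i y)"
        have small: "norm (z (y - ?d)) \<le> e y / 4" if "norm z \<le> c" for z :: "'a \<Rightarrow>\<^sub>L 'k"
        proof -
          have "norm (z (y - ?d)) \<le> norm z * norm (y - ?d)" by (rule norm_blinfun)
          also have "\<dots> \<le> (c + 1) * (e y / (4 * (c + 1)))"
            using that c i[of y] by (intro mult_mono) auto
          also have "\<dots> = e y / 4" using c by (simp add: field_simps)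
          finally show ?thesis .
        qed
        have eq: "x' y - x y = x' (y - ?d) + (x' ?d - x ?d) - x (y - ?d)"
          by (simp add: blinfun.diff_right)
        have "norm (x' y - x y) \<le> norm (x' (y - ?d)) + norm (x' ?d - x ?d) + norm (x (y - ?d))"
          unfolding eq using norm_triangle_ineq4[of "x' (y - ?d) + (x' ?d - x ?d)" "x (y - ?d)"]
            norm_triangle_ineq[of "x' (y - ?d)" "x' ?d - x ?d"] by linarith
        moreover have "norm (x' ?d - x ?d) < e y / 2"
          using x'(2) True by (auto simp: W_def dist_norm)
        ultimately have "norm (x' y - x y) < e y"
          using small[OF x'(1)] small[OF x(1)] by linarith
        then show ?thesis
          using e(2)[of y] by (auto simp: dist_norm norm_minus_commute)
      qed auto
      then show ?thesis
        using X(4) by auto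
    qed
    moreover have "(\<lambda>i. x (dense_seq i)) \<in> W"
      using e(1) by (simp add: W_def)
    ultimately show ?thesis unfolding \<W>_def by blast
  qed
  moreover have "open (\<Union>\<W>)"
    unfolding \<W>_def by (intro open_Union) auto
  ultimately show thesis
    by (intro that[of "\<Union>\<W>"]) (auto simp: U \<W>_def)
qed

text \<open>The weak* Borel structure is generated by the evaluations: the dual is a countable union of balls, and
  on each of them weak* open sets come from a second countable space.\<close>

lemma weak_star_measurableI:
  fixes f :: "'w \<Rightarrow> 'a::{banach, second_countable_topology} \<Rightarrow>\<^sub>L 'k::{real_normed_field, euclidean_space}"
  assumes [measurable]: "weakly_measurable M f" and f: "\<And>w. w \<in> space M \<Longrightarrow> f w \<in> dual_space smul"
  shows "f \<in> M \<rightarrow>\<^sub>M weak_star_borel smul"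
  unfolding weak_star_borel_def
proof (rule measurable_measure_of)
  show "{U. openin (weak_star_topology smul) U} \<subseteq> Pow (dual_space smul)"
    by (auto simp: weak_star_topology_def openin_subtopology)
  show "f \<in> space M \<rightarrow> dual_space smul" using f by auto
  fix U assume "U \<in> {U. openin (weak_star_topology smul) U}"
  then have U: "openin (weak_star_topology smul) U" by simp
  have "\<exists>W :: (nat \<Rightarrow> 'k) set. open W \<and>
    (\<forall>x\<in>dual_space smul. norm x \<le> real n \<longrightarrow> x \<in> U \<longleftrightarrow> (\<lambda>i. x (dense_seq i)) \<in> W)" for n
    using weak_star_open_on_ball[OF U, of "real n"] by metis
  then obtain W :: "nat \<Rightarrow> (nat \<Rightarrow> 'k) set" where W: "\<And>n. open (W n)"
    "\<And>n x. x \<in> dual_space smul \<Longrightarrow> norm x \<le> real n \<Longrightarrow> x \<in> U \<longleftrightarrow> (\<lambda>i. x (dense_seq i)) \<in> W n"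
    by metis
  have [measurable]: "(\<lambda>w. norm (f w)) \<in> borel_measurable M"
    by (rule weakly_measurable_norm) fact
  have [measurable]: "(\<lambda>w. \<lambda>i. f w (dense_seq i)) \<in> borel_measurable M"
    by (rule measurable_coordinatewise_then_product) measurable
  have [measurable]: "W n \<in> sets borel" for n using W(1) by simp
  have "f -` U \<inter> space M = {w \<in> space M. \<exists>n. norm (f w) \<le> real n \<and> (\<lambda>i. f w (dense_seq i)) \<in> W n}"
    using W(2)[OF f] real_arch_simple by blast
  also have "\<dots> \<in> sets M" by measurable
  finally show "f -` U \<inter> space M \<in> sets M" .
qed

lemma weak_star_measurableD:
  fixes smul :: "'k::real_normed_field \<Rightarrow> 'a::real_normed_vector \<Rightarrow> 'a"
  assumes f: "f \<in> M \<rightarrow>\<^sub>M weak_star_borel smul"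
  shows "weakly_measurable M f" "w \<in> space M \<Longrightarrow> f w \<in> dual_space smul"
proof -
  have sp: "{U. openin (weak_star_topology smul) U} \<subseteq> Pow (dual_space smul)"
    by (auto simp: weak_star_topology_def openin_subtopology)
  show "w \<in> space M \<Longrightarrow> f w \<in> dual_space smul"
    using measurable_space[OF f, of w] sp by (simp add: weak_star_borel_def space_measure_of)
  have "(\<lambda>x. blinfun_apply x y) \<in> weak_star_borel smul \<rightarrow>\<^sub>M borel" for y
  proof (rule borel_measurableI)
    fix S :: "'k set" assume S: "open S"
    have "openin (weak_star_topology smul) ((\<lambda>x. blinfun_apply x y) -` S \<inter> dual_space smul)"
    proof -
      have "open ((\<lambda>z :: 'a \<Rightarrow> 'k. z y) -` S)"
        using S by (intro open_vimage continuous_on_product_coordinates)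
      then have "openin strong_operator_topology (blinfun_apply -` ((\<lambda>z. z y) -` S))"
        unfolding strong_operator_topology_def openin_pullback_topology
        by auto
      then show ?thesis
        unfolding weak_star_topology_def openin_subtopology by (auto simp: vimage_def)
    qed
    then show "(\<lambda>x. blinfun_apply x y) -` S \<inter> space (weak_star_borel smul) \<in> sets (weak_star_borel smul)"
      using sp by (simp add: weak_star_borel_def space_measure_of sets_measure_of)
  qed
  from measurable_compose[OF f this] show "weakly_measurable M f"
    by (simp add: weakly_measurable_def)
qed

lemma weakly_measurable_mono:
  assumes "weakly_measurable N f" "space N = space M" "sets N \<subseteq> sets M"
  shows "weakly_measurable M f"
  using assms unfolding weakly_measurable_def by (auto simp: measurable_def)

lemma integrable_eval:
  fixes f :: "'w \<Rightarrow> 'a::{banach, second_countable_topology} \<Rightarrow>\<^sub>L 'k::{banach, second_countable_topology}"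
  assumes f: "weakly_measurable M f" and bound: "AE w in M. norm (f w) \<le> C" and Z: "integrable M Z"
  shows "integrable M (\<lambda>w. f w (Z w))"
proof (rule Bochner_Integration.integrable_bound)
  show "integrable M (\<lambda>w. C * norm (Z w))" using Z by simp
  show "(\<lambda>w. f w (Z w)) \<in> borel_measurable M"
    using f borel_measurable_integrable[OF Z] by (rule weakly_measurable_eval)
  show "AE w in M. norm (f w (Z w)) \<le> norm (C * norm (Z w))"
    using bound
  proof eventually_elim
    case (elim w)
    have "norm (f w (Z w)) \<le> norm (f w) * norm (Z w)" by (rule norm_blinfun)
    also have "\<dots> \<le> C * norm (Z w)" using elim by (rule mult_right_mono) simp
    finally show ?case by simp
  qed
qed

lemma norm_integral_eval_le:
  fixes f :: "'w \<Rightarrow> 'a::{banach, second_countable_topology} \<Rightarrow>\<^sub>L 'k::{banach, second_countable_topology}"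
  assumes f: "weakly_measurable M f" and bound: "\<And>w. norm (f w) \<le> C" and Z: "integrable M Z"
  shows "norm (\<integral>w. f w (Z w) \<partial>M) \<le> C * (\<integral>w. norm (Z w) \<partial>M)"
proof -
  have "norm (\<integral>w. f w (Z w) \<partial>M) \<le> (\<integral>w. norm (f w (Z w)) \<partial>M)"
    by (rule integral_norm_bound)
  also have "\<dots> \<le> (\<integral>w. C * norm (Z w) \<partial>M)"
  proof (rule integral_mono)
    show "integrable M (\<lambda>w. norm (f w (Z w)))"
      using integrable_eval[OF f _ Z, of C] bound by simp
    show "norm (f w (Z w)) \<le> C * norm (Z w)" for w
      by (rule order_trans[OF norm_blinfun mult_right_mono[OF bound norm_ge_zero]])
  qed (use Z in simp)
  finally show ?thesis by simp
qed

lemma (in finite_measure) weak_star_integral_apply: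
  fixes f :: "'a \<Rightarrow> 'c::{banach, second_countable_topology} \<Rightarrow>\<^sub>L 'k::{real_normed_field, euclidean_space}"
  assumes f: "weakly_measurable M f" and bound: "\<And>w. norm (f w) \<le> C"
  shows "blinfun_apply (weak_star_integral M f) y = (\<integral>w. f w y \<partial>M)"
proof -
  have int: "integrable M (\<lambda>w. f w y)" for y
    using integrable_eval[OF f, of C "\<lambda>_. y"] bound by simp
  have "bounded_linear (\<lambda>y. \<integral>w. f w y \<partial>M)"
  proof (rule bounded_linear_intro[where K = "C * measure M (space M)"])
    show "(\<integral>w. f w (y + z) \<partial>M) = (\<integral>w. f w y \<partial>M) + (\<integral>w. f w z \<partial>M)" for y z
      using int by (simp add: blinfun.add_right)
    show "(\<integral>w. f w (r *\<^sub>R y) \<partial>M) = r *\<^sub>R (\<integral>w. f w y \<partial>M)" for r y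
      by (simp add: blinfun.scaleR_right)
    show "norm (\<integral>w. f w y \<partial>M) \<le> norm y * (C * measure M (space M))" for y
      using norm_integral_eval_le[OF f bound, of "\<lambda>_. y"] by (simp add: mult_ac)
  qed
  then show ?thesis
    by (simp add: weak_star_integral_def bounded_linear_Blinfun_apply)
qed

lemma (in finite_measure) weak_star_integral_dual_space:
  fixes f :: "'a \<Rightarrow> 'c::{banach, second_countable_topology} \<Rightarrow>\<^sub>L 'k::{real_normed_field, euclidean_space}"
  assumes f: "weakly_measurable M f" and bound: "\<And>w. norm (f w) \<le> C" and "\<And>w. f w \<in> dual_space smul"
  shows "weak_star_integral M f \<in> dual_space smul"
  using assms(3) by (simp add: dual_space_def weak_star_integral_apply[OF f bound])

section \<open>Shift-invariant functions\<close>

lemma measurable_path_shift[measurable]: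
  "path_shift \<in> path_space \<rightarrow>\<^sub>M (path_space :: (nat \<Rightarrow> 'g::topological_space) measure)"
  unfolding path_shift_def[abs_def] by (rule measurable_PiM_single') (auto intro: measurable_component_singleton)

lemma sets_invariant_algebra:
  "sets (invariant_algebra :: (nat \<Rightarrow> 'g::topological_space) measure)
    = {A \<in> sets path_space. path_shift -` A = A}"
proof -
  have "sigma_algebra UNIV {A \<in> sets (path_space :: (nat \<Rightarrow> 'g) measure). path_shift -` A = A}"
  proof (unfold sigma_algebra_iff2, intro conjI ballI allI impI)
    show "UNIV - s \<in> {A \<in> sets (path_space :: (nat \<Rightarrow> 'g) measure). path_shift -` A = A}"
      if "s \<in> {A \<in> sets path_space. path_shift -` A = A}" for s
    proof -
      have "UNIV - s \<in> sets path_space"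
        using that sets.compl_sets[of s path_space] by simp
      moreover have "path_shift -` (UNIV - s) = UNIV - path_shift -` s" by auto
      ultimately show ?thesis using that by simp
    qed
    show "(\<Union>i. A i) \<in> {A \<in> sets (path_space :: (nat \<Rightarrow> 'g) measure). path_shift -` A = A}"
      if "range A \<subseteq> {A \<in> sets path_space. path_shift -` A = A}" for A :: "nat \<Rightarrow> _"
      using that by (auto simp: vimage_Union)
  qed auto
  then show ?thesis
    unfolding invariant_algebra_def
    by (subst sets_measure_of) (auto simp: sigma_algebra.sigma_sets_eq)
qed

lemma space_invariant_algebra[simp]: "space invariant_algebra = UNIV"
  by (simp add: invariant_algebra_def space_measure_of)

lemma subalgebra_invariant: "sets M = sets path_space \<Longrightarrow> subalgebra M invariant_algebra"
  using sets_eq_imp_space_eq[of M path_space]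
  by (auto simp: subalgebra_def sets_invariant_algebra)

lemma measurable_invariantI:
  "f \<in> path_space \<rightarrow>\<^sub>M N \<Longrightarrow> (\<And>w. f (path_shift w) = f w) \<Longrightarrow> f \<in> invariant_algebra \<rightarrow>\<^sub>M N"
  by (auto simp: measurable_def sets_invariant_algebra)

lemma measurable_invariantD: "f \<in> invariant_algebra \<rightarrow>\<^sub>M N \<Longrightarrow> f \<in> path_space \<rightarrow>\<^sub>M N"
  by (auto simp: measurable_def sets_invariant_algebra)

text \<open>The level sets of an invariantly measurable function are invariant, so invariance holds at every path.\<close>

lemma measurable_invariant_shift:
  fixes f :: "_ \<Rightarrow> 'b::t1_space"
  assumes "f \<in> borel_measurable invariant_algebra"
  shows "f (path_shift w) = f w"
proof -
  have "f -` {f w} \<inter> space invariant_algebra \<in> sets invariant_algebra"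
    using assms by (rule measurable_sets) simp
  then show ?thesis
    by (auto simp: sets_invariant_algebra)
qed

lemma weakly_measurable_invariant_shift:
  fixes f :: "_ \<Rightarrow> 'a::real_normed_vector \<Rightarrow>\<^sub>L 'k::real_normed_vector"
  assumes "weakly_measurable invariant_algebra f"
  shows "f (path_shift w) = f w"
proof (rule blinfun_eqI)
  show "f (path_shift w) y = f w y" for y
    using assms by (intro measurable_invariant_shift[where f = "\<lambda>w. f w y"]) (simp add: weakly_measurable_def)
qed

section \<open>Boundary values of harmonic elements\<close>

lemma borel_measurable_group_minus[measurable (raw)]:
  fixes f :: "'w \<Rightarrow> 'g::{topological_group_add, t2_space, second_countable_topology}"
  shows "f \<in> borel_measurable M \<Longrightarrow> (\<lambda>w. - f w) \<in> borel_measurable M"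
  by (rule measurable_compose[OF _ borel_measurable_continuous_onI])
     (auto intro!: continuous_on_minus continuous_on_id)

text \<open>The additive notation makes \<open>\<rho> (- g) y\<close> the vector \<open>\<pi>\<^sub>*(g\<^sup>-\<^sup>1)y\<close>, so that \<open>x (\<rho> (- g) y)\<close> is
  \<open>\<langle>y, \<pi>(g)x\<rangle>\<close>.\<close>

locale isometric_rep =
  fixes smul :: "'k::{real_normed_field, euclidean_space} \<Rightarrow> 'a::{banach, second_countable_topology} \<Rightarrow> 'a"
    and \<rho> :: "'g::{topological_group_add, t2_space, second_countable_topology} \<Rightarrow> 'a \<Rightarrow>\<^sub>L 'a"
  assumes normed_space_over: "normed_space_over smul"
    and isometric: "isometric_representation smul \<rho>"
begin

lemma rep_zero[simp]: "\<rho> 0 y = y"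
  and rep_add: "\<rho> (g + h) y = \<rho> g (\<rho> h y)"
  and rep_smul: "\<rho> g (smul c y) = smul c (\<rho> g y)"
  and norm_rep[simp]: "norm (\<rho> g y) = norm y"
  and continuous_rep: "continuous_on UNIV (\<lambda>g. \<rho> g y)"
  using isometric by (auto simp: isometric_representation_def)

lemma rep_minus_cancel[simp]: "\<rho> (- g) (\<rho> g y) = y" "\<rho> g (\<rho> (- g) y) = y"
  by (simp_all add: rep_add[symmetric])

lemma rep_minus_add:
  "\<rho> (- (g + h)) y = \<rho> (- h) (\<rho> (- g) y)" "\<rho> (- h - g) y = \<rho> (- h) (\<rho> (- g) y)"
  by (simp_all only: minus_add diff_conv_add_uminus rep_add)

lemma weakly_measurable_rep: "f \<in> M \<rightarrow>\<^sub>M borel \<Longrightarrow> weakly_measurable M (\<lambda>w. \<rho> (f w))"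
  unfolding weakly_measurable_def
  by (auto intro!: measurable_compose[of f M borel] borel_measurable_continuous_onI continuous_rep)

lemma measurable_rep[measurable (raw)]:
  assumes "f \<in> M \<rightarrow>\<^sub>M borel" "y \<in> M \<rightarrow>\<^sub>M borel"
  shows "(\<lambda>w. \<rho> (f w) (y w)) \<in> borel_measurable M"
  using weakly_measurable_rep[OF assms(1)] assms(2) by (rule weakly_measurable_eval)

lemma adjoint_apply[simp]: "blinfun_apply (adjoint_representation \<rho> g x) y = x (\<rho> (- g) y)"
  by (simp add: adjoint_representation_def)

lemma adjoint_minus_cancel[simp]: "adjoint_representation \<rho> g (adjoint_representation \<rho> (- g) x) = x"
  by (rule blinfun_eqI) simp

lemma norm_adjoint_le: "norm (adjoint_representation \<rho> g x) \<le> norm x"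
  by (rule norm_blinfun_bound) (use norm_blinfun[of x "\<rho> (- g) _"] in auto)

lemma norm_adjoint[simp]: "norm (adjoint_representation \<rho> g x) = norm (x :: 'a \<Rightarrow>\<^sub>L 'k)"
  using norm_adjoint_le[of g x] norm_adjoint_le[of "- g" "adjoint_representation \<rho> g x"]
    adjoint_minus_cancel[of "- g" x] by simp

lemma adjoint_dual_space: "x \<in> dual_space smul \<Longrightarrow> adjoint_representation \<rho> g x \<in> dual_space smul"
  by (simp add: dual_space_def rep_smul)

lemma norm_eval_rep_le: "norm (x (\<rho> g y)) \<le> norm x * norm y" for x :: "'a \<Rightarrow>\<^sub>L 'k"
  using norm_blinfun[of x "\<rho> g y"] by simp

text \<open>The weak* limit of \<open>\<pi>(w\<^sub>n)x\<close>. The exceptional value \<open>0\<close> is fixed by every \<open>\<pi>(g)\<close>, and whether the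
  limit exists is unaffected by translations and shifts of the path; so equivariance and
  invariance hold without exceptional paths.\<close>

definition boundary_fun :: "('a \<Rightarrow>\<^sub>L 'k) \<Rightarrow> (nat \<Rightarrow> 'g) \<Rightarrow> 'a \<Rightarrow>\<^sub>L 'k"
  where "boundary_fun x w =
    (if \<forall>y. convergent (\<lambda>n. x (\<rho> (- w n) y)) then Blinfun (\<lambda>y. lim (\<lambda>n. x (\<rho> (- w n) y))) else 0)"

lemma boundary_fun_tendsto:
  fixes x :: "'a \<Rightarrow>\<^sub>L 'k"
  assumes "\<And>y. convergent (\<lambda>n. x (\<rho> (- w n) y))"
  shows "(\<lambda>n. x (\<rho> (- w n) y)) \<longlonglongrightarrow> boundary_fun x w y"
proof -
  have lim: "(\<lambda>n. x (\<rho> (- w n) y)) \<longlonglongrightarrow> lim (\<lambda>n. x (\<rho> (- w n) y))" for y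
    using assms by (simp add: convergent_LIMSEQ_iff)
  have "bounded_linear (\<lambda>y. lim (\<lambda>n. x (\<rho> (- w n) y)))"
  proof (rule bounded_linear_intro[where K = "norm x"])
    show "lim (\<lambda>n. x (\<rho> (- w n) (y + z))) = lim (\<lambda>n. x (\<rho> (- w n) y)) + lim (\<lambda>n. x (\<rho> (- w n) z))" for y z
      using tendsto_add[OF lim[of y] lim[of z]] by (intro limI) (simp add: blinfun.add_right)
    show "lim (\<lambda>n. x (\<rho> (- w n) (r *\<^sub>R y))) = r *\<^sub>R lim (\<lambda>n. x (\<rho> (- w n) y))" for r y
      using tendsto_scaleR[OF tendsto_const lim[of y], of r] by (intro limI) (simp add: blinfun.scaleR_right)
    show "norm (lim (\<lambda>n. x (\<rho> (- w n) y))) \<le> norm y * norm x" for y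
      using tendsto_norm[OF lim[of y]]
      by (rule LIMSEQ_le_const2) (auto intro!: exI[of _ 0] norm_eval_rep_le simp: mult.commute[of "norm y"])
  qed
  then show ?thesis
    using lim[of y] assms by (simp add: boundary_fun_def bounded_linear_Blinfun_apply)
qed

text \<open>The operators \<open>\<rho> (- w n)\<close> are isometries, so the sequences depend on \<open>y\<close> equicontinuously.\<close>

lemma convergent_if_dense:
  fixes x :: "'a \<Rightarrow>\<^sub>L 'k"
  assumes "\<And>i. convergent (\<lambda>n. x (\<rho> (- w n) (dense_seq i)))"
  shows "convergent (\<lambda>n. blinfun_apply (x :: 'a \<Rightarrow>\<^sub>L 'k) (\<rho> (- w n) y))"
proof -
  have "Cauchy (\<lambda>n. x (\<rho> (- w n) y))"
  proof (rule metric_CauchyI)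
    fix e :: real assume "e > 0"
    define \<delta> where "\<delta> = e / (4 * (norm x + 1))"
    have "norm x + 1 > 0" by (simp add: add_nonneg_pos)
    then have "\<delta> > 0" using \<open>e > 0\<close> by (simp add: \<delta>_def)
    from dense_seq[OF this, of y] obtain i where i: "norm (y - dense_seq i) < \<delta>" by blast
    have "Cauchy (\<lambda>n. x (\<rho> (- w n) (dense_seq i)))"
      using assms[of i] by (simp add: Cauchy_convergent_iff)
    from metric_CauchyD[OF this, of "e / 2"] \<open>e > 0\<close> obtain M where M:
      "\<And>m n. m \<ge> M \<Longrightarrow> n \<ge> M \<Longrightarrow> dist (x (\<rho> (- w m) (dense_seq i))) (x (\<rho> (- w n) (dense_seq i))) < e / 2"
      by auto
    have close: "dist (x (\<rho> g y)) (x (\<rho> g (dense_seq i))) \<le> e / 4" for g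
    proof -
      have "dist (x (\<rho> g y)) (x (\<rho> g (dense_seq i))) = norm (x (\<rho> g (y - dense_seq i)))"
        by (simp add: dist_norm blinfun.diff_right)
      also have "\<dots> \<le> norm x * norm (y - dense_seq i)" by (rule norm_eval_rep_le)
      also have "\<dots> \<le> (norm x + 1) * \<delta>" using i by (intro mult_mono) auto
      also have "\<dots> = e / 4" using \<open>norm x + 1 > 0\<close> by (simp add: \<delta>_def field_simps)
      finally show ?thesis .
    qed
    have "dist (x (\<rho> (- w m) y)) (x (\<rho> (- w n) y)) < e" if "m \<ge> M" "n \<ge> M" for m n
      using M[OF that] close[of "- w m"] close[of "- w n"]
        dist_triangle[of "x (\<rho> (- w m) y)" "x (\<rho> (- w n) y)" "x (\<rho> (- w m) (dense_seq i))"]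
        dist_triangle[of "x (\<rho> (- w m) (dense_seq i))" "x (\<rho> (- w n) y)" "x (\<rho> (- w n) (dense_seq i))"]
        dist_commute[of "x (\<rho> (- w n) (dense_seq i))" "x (\<rho> (- w n) y)"]
      by linarith
    then show "\<exists>M. \<forall>m\<ge>M. \<forall>n\<ge>M. dist (x (\<rho> (- w m) y)) (x (\<rho> (- w n) y)) < e" by blast
  qed
  then show ?thesis by (simp add: Cauchy_convergent_iff)
qed

lemma boundary_fun_eq_0:
  fixes x :: "'a \<Rightarrow>\<^sub>L 'k"
  shows "\<not> convergent (\<lambda>n. x (\<rho> (- w n) y)) \<Longrightarrow> boundary_fun x w = 0"
  by (auto simp: boundary_fun_def)

lemma norm_boundary_fun_le: "norm (boundary_fun x w) \<le> norm x"
proof (cases "\<forall>y. convergent (\<lambda>n. x (\<rho> (- w n) y))")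
  case True
  show ?thesis
  proof (rule norm_blinfun_bound)
    fix y
    from True have "(\<lambda>n. norm (x (\<rho> (- w n) y))) \<longlonglongrightarrow> norm (boundary_fun x w y)"
      by (intro tendsto_norm boundary_fun_tendsto) auto
    then show "norm (boundary_fun x w y) \<le> norm x * norm y"
      by (rule LIMSEQ_le_const2) (auto intro!: exI[of _ 0] norm_eval_rep_le)
  qed simp
qed (auto simp: boundary_fun_eq_0)

lemma boundary_fun_dual_space:
  assumes "x \<in> dual_space smul"
  shows "boundary_fun x w \<in> dual_space smul"
proof (cases "\<forall>y. convergent (\<lambda>n. x (\<rho> (- w n) y))")
  case True
  have "boundary_fun x w (smul c y) = c * boundary_fun x w y" for c y
  proof (rule LIMSEQ_unique)
    show "(\<lambda>n. x (\<rho> (- w n) (smul c y))) \<longlonglongrightarrow> boundary_fun x w (smul c y)"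
      using True by (intro boundary_fun_tendsto) auto
    have "(\<lambda>n. c * x (\<rho> (- w n) y)) \<longlonglongrightarrow> c * boundary_fun x w y"
      using True by (intro tendsto_mult_left boundary_fun_tendsto) auto
    then show "(\<lambda>n. x (\<rho> (- w n) (smul c y))) \<longlonglongrightarrow> c * boundary_fun x w y"
      using assms by (simp add: rep_smul dual_space_def)
  qed
  then show ?thesis by (simp add: dual_space_def)
qed (auto simp: boundary_fun_eq_0 dual_space_def)

lemma boundary_fun_apply:
  fixes x :: "'a \<Rightarrow>\<^sub>L 'k"
  shows "boundary_fun x w y = (if \<forall>i. Cauchy (\<lambda>n. x (\<rho> (- w n) (dense_seq i)))
    then lim (\<lambda>n. x (\<rho> (- w n) y)) else 0)"
proof (cases "\<forall>i. convergent (\<lambda>n. x (\<rho> (- w n) (dense_seq i)))")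
  case True
  then have "convergent (\<lambda>n. x (\<rho> (- w n) z))" for z
    by (blast intro: convergent_if_dense)
  then have "(\<lambda>n. x (\<rho> (- w n) y)) \<longlonglongrightarrow> boundary_fun x w y"
    by (rule boundary_fun_tendsto)
  then show ?thesis using True by (simp add: limI Cauchy_convergent_iff)
next
  case False
  then show ?thesis by (auto simp: boundary_fun_eq_0 Cauchy_convergent_iff)
qed

lemma weakly_measurable_boundary_fun: "weakly_measurable path_space (boundary_fun x)"
  unfolding weakly_measurable_def
proof
  fix y
  have [measurable]: "(\<lambda>w. x (\<rho> (- w n) z)) \<in> borel_measurable path_space" for n z
    by (rule borel_measurable_continuous_on[where f = "blinfun_apply x"])
       (auto intro!: linear_continuous_on blinfun.bounded_linear_right)
  show "(\<lambda>w. boundary_fun x w y) \<in> borel_measurable path_space"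
    unfolding boundary_fun_apply
  proof (rule measurable_If)
    have "{w \<in> space path_space. Cauchy (\<lambda>n. x (\<rho> (- w n) (dense_seq i)))} \<in> sets path_space" for i
      by (rule sets_Collect_Cauchy) simp
    then show "{w \<in> space path_space. \<forall>i. Cauchy (\<lambda>n. x (\<rho> (- w n) (dense_seq i)))} \<in> sets path_space"
      by (rule sets.sets_Collect_countable_All)
    show "(\<lambda>w. lim (\<lambda>n. x (\<rho> (- w n) y))) \<in> borel_measurable path_space"
      by (rule borel_measurable_lim_metric) simp
  qed simp
qed

lemma boundary_fun_shift: "boundary_fun x (path_shift w) = boundary_fun x w"
proof -
  have "convergent (\<lambda>n. x (\<rho> (- path_shift w n) y)) \<longleftrightarrow> convergent (\<lambda>n. x (\<rho> (- w n) y))" for y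
    unfolding path_shift_def by (rule convergent_Suc_iff)
  moreover have "lim (\<lambda>n. x (\<rho> (- path_shift w n) y)) = lim (\<lambda>n. x (\<rho> (- w n) y))"
    if "\<And>y. convergent (\<lambda>n. x (\<rho> (- w n) y))" for y
  proof (rule limI)
    have "(\<lambda>n. x (\<rho> (- w n) y)) \<longlonglongrightarrow> lim (\<lambda>n. x (\<rho> (- w n) y))"
      using that by (simp add: convergent_LIMSEQ_iff)
    from LIMSEQ_Suc[OF this] show "(\<lambda>n. x (\<rho> (- path_shift w n) y)) \<longlonglongrightarrow> lim (\<lambda>n. x (\<rho> (- w n) y))"
      by (simp add: path_shift_def)
  qed
  ultimately show ?thesis
    by (simp add: boundary_fun_def)
qed

lemma boundary_fun_translate:
  "boundary_fun x (path_translate g w) = adjoint_representation \<rho> g (boundary_fun x w)"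
proof (cases "\<forall>y. convergent (\<lambda>n. x (\<rho> (- w n) y))")
  case True
  have tr: "x (\<rho> (- path_translate g w n) y) = x (\<rho> (- w n) (\<rho> (- g) y))" for n y
    by (simp add: path_translate_def rep_minus_add)
  show ?thesis
  proof (rule blinfun_eqI, rule LIMSEQ_unique)
    fix y
    show "(\<lambda>n. x (\<rho> (- path_translate g w n) y)) \<longlonglongrightarrow> boundary_fun x (path_translate g w) y"
      using True by (intro boundary_fun_tendsto) (simp add: tr)
    show "(\<lambda>n. x (\<rho> (- path_translate g w n) y)) \<longlonglongrightarrow> adjoint_representation \<rho> g (boundary_fun x w) y"
      unfolding tr adjoint_apply using True by (intro boundary_fun_tendsto) auto
  qed
next
  case False
  then obtain y where y: "\<not> convergent (\<lambda>n. x (\<rho> (- w n) y))" by auto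
  then have "\<not> convergent (\<lambda>n. x (\<rho> (- path_translate g w n) (\<rho> g y)))"
    by (simp add: path_translate_def rep_minus_add)
  from boundary_fun_eq_0[OF this] boundary_fun_eq_0[OF y] show ?thesis
    by (simp add: adjoint_representation_def)
qed

lemma boundary_fun_strict:
  assumes x: "x \<in> dual_space smul"
  shows "boundary_fun x \<in> strict_equivariant_functions smul \<rho>"
proof -
  have "boundary_fun x \<in> path_space \<rightarrow>\<^sub>M weak_star_borel smul"
    by (intro weak_star_measurableI weakly_measurable_boundary_fun boundary_fun_dual_space x)
  then have "boundary_fun x \<in> invariant_algebra \<rightarrow>\<^sub>M weak_star_borel smul"
    by (rule measurable_invariantI) (rule boundary_fun_shift)
  moreover have "bounded (range (boundary_fun x))"
    by (rule boundedI[of _ "norm x"]) (auto intro: norm_boundary_fun_le)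
  ultimately show ?thesis
    by (simp add: strict_equivariant_functions_def boundary_fun_translate)
qed

end

locale walk_rep = random_walk \<mu> + isometric_rep smul \<rho>
  for \<mu> :: "'g::{topological_group_add, t2_space, second_countable_topology} measure"
    and smul :: "'k::{real_normed_field, euclidean_space} \<Rightarrow> 'a::{banach, second_countable_topology} \<Rightarrow> 'a"
    and \<rho> :: "'g \<Rightarrow> 'a \<Rightarrow>\<^sub>L 'a"
begin

lemma measurable_eval_rep[measurable (raw)]:
  assumes "f \<in> M \<rightarrow>\<^sub>M borel" "y \<in> M \<rightarrow>\<^sub>M borel"
  shows "(\<lambda>w. blinfun_apply (x :: 'a \<Rightarrow>\<^sub>L 'k) (\<rho> (f w) (y w))) \<in> borel_measurable M"
  by (rule borel_measurable_continuous_on[where f = "blinfun_apply x"])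
     (use assms in \<open>auto intro!: linear_continuous_on blinfun.bounded_linear_right measurable_rep\<close>)

abbreviation \<H> :: "('a \<Rightarrow>\<^sub>L 'k) set" where "\<H> \<equiv> harmonic_elements smul \<mu> \<rho>"

lemma harmonic_iff:
  "x \<in> \<H> \<longleftrightarrow>
    x \<in> dual_space smul \<and> (\<forall>y. (\<integral>k. x (\<rho> (- k) y) \<partial>\<mu>) = x y)"
proof -
  have "weakly_measurable \<mu> (\<lambda>g. adjoint_representation \<rho> g x)"
    unfolding weakly_measurable_def adjoint_apply by measurable
  from weak_star_integral_apply[OF this, of "norm x"]
  have "blinfun_apply (convolution_operator \<rho> \<mu> x) y = (\<integral>k. x (\<rho> (- k) y) \<partial>\<mu>)" for y
    unfolding convolution_operator_def by simp
  then have "convolution_operator \<rho> \<mu> x = x \<longleftrightarrow> (\<forall>y. (\<integral>k. x (\<rho> (- k) y) \<partial>\<mu>) = x y)"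
    using blinfun_eqI[of "convolution_operator \<rho> \<mu> x" x] by metis
  then show ?thesis
    unfolding harmonic_elements_def by blast
qed

lemma integral_increments_first:
  fixes f :: "'g \<Rightarrow> 'b::{banach, second_countable_topology}"
  assumes "f \<in> borel_measurable borel"
  shows "(\<integral>\<xi>. f (\<xi> 0) \<partial>increments) = (\<integral>k. f k \<partial>\<mu>)"
proof -
  have "(\<integral>k. f k \<partial>\<mu>) = (\<integral>k. f k \<partial>distr increments \<mu> (\<lambda>\<xi>. \<xi> 0))"
    by (simp add: inc.PiM_component)
  also have "\<dots> = (\<integral>\<xi>. f (\<xi> 0) \<partial>increments)"
    using assms by (intro integral_distr) (simp_all add: measurable_cong_sets[OF sets_\<mu> refl])
  finally show ?thesis by simp
qed

end

locale walk_rep_start = random_walk_start \<mu> \<nu> + walk_rep \<mu> smul \<rho>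
  for \<mu> :: "'g::{topological_group_add, t2_space, second_countable_topology} measure"
    and \<nu> :: "'g measure"
    and smul :: "'k::{real_normed_field, euclidean_space} \<Rightarrow> 'a::{banach, second_countable_topology} \<Rightarrow> 'a"
    and \<rho> :: "'g \<Rightarrow> 'a \<Rightarrow>\<^sub>L 'a"
begin

lemma integrable_rep:
  fixes x :: "'a \<Rightarrow>\<^sub>L 'k"
  assumes Z: "integrable Q Z"
  shows "integrable Q (\<lambda>w. \<rho> (- w n) (Z w))" "integrable Q (\<lambda>w. x (\<rho> (- w n) (Z w)))"
proof -
  have [measurable]: "Z \<in> borel_measurable path_space"
    using borel_measurable_integrable[OF Z] by simp
  show *: "integrable Q (\<lambda>w. \<rho> (- w n) (Z w))"
    by (rule Bochner_Integration.integrable_bound[OF Z]) simp_all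
  show "integrable Q (\<lambda>w. x (\<rho> (- w n) (Z w)))"
    by (rule integrable_bounded_linear[OF blinfun.bounded_linear_right *])
qed

text \<open>By the Markov property the next step averages \<open>\<pi>(k)x\<close> over \<open>\<mu>\<close>, which reproduces \<open>x\<close>.\<close>

lemma harmonic_martingale_Suc:
  assumes x: "x \<in> \<H>"
    and Z: "integrable Q Z" "\<And>w. Z (stopped n w) = Z w"
  shows "(\<integral>w. x (\<rho> (- w (Suc n)) (Z w)) \<partial>Q) = (\<integral>w. x (\<rho> (- w n) (Z w)) \<partial>Q)"
proof -
  have [measurable]: "Z \<in> borel_measurable path_space"
    using borel_measurable_integrable[OF Z(1)] by simp
  \<comment> \<open>step \<open>1\<close> of the path after time \<open>n\<close> is its position at time \<open>Suc n\<close>\<close>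
  let ?H = "\<lambda>(w, w'). x (\<rho> (- w' 1) (Z w))"
  have "(\<integral>w. x (\<rho> (- w (Suc n)) (Z w)) \<partial>Q) = (\<integral>w. ?H (stopped n w, after n w) \<partial>Q)"
    by (simp add: after_def Z(2))
  also have "\<dots> = (\<integral>w. \<integral>\<xi>. ?H (stopped n w, walk_path (w n) \<xi>) \<partial>increments \<partial>Q)"
    using integrable_rep(2)[OF Z(1), of x "Suc n"]
    by (intro markov_integral) (simp_all add: after_def Z(2) split_beta')
  also have "\<dots> = (\<integral>w. x (\<rho> (- w n) (Z w)) \<partial>Q)"
  proof (rule Bochner_Integration.integral_cong)
    fix w :: "nat \<Rightarrow> 'g"
    have "(\<integral>\<xi>. ?H (stopped n w, walk_path (w n) \<xi>) \<partial>increments)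
        = (\<integral>\<xi>. x (\<rho> (- \<xi> 0) (\<rho> (- w n) (Z w))) \<partial>increments)"
      by (simp add: Z(2) rep_minus_add)
    also have "\<dots> = (\<integral>k. x (\<rho> (- k) (\<rho> (- w n) (Z w))) \<partial>\<mu>)"
      by (rule integral_increments_first) measurable
    also have "\<dots> = x (\<rho> (- w n) (Z w))"
      using x by (simp add: harmonic_iff)
    finally show "(\<integral>\<xi>. ?H (stopped n w, walk_path (w n) \<xi>) \<partial>increments) = x (\<rho> (- w n) (Z w))" .
  qed simp
  finally show ?thesis .
qed

lemma AE_harmonic_convergent:
  assumes x: "x \<in> \<H>"
  shows "AE w in Q. \<forall>y. convergent (\<lambda>n. x (\<rho> (- w n) y))"
proof -
  have comp: "AE w in Q. convergent (\<lambda>n. x (\<rho> (- w n) y) \<bullet> b)" if "b \<in> Basis" for y b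
  proof (rule bounded_martingale_converges[OF Q.finite_measure_axioms sets_Q])
    fix n
    show "(\<lambda>w. x (\<rho> (- w n) y) \<bullet> b) \<in> borel_measurable path_space" by measurable
    show "\<bar>x (\<rho> (- w n) y) \<bullet> b\<bar> \<le> norm x * norm y" for w
      using Basis_le_norm[OF that, of "x (\<rho> (- w n) y)"] norm_eval_rep_le order_trans by blast
    show "x (\<rho> (- stopped n w n) y) \<bullet> b = x (\<rho> (- w n) y) \<bullet> b" for w
      by (simp add: stopped_apply)
    fix Z :: "(nat \<Rightarrow> 'g) \<Rightarrow> real" and B
    assume [measurable]: "Z \<in> borel_measurable path_space"
      and Z: "\<And>w. Z (stopped n w) = Z w" "\<And>w. \<bar>Z w\<bar> \<le> B"
    have int: "integrable Q (\<lambda>w. Z w *\<^sub>R y)"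
      using Z(2) by (intro integrable_scaleR_left Q.integrable_const_bound[of _ B]) auto
    have "(\<integral>w. Z w * (x (\<rho> (- w m) y) \<bullet> b) \<partial>Q) = (\<integral>w. x (\<rho> (- w m) (Z w *\<^sub>R y)) \<partial>Q) \<bullet> b" for m
      by (subst integral_inner_left[OF integrable_rep(2)[OF int, of x m], symmetric]) (simp add: blinfun.scaleR_right)
    with harmonic_martingale_Suc[OF x int, of n] Z(1)
    show "(\<integral>w. Z w * (x (\<rho> (- w (Suc n)) y) \<bullet> b) \<partial>Q) = (\<integral>w. Z w * (x (\<rho> (- w n) y) \<bullet> b) \<partial>Q)"
      by simp
  qed
  have "AE w in Q. \<forall>i. \<forall>b\<in>Basis. convergent (\<lambda>n. x (\<rho> (- w n) (dense_seq i)) \<bullet> b)"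
    unfolding AE_all_countable by (intro allI AE_finite_allI comp) simp
  then show ?thesis
  proof eventually_elim
    case (elim w)
    show ?case
    proof (rule allI, rule convergent_if_dense)
      fix i
      have "\<forall>b\<in>Basis. \<exists>l. (\<lambda>n. x (\<rho> (- w n) (dense_seq i)) \<bullet> b) \<longlonglongrightarrow> l"
        using elim unfolding convergent_def by blast
      then obtain l where l: "\<And>b. b \<in> Basis \<Longrightarrow> (\<lambda>n. x (\<rho> (- w n) (dense_seq i)) \<bullet> b) \<longlonglongrightarrow> l b"
        by metis
      have "(\<lambda>n. \<Sum>b\<in>Basis. (x (\<rho> (- w n) (dense_seq i)) \<bullet> b) *\<^sub>R b) \<longlonglongrightarrow> (\<Sum>b\<in>Basis. l b *\<^sub>R b)"
        using l by (intro tendsto_sum tendsto_scaleR tendsto_const) auto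
      then show "convergent (\<lambda>n. x (\<rho> (- w n) (dense_seq i)))"
        unfolding euclidean_representation by (rule convergentI)
    qed
  qed
qed

lemma AE_boundary_fun_tendsto:
  assumes x: "x \<in> \<H>"
  shows "AE w in Q. \<forall>y. (\<lambda>n. x (\<rho> (- w n) y)) \<longlonglongrightarrow> boundary_fun x w y"
  using AE_harmonic_convergent[OF x] by eventually_elim (auto intro: boundary_fun_tendsto)

text \<open>The martingale is closed by its limit: the integrals of \<open>x (\<rho> (- w m) (Z w))\<close> do not depend on
  \<open>m \<ge> n\<close>, and \<open>m\<close> tends to infinity by dominated convergence.\<close>

lemma integral_boundary_fun:
  assumes x: "x \<in> \<H>"
    and Z: "integrable Q Z" "\<And>w. Z (stopped n w) = Z w"
  shows "(\<integral>w. boundary_fun x w (Z w) \<partial>Q) = x (\<integral>w. \<rho> (- w n) (Z w) \<partial>Q)"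
proof -
  have const: "(\<integral>w. x (\<rho> (- w m) (Z w)) \<partial>Q) = (\<integral>w. x (\<rho> (- w n) (Z w)) \<partial>Q)" if "n \<le> m" for m
    using that
  proof (induction rule: dec_induct)
    case (step m)
    have "Z (stopped m w) = Z w" for w
      using Z(2)[of "stopped m w"] Z(2)[of w] stopped_stopped[OF step(1), of w] by simp
    from harmonic_martingale_Suc[OF x Z(1) this] step show ?case by simp
  qed simp
  have "(\<lambda>m. \<integral>w. x (\<rho> (- w m) (Z w)) \<partial>Q) \<longlonglongrightarrow> (\<integral>w. boundary_fun x w (Z w) \<partial>Q)"
  proof (rule integral_dominated_convergence[where w = "\<lambda>w. norm x * norm (Z w)"])
    show "(\<lambda>w. boundary_fun x w (Z w)) \<in> borel_measurable Q"
      using Z(1) by (intro weakly_measurable_eval weakly_measurable_mono[OF weakly_measurable_boundary_fun])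
        (auto simp: sets_Q)
    show "AE w in Q. (\<lambda>m. x (\<rho> (- w m) (Z w))) \<longlonglongrightarrow> boundary_fun x w (Z w)"
      using AE_boundary_fun_tendsto[OF x] by eventually_elim auto
  qed (use Z integrable_rep(2)[OF Z(1), of x] norm_eval_rep_le in \<open>auto intro: borel_measurable_integrable\<close>)
  moreover have "(\<lambda>m. \<integral>w. x (\<rho> (- w m) (Z w)) \<partial>Q) \<longlonglongrightarrow> (\<integral>w. x (\<rho> (- w n) (Z w)) \<partial>Q)"
    by (rule tendsto_eventually, rule eventually_sequentiallyI[of n]) (rule const)
  ultimately have "(\<integral>w. boundary_fun x w (Z w) \<partial>Q) = (\<integral>w. x (\<rho> (- w n) (Z w)) \<partial>Q)"
    by (rule LIMSEQ_unique)
  also have "\<dots> = x (\<integral>w. \<rho> (- w n) (Z w) \<partial>Q)"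
    by (rule integral_bounded_linear[OF blinfun.bounded_linear_right integrable_rep(1)[OF Z(1)]])
  finally show ?thesis .
qed

end

section \<open>Pairings are evaluations\<close>

context walk_rep_start
begin

lemma weakly_measurable_Q: "weakly_measurable path_space f \<Longrightarrow> weakly_measurable Q f"
  unfolding weakly_measurable_def by (simp add: measurable_cong_sets[OF sets_Q refl])

lemma integrable_boundary_fun:
  "integrable Q \<phi> \<Longrightarrow> integrable Q (\<lambda>w. boundary_fun x w (\<phi> w))"
  by (rule integrable_eval[OF weakly_measurable_Q[OF weakly_measurable_boundary_fun], of x "norm x"])
     (simp_all add: norm_boundary_fun_le)

lemma norm_integral_boundary_fun_le:
  "integrable Q \<phi> \<Longrightarrow> norm (\<integral>w. boundary_fun x w (\<phi> w) \<partial>Q) \<le> norm x * (\<integral>w. norm (\<phi> w) \<partial>Q)"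
  by (rule norm_integral_eval_le[OF weakly_measurable_Q[OF weakly_measurable_boundary_fun]])
     (auto simp: norm_boundary_fun_le)

text \<open>Here \<open>\<phi>'\<close> is what remains of \<open>\<phi>\<close> after subtraction of an approximation that depends on finitely many
  positions; the pairing with that approximation is an evaluation.\<close>

lemma pairing_approx_evaluation:
  assumes \<phi>: "integrable Q \<phi>" and "\<epsilon> > 0"
  shows "\<exists>\<phi>'. integrable Q \<phi>' \<and> (\<integral>w. norm (\<phi>' w) \<partial>Q) < \<epsilon> \<and>
    (\<exists>y. norm y \<le> (\<integral>w. norm (\<phi> w) \<partial>Q) + \<epsilon> \<and>
      (\<forall>x\<in>\<H>.
        (\<integral>w. boundary_fun x w (\<phi> w) \<partial>Q) = x y + (\<integral>w. boundary_fun x w (\<phi>' w) \<partial>Q)))"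
proof -
  from L1_approx_stopped[OF Q.finite_measure_axioms sets_Q \<phi> \<open>\<epsilon> > 0\<close>] obtain n Z where Z:
    "\<And>w. Z (stopped n w) = Z w" "integrable Q Z" "(\<integral>w. norm (\<phi> w - Z w) \<partial>Q) < \<epsilon>" by blast
  let ?y = "\<integral>w. \<rho> (- w n) (Z w) \<partial>Q"
  have "norm ?y \<le> (\<integral>w. norm (\<rho> (- w n) (Z w)) \<partial>Q)"
    by (rule integral_norm_bound)
  also have "\<dots> = (\<integral>w. norm (Z w) \<partial>Q)" by simp
  also have "\<dots> \<le> (\<integral>w. norm (\<phi> w) + norm (\<phi> w - Z w) \<partial>Q)"
  proof (rule integral_mono)
    show "norm (Z w) \<le> norm (\<phi> w) + norm (\<phi> w - Z w)" for w
      using norm_triangle_ineq4[of "\<phi> w" "\<phi> w - Z w"] by simp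
  qed (use Z \<phi> in auto)
  also have "\<dots> = (\<integral>w. norm (\<phi> w) \<partial>Q) + (\<integral>w. norm (\<phi> w - Z w) \<partial>Q)"
    using Z \<phi> by (intro Bochner_Integration.integral_add) auto
  finally have "norm ?y \<le> (\<integral>w. norm (\<phi> w) \<partial>Q) + \<epsilon>" using Z(3) by simp
  moreover have "(\<integral>w. boundary_fun x w (\<phi> w) \<partial>Q) = x ?y + (\<integral>w. boundary_fun x w (\<phi> w - Z w) \<partial>Q)"
    if "x \<in> \<H>" for x
    using integral_boundary_fun[OF that Z(2,1)] integrable_boundary_fun[OF \<phi>, of x]
      integrable_boundary_fun[OF Z(2), of x] by (simp add: blinfun.diff_right)
  ultimately show ?thesis
    using Z \<phi> by (intro exI[of _ "\<lambda>w. \<phi> w - Z w"] conjI exI[of _ ?y]) auto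
qed

text \<open>The remainder of the approximation is approximated in turn; the vectors so obtained have summable norms.\<close>

lemma pairing_eq_evaluation:
  assumes \<phi>: "integrable Q \<phi>"
  shows "\<exists>y. \<forall>x\<in>\<H>. (\<integral>w. boundary_fun x w (\<phi> w) \<partial>Q) = x y"
proof -
  \<comment> \<open>\<open>\<psi> n\<close> is the remainder after \<open>n\<close> rounds; \<open>\<psi> 0 = \<phi>\<close> is not bounded by a power of \<open>1/2\<close>\<close>
  let ?P = "\<lambda>n \<psi>. integrable Q \<psi> \<and> (if n = 0 then \<psi> = \<phi> else (\<integral>w. norm (\<psi> w) \<partial>Q) < (1/2) ^ n)"
  let ?Q = "\<lambda>n \<psi> \<psi>'. \<exists>y. norm y \<le> (\<integral>w. norm (\<psi> w) \<partial>Q) + (1/2) ^ Suc n \<and>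
      (\<forall>x\<in>\<H>.
        (\<integral>w. boundary_fun x w (\<psi> w) \<partial>Q) = x y + (\<integral>w. boundary_fun x w (\<psi>' w) \<partial>Q))"
  have "\<exists>\<psi>. \<forall>n. ?P n (\<psi> n) \<and> ?Q n (\<psi> n) (\<psi> (Suc n))"
  proof (rule dependent_nat_choice)
    show "\<exists>\<psi>. ?P 0 \<psi>" using \<phi> by simp
    fix \<psi> n assume "?P n \<psi>"
    then have "integrable Q \<psi>" by blast
    moreover have "(0::real) < (1/2) ^ Suc n" by simp
    ultimately obtain \<psi>' where "integrable Q \<psi>'" "(\<integral>w. norm (\<psi>' w) \<partial>Q) < (1/2) ^ Suc n" "?Q n \<psi> \<psi>'"
      using pairing_approx_evaluation[of \<psi> "(1/2) ^ Suc n"] by blast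
    then show "\<exists>\<psi>'. ?P (Suc n) \<psi>' \<and> ?Q n \<psi> \<psi>'"
      unfolding if_not_P[OF nat.simps(3)] by blast
  qed
  then obtain \<psi> where all: "\<And>n. ?P n (\<psi> n)" and step: "\<And>n. ?Q n (\<psi> n) (\<psi> (Suc n))"
    by blast
  have \<psi>: "\<And>n. integrable Q (\<psi> n)" "\<psi> 0 = \<phi>" "\<And>n. n > 0 \<Longrightarrow> (\<integral>w. norm (\<psi> n w) \<partial>Q) < (1/2) ^ n"
  proof -
    show "integrable Q (\<psi> n)" for n using all by blast
    show "\<psi> 0 = \<phi>" using all[of 0] by simp
    show "(\<integral>w. norm (\<psi> n w) \<partial>Q) < (1/2) ^ n" if "n > 0" for n
      using all[of n] that by simp
  qed
  from step have "\<forall>n. \<exists>y. norm y \<le> (\<integral>w. norm (\<psi> n w) \<partial>Q) + (1/2) ^ Suc n \<and>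
      (\<forall>x\<in>\<H>.
        (\<integral>w. boundary_fun x w (\<psi> n w) \<partial>Q) = x y + (\<integral>w. boundary_fun x w (\<psi> (Suc n) w) \<partial>Q))"
    by blast
  from choice[OF this] obtain y where y: "\<And>n. norm (y n) \<le> (\<integral>w. norm (\<psi> n w) \<partial>Q) + (1/2) ^ Suc n"
    "\<And>n x. x \<in> \<H> \<Longrightarrow>
        (\<integral>w. boundary_fun x w (\<psi> n w) \<partial>Q) = x (y n) + (\<integral>w. boundary_fun x w (\<psi> (Suc n) w) \<partial>Q)"
    by blast
  have "summable (\<lambda>n. norm (y (Suc n)))"
  proof (rule summable_comparison_test')
    show "summable (\<lambda>n. (1/2 :: real) ^ n)" by (rule summable_geometric) simp
    show "norm (norm (y (Suc n))) \<le> (1/2) ^ n" if "n \<ge> 0" for n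
    proof -
      have "(1/2 :: real) ^ Suc n + (1/2) ^ Suc (Suc n) \<le> (1/2) ^ n" by simp
      moreover have "(\<integral>w. norm (\<psi> (Suc n) w) \<partial>Q) < (1/2) ^ Suc n" by (rule \<psi>(3)) simp
      ultimately show ?thesis using y(1)[of "Suc n"] unfolding real_norm_def abs_norm_cancel by linarith
    qed
  qed
  then have "summable y"
    by (subst summable_Suc_iff[symmetric]) (rule summable_norm_cancel)
  then have sums: "y sums (\<Sum>n. y n)" by (rule summable_sums)
  have "(\<integral>w. boundary_fun x w (\<phi> w) \<partial>Q) = x (\<Sum>n. y n)" if x: "x \<in> \<H>" for x
  proof -
    let ?r = "\<lambda>n. \<integral>w. boundary_fun x w (\<psi> n w) \<partial>Q"
    have "(\<Sum>i<n. x (y i)) = ?r 0 - ?r n" for n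
    proof (induction n)
      case (Suc n)
      then show ?case using y(2)[OF x, of n] by simp
    qed simp
    moreover have "?r \<longlonglongrightarrow> 0"
    proof (rule Lim_null_comparison)
      show "\<forall>\<^sub>F n in sequentially. norm (?r n) \<le> norm x * (1/2) ^ n"
      proof (rule eventually_sequentiallyI[of 1])
        fix n :: nat assume "n \<ge> 1"
        then have "norm x * (\<integral>w. norm (\<psi> n w) \<partial>Q) \<le> norm x * (1/2) ^ n"
          using \<psi>(3)[of n] by (intro mult_left_mono) auto
        then show "norm (?r n) \<le> norm x * (1/2) ^ n"
          using norm_integral_boundary_fun_le[OF \<psi>(1), of x n] by linarith
      qed
      show "(\<lambda>n. norm x * (1/2) ^ n) \<longlonglongrightarrow> 0"
        by (intro tendsto_mult_right_zero LIMSEQ_power_zero) simp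
    qed
    ultimately have "(\<lambda>n. \<Sum>i<n. x (y i)) \<longlonglongrightarrow> ?r 0 - 0"
      by (simp only: tendsto_diff[OF tendsto_const])
    then have "(\<lambda>n. x (y n)) sums ?r 0"
      by (simp add: sums_def)
    moreover have "(\<lambda>n. x (y n)) sums x (\<Sum>n. y n)"
      by (rule bounded_linear.sums[OF blinfun.bounded_linear_right sums])
    ultimately have "?r 0 = x (\<Sum>n. y n)"
      by (rule sums_unique2)
    then show ?thesis by (simp add: \<psi>(2))
  qed
  then show ?thesis by blast
qed

end

section \<open>Measures equivalent to left Haar measure\<close>

text \<open>The null sets of Haar measure are those of the finite measure \<open>\<beta>\<close>, to which Fubini's theorem applies.\<close>

locale walk_quasi_haar = walk_rep_start \<mu> \<beta> smul \<rho>
  for \<mu> \<beta> :: "'g::{topological_group_add, t2_space, second_countable_topology} measure"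
    and smul :: "'k::{real_normed_field, euclidean_space} \<Rightarrow> 'a::{banach, second_countable_topology} \<Rightarrow> 'a"
    and \<rho> :: "'g \<Rightarrow> 'a \<Rightarrow>\<^sub>L 'a" +
  fixes haar :: "'g measure"
  assumes haar: "left_haar_measure haar"
    and ac: "absolutely_continuous haar \<beta>" "absolutely_continuous \<beta> haar"
begin

lemma sets_haar[measurable_cong]: "sets haar = sets borel"
  using haar by (simp add: left_haar_measure_def)

lemma null_sets_haar: "null_sets haar = null_sets \<beta>"
  using ac by (auto simp: absolutely_continuous_def)

lemma AE_haar: "(AE g in haar. P g) \<longleftrightarrow> (AE g in \<beta>. P g)"
proof -
  have "space haar = space \<beta>"
    using sets_eq_imp_space_eq[of haar \<beta>] by (simp add: sets_haar sets_\<nu>)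
  then show ?thesis
    by (simp add: eventually_ae_filter null_sets_haar)
qed

lemma AE_walk_haar: "(AE w in walk_measure \<mu> haar. P w) \<longleftrightarrow> (AE w in Q. P w)"
proof -
  have "emeasure (walk_measure \<mu> haar) A = 0 \<longleftrightarrow> emeasure Q A = 0" if "A \<in> sets path_space" for A
  proof -
    have [measurable]: "A \<in> sets path_space" by fact
    have [measurable]: "(\<lambda>g. emeasure (walk_law \<mu> g) A) \<in> borel_measurable borel"
      using measurable_emeasure_kernel[OF measurable_walk_law that] .
    show ?thesis
      using that by (simp add: emeasure_walk_measure sets_haar sets_\<nu> nn_integral_0_iff_AE AE_haar)
  qed
  moreover have sets: "sets (walk_measure \<mu> haar) = sets path_space"
    by (rule sets_walk_measure[OF sets_haar])
  ultimately have "null_sets (walk_measure \<mu> haar) = null_sets Q"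
    by (auto simp: null_sets_def sets_Q)
  moreover have "space (walk_measure \<mu> haar) = space Q"
    using sets_eq_imp_space_eq[OF sets] by simp
  ultimately show ?thesis
    by (simp add: eventually_ae_filter)
qed

lemma AE_left_translate:
  assumes "AE h in \<beta>. P h"
  shows "AE h in \<beta>. P (g + h)"
proof -
  obtain N where N: "N \<in> null_sets \<beta>" "{h. \<not> P h} \<subseteq> N"
    using assms unfolding eventually_ae_filter by auto
  let ?N = "(+) (- g) ` N"
  have N': "N \<in> sets borel" "emeasure haar N = 0"
    using N(1) unfolding null_sets_haar[symmetric] by (auto simp: null_sets_def sets_haar)
  then have "emeasure haar ?N = 0"
    using haar by (auto simp: left_haar_measure_def)
  moreover have "?N = (+) g -` N"
    by (auto simp: image_iff add.assoc[symmetric] intro!: bexI[of _ "g + _"])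
  moreover have "(+) g -` N \<in> sets borel"
  proof -
    have "(\<lambda>h. g + h) \<in> borel \<rightarrow>\<^sub>M borel" by measurable
    from measurable_sets[OF this N'(1)] show ?thesis by simp
  qed
  ultimately have "(+) g -` N \<in> null_sets \<beta>"
    unfolding null_sets_haar[symmetric] by (simp add: null_sets_def sets_haar)
  then show ?thesis
    by (rule AE_I') (use N(2) in auto)
qed

lemma \<beta>_nonzero: "\<not> (AE g in \<beta>. False)"
proof
  assume "AE g in \<beta>. False"
  then have "AE g in haar. False" by (simp add: AE_haar)
  then have "emeasure haar (space haar) = 0"
    by (simp add: AE_iff_measurable[OF sets.top])
  moreover have "space haar = UNIV"
    using sets_eq_imp_space_eq[OF sets_haar] by simp
  ultimately show False
    using haar by (simp add: left_haar_measure_def)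
qed

lemma AE_\<beta>_obtain:
  assumes "AE g in \<beta>. P g"
  obtains g where "P g"
  using assms \<beta>_nonzero by (metis (mono_tags, lifting) eventually_mono)

sublocale \<beta>\<beta>: pair_sigma_finite \<beta> \<beta> ..

text \<open>For a null set \<open>N\<close> the translates \<open>{g. - h + g \<in> N}\<close> are null for every \<open>h\<close>. Exchanging the
  variables, \<open>{h. - h + g \<in> N}\<close> is null for some \<open>g\<close>, and a left translation removes \<open>g\<close>.\<close>

lemma AE_inverse:
  assumes "AE h in \<beta>. P h"
  shows "AE h in \<beta>. P (- h)"
proof -
  obtain N where N: "N \<in> null_sets \<beta>" "{h. \<not> P h} \<subseteq> N"
    using assms unfolding eventually_ae_filter by auto
  have N'[measurable]: "N \<in> sets borel" using N(1) by (auto simp: null_sets_def sets_\<nu>)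
  have "AE h in \<beta>. h \<notin> N" using N(1) by (rule AE_not_in)
  from AE_left_translate[OF this] have "AE h in \<beta>. AE g in \<beta>. - h + g \<notin> N"
    by simp
  moreover have "{z \<in> space (\<beta> \<Otimes>\<^sub>M \<beta>). - fst z + snd z \<notin> N} \<in> sets (\<beta> \<Otimes>\<^sub>M \<beta>)"
    by measurable
  ultimately have "AE g in \<beta>. AE h in \<beta>. - h + g \<notin> N"
    by (subst (asm) \<beta>\<beta>.AE_commute) auto
  then obtain g where "AE h in \<beta>. - h + g \<notin> N"
    by (rule AE_\<beta>_obtain)
  then have "AE h in \<beta>. - (g + h) + g \<notin> N"
    by (rule AE_left_translate)
  then have "AE h in \<beta>. - h \<notin> N"
    by (simp only: minus_add add.assoc left_minus add_0_right)
  then show ?thesis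
    by eventually_elim (use N(2) in auto)
qed

text \<open>A right translation is a left translation conjugated by inversion.\<close>

lemma AE_right_translate:
  assumes "AE h in \<beta>. P h"
  shows "AE h in \<beta>. P (h + k)"
proof -
  have "AE h in \<beta>. P (- h)" using assms by (rule AE_inverse)
  then have "AE h in \<beta>. P (- (- k + h))" by (rule AE_left_translate)
  then have "AE h in \<beta>. P (- (- k + - h))" by (rule AE_inverse)
  then show ?thesis by (simp only: minus_add minus_minus)
qed

text \<open>Countably many translates of a neighbourhood of the identity cover the group.\<close>

lemma open_positive:
  assumes U: "open U" "0 \<in> U"
  shows "measure \<beta> U > 0"
proof (rule ccontr)
  assume "\<not> measure \<beta> U > 0"
  then have "measure \<beta> U = 0" by (simp add: measure_le_0_iff not_less)
  then have "U \<in> null_sets \<beta>"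
    using U by (intro null_setsI) (auto simp: init.emeasure_eq_measure sets_\<nu>)
  then have null: "AE h in \<beta>. h \<notin> U" by (rule AE_not_in)
  let ?V = "\<lambda>g. {h. g + h \<in> U}"
  have "open (?V g)" for g
    using open_vimage[OF U(1), of "\<lambda>h. g + h"] by (simp add: vimage_def continuous_on_add)
  then have "\<And>S. S \<in> range ?V \<Longrightarrow> open S" by blast
  from Lindelof[OF this]
  obtain \<F> where \<F>: "\<F> \<subseteq> range ?V" "countable \<F>" "\<Union>\<F> = (\<Union>g. ?V g)"
    by blast
  have "AE h in \<beta>. \<forall>V\<in>\<F>. h \<notin> V"
  proof (subst AE_ball_countable[OF \<F>(2)], rule ballI)
    fix V assume "V \<in> \<F>"
    then obtain g where "V = ?V g" using \<F>(1) by blast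
    then show "AE h in \<beta>. h \<notin> V"
      using AE_left_translate[OF null, of g] by simp
  qed
  moreover have "\<exists>V\<in>\<F>. h \<in> V" for h
  proof -
    have "h \<in> ?V (- h)" using U by simp
    then have "h \<in> \<Union>\<F>" unfolding \<F>(3) by blast
    then show ?thesis by blast
  qed
  ultimately have "AE h in \<beta>. False" by (auto elim: eventually_mono)
  then show False using \<beta>_nonzero by simp
qed

section \<open>Evaluations are pairings\<close>

lemma subalgebra_Q: "subalgebra Q invariant_algebra"
  by (rule subalgebra_invariant[OF sets_Q])

sublocale inv: finite_measure_subalgebra Q invariant_algebra
  by unfold_locales (rule subalgebra_Q)

abbreviation R :: "(nat \<Rightarrow> 'g) measure"
  where "R \<equiv> restr_to_subalg Q invariant_algebra"

lemma measurable_R[simp]: "borel_measurable R = borel_measurable invariant_algebra"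
  by (rule measurable_cong_sets) (simp_all add: sets_restr_to_subalg[OF subalgebra_Q])

lemma borel_measurable_boundary_fun_inv: "weakly_measurable invariant_algebra (boundary_fun x)"
  unfolding weakly_measurable_def
proof (intro allI measurable_invariantI)
  show "(\<lambda>w. boundary_fun x w y) \<in> borel_measurable path_space" for y
    using weakly_measurable_boundary_fun[of x] by (simp add: weakly_measurable_def)
qed (simp add: boundary_fun_shift)

text \<open>Averaging \<open>\<rho> (- g) y\<close> over a small neighbourhood \<open>U\<close> of the identity hardly changes \<open>y\<close>. This average is
  the pairing of \<open>boundary_fun x\<close> with \<open>y\<close> weighted by the initial position, and as
  \<open>boundary_fun x\<close> is shift-invariant, the weight may be replaced by its conditional expectation.\<close>

lemma evaluation_approx_pairing:
  assumes "\<epsilon> > 0"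
  shows "\<exists>y'. norm y' < \<epsilon> \<and> (\<exists>\<phi>. integrable R \<phi> \<and> (\<integral>w. norm (\<phi> w) \<partial>R) \<le> norm y \<and>
    (\<forall>x\<in>\<H>. blinfun_apply x y = (\<integral>w. boundary_fun x w (\<phi> w) \<partial>R) + x y'))"
proof -
  have "continuous_on UNIV (\<lambda>g. \<rho> (- g) y)"
    by (rule continuous_on_compose2[OF continuous_rep]) (auto intro!: continuous_on_minus continuous_on_id)
  then have "open ((\<lambda>g. \<rho> (- g) y) -` ball y (\<epsilon> / 2))"
    by (intro open_vimage) auto
  moreover define U where "U = (\<lambda>g. \<rho> (- g) y) -` ball y (\<epsilon> / 2)"
  ultimately have U: "open U" "0 \<in> U" "\<And>g. g \<in> U \<Longrightarrow> norm (y - \<rho> (- g) y) \<le> \<epsilon> / 2"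
    using assms by (auto simp: dist_norm)
  have [measurable]: "U \<in> sets borel" using U(1) by simp
  define \<kappa> where "\<kappa> w = indicator U (w 0) / measure \<beta> U" for w :: "nat \<Rightarrow> 'g"
  have m: "measure \<beta> U > 0" by (rule open_positive) fact+
  have [measurable]: "\<kappa> \<in> borel_measurable path_space" unfolding \<kappa>_def by measurable
  have \<kappa>0: "\<kappa> w \<ge> 0" for w by (simp add: \<kappa>_def)
  have \<kappa>_int: "integrable Q \<kappa>"
    by (rule Q.integrable_const_bound[of _ "1 / measure \<beta> U"]) (auto simp: \<kappa>_def indicator_def)
  have \<kappa>1: "(\<integral>w. \<kappa> w \<partial>Q) = 1"
  proof -
    have "(\<integral>w. \<kappa> w \<partial>Q) = (\<integral>g. indicator U g / measure \<beta> U \<partial>\<beta>)"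
      using \<kappa>_int by (subst integral_Q) (simp_all add: \<kappa>_def)
    then show ?thesis using m by (simp add: sets_\<nu>)
  qed
  define D where "D = real_cond_exp Q invariant_algebra \<kappa>"
  have D_meas[measurable]: "D \<in> borel_measurable invariant_algebra"
    by (simp add: D_def)
  have D_Q[measurable]: "D \<in> borel_measurable Q"
    using measurable_from_subalg[OF subalgebra_Q D_meas] .
  have D_int: "integrable Q D" "(\<integral>w. D w \<partial>Q) = 1"
    using inv.real_cond_exp_int[OF \<kappa>_int] \<kappa>1 by (simp_all add: D_def)
  have D_pos: "AE w in Q. D w \<ge> 0"
    unfolding D_def by (rule inv.real_cond_exp_pos) (simp_all add: \<kappa>0)
  let ?\<phi> = "\<lambda>w. D w *\<^sub>R y"
  have \<phi>_int: "integrable R ?\<phi>"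
    using D_int(1) by (intro integrable_in_subalg[OF subalgebra_Q]) auto
  have "(\<integral>w. norm (?\<phi> w) \<partial>R) = (\<integral>w. norm (?\<phi> w) \<partial>Q)"
    by (rule integral_subalgebra2[OF subalgebra_Q]) measurable
  also have "\<dots> = (\<integral>w. D w * norm y \<partial>Q)"
  proof (rule integral_cong_AE)
    show "AE w in Q. norm (?\<phi> w) = D w * norm y"
      using D_pos by eventually_elim simp
  qed (use D_Q in auto)
  also have "\<dots> = norm y" by (simp add: D_int(2))
  finally have \<phi>_norm: "(\<integral>w. norm (?\<phi> w) \<partial>R) = norm y" .
  let ?Z = "\<lambda>w. \<kappa> w *\<^sub>R y"
  have Z_int: "integrable Q ?Z" using \<kappa>_int by simp
  have Z_stop: "?Z (stopped 0 w) = ?Z w" for w by (simp add: \<kappa>_def stopped_apply)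
  let ?y = "\<integral>w. \<rho> (- w 0) (?Z w) \<partial>Q"
  have "y - ?y = (\<integral>w. \<kappa> w *\<^sub>R y - \<rho> (- w 0) (?Z w) \<partial>Q)"
    using Z_int integrable_rep(1)[OF Z_int, of 0] \<kappa>_int by (simp add: \<kappa>1)
  also have "norm \<dots> \<le> (\<integral>w. norm (\<kappa> w *\<^sub>R y - \<rho> (- w 0) (?Z w)) \<partial>Q)"
    by (rule integral_norm_bound)
  also have "\<dots> \<le> (\<integral>w. \<kappa> w * (\<epsilon> / 2) \<partial>Q)"
  proof (rule integral_mono)
    show "integrable Q (\<lambda>w. norm (\<kappa> w *\<^sub>R y - \<rho> (- w 0) (?Z w)))"
      using Z_int integrable_rep(1)[OF Z_int, of 0] by auto
    show "integrable Q (\<lambda>w. \<kappa> w * (\<epsilon> / 2))" using \<kappa>_int by simp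
    fix w :: "nat \<Rightarrow> 'g"
    have "norm (\<kappa> w *\<^sub>R y - \<rho> (- w 0) (?Z w)) = \<kappa> w * norm (y - \<rho> (- w 0) y)"
      using \<kappa>0[of w] by (simp add: blinfun.scaleR_right scaleR_diff_right[symmetric])
    also have "\<dots> \<le> \<kappa> w * (\<epsilon> / 2)"
    proof (cases "w 0 \<in> U")
      case True
      then show ?thesis by (intro mult_left_mono U(3) \<kappa>0)
    qed (simp add: \<kappa>_def)
    finally show "norm (\<kappa> w *\<^sub>R y - \<rho> (- w 0) (?Z w)) \<le> \<kappa> w * (\<epsilon> / 2)" .
  qed
  also have "\<dots> < \<epsilon>" using assms by (simp add: \<kappa>1)
  finally have y'_norm: "norm (y - ?y) < \<epsilon>" .
  have "blinfun_apply x y = (\<integral>w. boundary_fun x w (?\<phi> w) \<partial>R) + x (y - ?y)"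
    if x: "x \<in> \<H>" for x
  proof -
    have bm: "(\<lambda>w. boundary_fun x w y) \<in> borel_measurable invariant_algebra"
      using borel_measurable_boundary_fun_inv[of x] by (simp add: weakly_measurable_def)
    have "(\<integral>w. boundary_fun x w (?\<phi> w) \<partial>R) = (\<integral>w. boundary_fun x w (?\<phi> w) \<partial>Q)"
      by (rule integral_subalgebra2[OF subalgebra_Q], rule weakly_measurable_eval[OF borel_measurable_boundary_fun_inv])
         measurable
    also have "\<dots> = (\<integral>w. boundary_fun x w (?Z w) \<partial>Q)"
    proof (rule euclidean_eqI)
      fix b :: 'k assume "b \<in> Basis"
      let ?u = "\<lambda>w. boundary_fun x w y \<bullet> b"
      have u: "?u \<in> borel_measurable invariant_algebra" using bm by measurable
      have i1: "integrable Q (\<lambda>w. boundary_fun x w (?\<phi> w))"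
        using D_int(1) by (intro integrable_boundary_fun) simp
      have i2: "integrable Q (\<lambda>w. boundary_fun x w (?Z w))"
        by (rule integrable_boundary_fun[OF Z_int])
      have "(\<integral>w. boundary_fun x w (?\<phi> w) \<partial>Q) \<bullet> b = (\<integral>w. ?u w * D w \<partial>Q)"
        by (subst integral_inner_left[OF i1, symmetric]) (simp add: blinfun.scaleR_right mult.commute)
      also have "\<dots> = (\<integral>w. ?u w * \<kappa> w \<partial>Q)"
        unfolding D_def
      proof (rule inv.real_cond_exp_intg(2)[OF _ u])
        show "integrable Q (\<lambda>w. ?u w * \<kappa> w)"
          using integrable_inner_left[OF i2, of b] by (simp add: blinfun.scaleR_right mult.commute)
      qed (use \<kappa>_int in \<open>rule borel_measurable_integrable\<close>)
      also have "\<dots> = (\<integral>w. boundary_fun x w (?Z w) \<partial>Q) \<bullet> b"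
        by (subst integral_inner_left[OF i2, symmetric]) (simp add: blinfun.scaleR_right mult.commute)
      finally show "(\<integral>w. boundary_fun x w (?\<phi> w) \<partial>Q) \<bullet> b = (\<integral>w. boundary_fun x w (?Z w) \<partial>Q) \<bullet> b" .
    qed
    also have "\<dots> = x ?y"
      by (rule integral_boundary_fun[OF x Z_int Z_stop])
    finally show ?thesis by (simp add: blinfun.diff_right)
  qed
  then show ?thesis
    using y'_norm \<phi>_int \<phi>_norm by (intro exI[of _ "y - ?y"] conjI exI[of _ ?\<phi>]) auto
qed

text \<open>The error vectors are represented in turn, and the densities are summed in \<open>L\<^sup>1\<close>.\<close>

lemma evaluation_eq_pairing:
  "\<exists>\<phi>. integrable R \<phi> \<and>
    (\<forall>x\<in>\<H>. blinfun_apply x y = (\<integral>w. boundary_fun x w (\<phi> w) \<partial>R))"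
proof -
  \<comment> \<open>\<open>z n\<close> is the error vector after \<open>n\<close> rounds, with \<open>z 0 = y\<close>\<close>
  let ?P = "\<lambda>n z. if n = 0 then z = y else norm z < (1/2) ^ n"
  let ?Q = "\<lambda>n z z'. \<exists>\<phi>. integrable R \<phi> \<and> (\<integral>w. norm (\<phi> w) \<partial>R) \<le> norm z \<and>
    (\<forall>x\<in>\<H>. blinfun_apply x z = (\<integral>w. boundary_fun x w (\<phi> w) \<partial>R) + x z')"
  have "\<exists>z. \<forall>n. ?P n (z n) \<and> ?Q n (z n) (z (Suc n))"
  proof (rule dependent_nat_choice)
    fix z n assume "?P n z"
    have "(0::real) < (1/2) ^ Suc n" by simp
    from evaluation_approx_pairing[OF this, of z] obtain z' where "norm z' < (1/2) ^ Suc n" "?Q n z z'"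
      by blast
    then show "\<exists>z'. ?P (Suc n) z' \<and> ?Q n z z'"
      unfolding if_not_P[OF nat.simps(3)] by blast
  qed simp
  then obtain z where all: "\<And>n. ?P n (z n)" and step: "\<And>n. ?Q n (z n) (z (Suc n))"
    by blast
  have z: "z 0 = y" "\<And>n. n > 0 \<Longrightarrow> norm (z n) < (1/2) ^ n"
  proof -
    show "z 0 = y" using all[of 0] by simp
    show "norm (z n) < (1/2) ^ n" if "n > 0" for n
      using all[of n] that by simp
  qed
  from step have "\<forall>n. \<exists>\<phi>. integrable R \<phi> \<and> (\<integral>w. norm (\<phi> w) \<partial>R) \<le> norm (z n) \<and>
    (\<forall>x\<in>\<H>.
      blinfun_apply x (z n) = (\<integral>w. boundary_fun x w (\<phi> w) \<partial>R) + x (z (Suc n)))"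
    by blast
  from choice[OF this] obtain \<phi> where \<phi>: "\<And>n. integrable R (\<phi> n)" "\<And>n. (\<integral>w. norm (\<phi> n w) \<partial>R) \<le> norm (z n)"
    "\<And>n x. x \<in> \<H> \<Longrightarrow>
      x (z n) = (\<integral>w. boundary_fun x w (\<phi> n w) \<partial>R) + x (z (Suc n))"
    by blast
  have "summable (\<lambda>n. norm (z (Suc n)))"
  proof (rule summable_comparison_test')
    show "summable (\<lambda>n. (1/2 :: real) ^ Suc n)"
      by (subst summable_Suc_iff) (rule summable_geometric, simp)
    show "norm (norm (z (Suc n))) \<le> (1/2) ^ Suc n" if "n \<ge> 0" for n
      using z(2)[of "Suc n"] by simp
  qed
  then have sz: "summable (\<lambda>n. norm (z n))" by (subst summable_Suc_iff[symmetric])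
  have sn: "summable (\<lambda>n. \<integral>w. norm (\<phi> n w) \<partial>R)"
    by (rule summable_comparison_test'[OF sz, of 0]) (simp add: \<phi>(2))
  have [measurable]: "\<phi> n \<in> borel_measurable R" for n
    by (rule borel_measurable_integrable[OF \<phi>(1)])
  have ae: "AE w in R. summable (\<lambda>n. norm (\<phi> n w))"
  proof -
    have "(\<integral>\<^sup>+w. (\<Sum>n. ennreal (norm (\<phi> n w))) \<partial>R) = (\<Sum>n. \<integral>\<^sup>+w. norm (\<phi> n w) \<partial>R)"
      by (rule nn_integral_suminf) measurable
    also have "\<dots> = (\<Sum>n. ennreal (\<integral>w. norm (\<phi> n w) \<partial>R))"
      using \<phi>(1) by (intro suminf_cong nn_integral_eq_integral) auto
    also have "\<dots> = ennreal (\<Sum>n. \<integral>w. norm (\<phi> n w) \<partial>R)"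
      using sn by (intro suminf_ennreal2) auto
    finally have "(\<integral>\<^sup>+w. (\<Sum>n. ennreal (norm (\<phi> n w))) \<partial>R) \<noteq> \<infinity>" by simp
    then have "AE w in R. (\<Sum>n. ennreal (norm (\<phi> n w))) \<noteq> \<infinity>"
      by (rule nn_integral_noteq_infinite[rotated]) measurable
    then show ?thesis
      by eventually_elim (auto intro: summable_suminf_not_top)
  qed
  define \<Phi> where "\<Phi> w = (\<Sum>n. \<phi> n w)" for w
  have \<Phi>: "integrable R \<Phi>"
    unfolding \<Phi>_def by (rule integrable_suminf[OF \<phi>(1) ae sn])
  have "blinfun_apply x y = (\<integral>w. boundary_fun x w (\<Phi> w) \<partial>R)" if x: "x \<in> \<H>" for x
  proof -
    have wm: "weakly_measurable R (boundary_fun x)"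
      by (rule weakly_measurable_mono[OF borel_measurable_boundary_fun_inv])
         (simp_all add: sets_restr_to_subalg[OF subalgebra_Q] space_restr_to_subalg)
    let ?f = "\<lambda>n w. boundary_fun x w (\<phi> n w)"
    have le: "norm (?f n w) \<le> norm x * norm (\<phi> n w)" for n w
      by (rule order_trans[OF norm_blinfun mult_right_mono[OF norm_boundary_fun_le norm_ge_zero]])
    have f_int: "integrable R (?f n)" for n
      by (rule integrable_eval[OF wm, of "norm x"]) (simp_all add: norm_boundary_fun_le \<phi>(1))
    have f_ae: "AE w in R. summable (\<lambda>n. norm (?f n w))"
      using ae
    proof eventually_elim
      case (elim w)
      show ?case
        by (rule summable_comparison_test'[OF summable_mult[OF elim, of "norm x"], of 0]) (simp add: le)
    qed
    have f_sum: "summable (\<lambda>n. \<integral>w. norm (?f n w) \<partial>R)"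
    proof (rule summable_comparison_test'[OF summable_mult[OF sn, of "norm x"], of 0])
      fix n :: nat
      have "(\<integral>w. norm (?f n w) \<partial>R) \<le> (\<integral>w. norm x * norm (\<phi> n w) \<partial>R)"
        using f_int \<phi>(1) le by (intro integral_mono) auto
      then show "norm (\<integral>w. norm (?f n w) \<partial>R) \<le> norm x * (\<integral>w. norm (\<phi> n w) \<partial>R)" by simp
    qed
    have "(\<integral>w. boundary_fun x w (\<Phi> w) \<partial>R) = (\<integral>w. (\<Sum>n. ?f n w) \<partial>R)"
    proof (rule integral_cong_AE)
      show "(\<lambda>w. boundary_fun x w (\<Phi> w)) \<in> borel_measurable R"
        by (rule weakly_measurable_eval[OF wm borel_measurable_integrable[OF \<Phi>]])
      show "(\<lambda>w. \<Sum>n. ?f n w) \<in> borel_measurable R"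
        by (rule borel_measurable_integrable[OF integrable_suminf[OF f_int f_ae f_sum]])
      show "AE w in R. boundary_fun x w (\<Phi> w) = (\<Sum>n. ?f n w)"
        using ae
      proof eventually_elim
        case (elim w)
        from bounded_linear.suminf[OF blinfun.bounded_linear_right summable_norm_cancel[OF elim]]
        show ?case by (simp add: \<Phi>_def)
      qed
    qed
    then have sums: "(\<lambda>n. \<integral>w. ?f n w \<partial>R) sums (\<integral>w. boundary_fun x w (\<Phi> w) \<partial>R)"
      using sums_integral[OF f_int f_ae f_sum] by simp
    have "(\<Sum>i<n. \<integral>w. ?f i w \<partial>R) = x y - x (z n)" for n
    proof (induction n)
      case (Suc n)
      then show ?case using \<phi>(3)[OF x, of n] by simp
    qed (simp add: z(1))
    moreover have "(\<lambda>n. x (z n)) \<longlonglongrightarrow> 0"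
      using blinfun.tendsto[OF tendsto_const summable_LIMSEQ_zero[OF summable_norm_cancel[OF sz]], of x] by simp
    ultimately have "(\<lambda>n. \<Sum>i<n. \<integral>w. ?f i w \<partial>R) \<longlonglongrightarrow> x y - 0"
      by (simp only: tendsto_diff[OF tendsto_const])
    then have "(\<lambda>n. \<integral>w. ?f n w \<partial>R) sums x y"
      by (simp add: sums_def)
    from this sums show ?thesis by (rule sums_unique2)
  qed
  then show ?thesis using \<Phi> by blast
qed

end

section \<open>Almost everywhere equivariant functions\<close>

context walk_rep
begin

lemma weakly_measurable_adjoint:
  assumes "weakly_measurable M F" "g \<in> M \<rightarrow>\<^sub>M borel"
  shows "weakly_measurable M (\<lambda>w. adjoint_representation \<rho> (g w) (F w :: 'a \<Rightarrow>\<^sub>L 'k))"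
  unfolding weakly_measurable_def adjoint_apply
proof
  fix y
  show "(\<lambda>w. F w (\<rho> (- g w) y)) \<in> borel_measurable M"
    by (rule weakly_measurable_eval[OF assms(1) measurable_rep[OF borel_measurable_group_minus[OF assms(2)]]]) simp
qed

lemma integral_increments_case_nat:
  fixes f :: "(nat \<Rightarrow> 'g) \<Rightarrow> 'b::{banach, second_countable_topology}"
  assumes [measurable]: "f \<in> borel_measurable path_space" and bound: "\<And>\<xi>. norm (f \<xi>) \<le> B"
  shows "(\<integral>\<xi>. f \<xi> \<partial>increments) = (\<integral>k. \<integral>\<xi>. f (case_nat k \<xi>) \<partial>increments \<partial>\<mu>)"
proof -
  interpret P: pair_prob_space \<mu> increments ..
  have "(\<integral>\<xi>. f \<xi> \<partial>increments) = (\<integral>\<xi>. f \<xi> \<partial>distr (\<mu> \<Otimes>\<^sub>M increments) increments (\<lambda>(s, w). case_nat s w))"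
    by (simp add: inc.PiM_iter)
  also have "\<dots> = (\<integral>z. f (case_nat (fst z) (snd z)) \<partial>(\<mu> \<Otimes>\<^sub>M increments))"
    by (subst integral_distr) (simp_all add: split_beta')
  also have "\<dots> = (\<integral>k. \<integral>\<xi>. f (case_nat k \<xi>) \<partial>increments \<partial>\<mu>)"
  proof -
    have "integrable (\<mu> \<Otimes>\<^sub>M increments) (\<lambda>z. f (case_nat (fst z) (snd z)))"
      using bound by (intro P.P.integrable_const_bound[of _ B]) simp_all
    from P.integral_fst'[OF this] show ?thesis by simp
  qed
  finally show ?thesis .
qed

end

context walk_quasi_haar
begin

text \<open>The means \<open>F g\<close> of \<open>f\<close> under \<open>Q\<^sub>g\<close> are almost everywhere of the form \<open>\<pi>(g)x\<close>; it remains to see that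
  \<open>x\<close> is harmonic and that \<open>f\<close> is its boundary function. The latter holds because \<open>f\<close> and
  \<open>boundary_fun x\<close> have equal pairings with functions of finitely many positions.\<close>

lemma equivariant_eq_boundary_fun:
  fixes f :: "(nat \<Rightarrow> 'g) \<Rightarrow> 'a \<Rightarrow>\<^sub>L 'k"
  assumes wm: "weakly_measurable invariant_algebra f" and bound: "\<And>w. norm (f w) \<le> C"
    and dual: "\<And>w. f w \<in> dual_space smul"
    and equivariant: "\<And>g. AE w in Q. f (path_translate g w) = adjoint_representation \<rho> g (f w)"
  obtains x where "x \<in> \<H>" "AE w in Q. f w = boundary_fun x w"
proof -
  have f_shift: "f (path_shift w) = f w" for w
    by (rule weakly_measurable_invariant_shift[OF wm])
  have f_path: "weakly_measurable path_space f"
    using wm unfolding weakly_measurable_def by (blast intro: measurable_invariantD)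
  note f_eval[measurable] = weakly_measurableD[OF f_path]
  have f_walk: "weakly_measurable M (\<lambda>z. f (walk_path (g z) (h z)))"
    if "g \<in> M \<rightarrow>\<^sub>M borel" "h \<in> M \<rightarrow>\<^sub>M path_space" for g h and M :: "'w measure"
    using that by (intro weakly_measurable_compose[OF f_path]) measurable
  define F where "F h = weak_star_integral increments (\<lambda>\<xi>. f (walk_path h \<xi>))" for h
  have f_walk_inc: "weakly_measurable increments (\<lambda>\<xi>. f (walk_path h \<xi>))" for h
    by (rule f_walk) simp_all
  have F_apply: "F h y = (\<integral>\<xi>. f (walk_path h \<xi>) y \<partial>increments)" for h y
    unfolding F_def using f_walk_inc bound by (rule inc.weak_star_integral_apply)
  have F_dual: "F h \<in> dual_space smul" for h
    unfolding F_def using f_walk_inc bound dual by (rule inc.weak_star_integral_dual_space)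
  have F_meas: "weakly_measurable borel F"
    unfolding weakly_measurable_def F_apply
  proof
    fix y
    have "weakly_measurable (borel \<Otimes>\<^sub>M increments) (\<lambda>z. f (walk_path (fst z) (snd z)))"
      by (rule f_walk) simp_all
    from weakly_measurableD[OF this, of y]
    show "(\<lambda>h. \<integral>\<xi>. f (walk_path h \<xi>) y \<partial>increments) \<in> borel_measurable borel"
      by (intro inc.borel_measurable_lebesgue_integral) (simp add: split_beta')
  qed
  have F_equiv: "AE h in \<beta>. F (g + h) = adjoint_representation \<rho> g (F h)" for g
    using AE_Q_walk_path[OF equivariant[of g]]
  proof eventually_elim
    case (elim h)
    show ?case
    proof (rule blinfun_eqI)
      fix y
      have "(\<integral>\<xi>. f (walk_path (g + h) \<xi>) y \<partial>increments) = (\<integral>\<xi>. f (walk_path h \<xi>) (\<rho> (- g) y) \<partial>increments)"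
      proof (rule integral_cong_AE)
        show "AE \<xi> in increments. f (walk_path (g + h) \<xi>) y = f (walk_path h \<xi>) (\<rho> (- g) y)"
          using elim by eventually_elim (simp add: walk_path_translate)
      qed (rule weakly_measurableD[OF f_walk_inc])+
      then show "F (g + h) y = adjoint_representation \<rho> g (F h) y"
        by (simp add: F_apply)
    qed
  qed
  have "{z \<in> space (\<beta> \<Otimes>\<^sub>M \<beta>). F (fst z + snd z) = adjoint_representation \<rho> (fst z) (F (snd z))} \<in> sets (\<beta> \<Otimes>\<^sub>M \<beta>)"
    by (intro sets_Collect_weakly_measurable_eq weakly_measurable_adjoint weakly_measurable_compose[OF F_meas])
       measurable
  \<comment> \<open>after exchanging the variables one \<open>h\<^sub>0\<close> serves almost all \<open>g\<close>, and \<open>F\<close> is known from \<open>F h\<^sub>0\<close>\<close>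
  from \<beta>\<beta>.AE_commute[OF this] F_equiv
  have "AE h in \<beta>. AE g in \<beta>. F (g + h) = adjoint_representation \<rho> g (F h)" by simp
  then obtain h\<^sub>0 where "AE g in \<beta>. F (g + h\<^sub>0) = adjoint_representation \<rho> g (F h\<^sub>0)"
    by (rule AE_\<beta>_obtain)
  from AE_right_translate[OF this, of "- h\<^sub>0"]
  have "AE g in \<beta>. F g = adjoint_representation \<rho> (g - h\<^sub>0) (F h\<^sub>0)" by simp
  moreover define x where "x = adjoint_representation \<rho> (- h\<^sub>0) (F h\<^sub>0)"
  moreover have "adjoint_representation \<rho> (g - h\<^sub>0) (F h\<^sub>0) = adjoint_representation \<rho> g x" for g
  proof (rule blinfun_eqI)
    show "adjoint_representation \<rho> (g - h\<^sub>0) (F h\<^sub>0) y = adjoint_representation \<rho> g x y" for y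
      using rep_minus_add(1)[of g "- h\<^sub>0" y] by (simp add: x_def)
  qed
  ultimately have F_x: "AE g in \<beta>. F g = adjoint_representation \<rho> g x" by simp
  have x_dual: "x \<in> dual_space smul"
    unfolding x_def by (intro adjoint_dual_space F_dual)
  \<comment> \<open>shift invariance of \<open>f\<close>: the first increment may be absorbed into the starting point\<close>
  have F_mean: "F g y = (\<integral>k. F (g + k) y \<partial>\<mu>)" for g y
  proof -
    have "F g y = (\<integral>k. \<integral>\<xi>. f (walk_path g (case_nat k \<xi>)) y \<partial>increments \<partial>\<mu>)"
      unfolding F_apply
    proof (rule integral_increments_case_nat)
      show "norm (f (walk_path g \<xi>) y) \<le> C * norm y" for \<xi>
        by (rule order_trans[OF norm_blinfun mult_right_mono[OF bound norm_ge_zero]])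
      show "(\<lambda>\<xi>. f (walk_path g \<xi>) y) \<in> borel_measurable path_space"
        by (rule weakly_measurableD[OF f_walk]) simp_all
    qed
    moreover have "f (walk_path g (case_nat k \<xi>)) = f (walk_path (g + k) \<xi>)" for k \<xi>
      using f_shift[of "walk_path g (case_nat k \<xi>)"] by (simp add: path_shift_walk_path_case_nat)
    ultimately show ?thesis by (simp add: F_apply)
  qed
  interpret \<beta>\<mu>: pair_sigma_finite \<beta> \<mu> ..
  have "AE k in \<mu>. AE g in \<beta>. F (g + k) = adjoint_representation \<rho> (g + k) x"
    using AE_right_translate[OF F_x] by simp
  moreover have adj_x: "weakly_measurable M (\<lambda>w. adjoint_representation \<rho> (g w) x)"
    if "g \<in> M \<rightarrow>\<^sub>M borel" for g and M :: "'w measure"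
    using that by (intro weakly_measurable_adjoint) (simp_all add: weakly_measurable_def)
  have "{z \<in> space (\<beta> \<Otimes>\<^sub>M \<mu>). F (fst z + snd z) = adjoint_representation \<rho> (fst z + snd z) x} \<in> sets (\<beta> \<Otimes>\<^sub>M \<mu>)"
    by (intro sets_Collect_weakly_measurable_eq adj_x weakly_measurable_compose[OF F_meas]) measurable
  from \<beta>\<mu>.AE_commute[OF this] calculation
  have "AE g in \<beta>. AE k in \<mu>. F (g + k) = adjoint_representation \<rho> (g + k) x" by simp
  with F_x have "AE g in \<beta>. F g = adjoint_representation \<rho> g x \<and>
      (AE k in \<mu>. F (g + k) = adjoint_representation \<rho> (g + k) x)" by eventually_elim simp
  then obtain g where g: "F g = adjoint_representation \<rho> g x"
    "AE k in \<mu>. F (g + k) = adjoint_representation \<rho> (g + k) x"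
    by (rule AE_\<beta>_obtain) blast
  \<comment> \<open>for one suitable \<open>g\<close> the mean value property of \<open>F\<close> at \<open>g\<close> is that of \<open>x\<close>, transported by \<open>\<pi>(g)\<close>\<close>
  have "(\<integral>k. x (\<rho> (- k) y) \<partial>\<mu>) = x y" for y
  proof -
    have "x y = F g (\<rho> g y)" by (simp add: g(1))
    also have "\<dots> = (\<integral>k. F (g + k) (\<rho> g y) \<partial>\<mu>)" by (rule F_mean)
    also have "\<dots> = (\<integral>k. x (\<rho> (- k) y) \<partial>\<mu>)"
    proof (rule integral_cong_AE)
      show "(\<lambda>k. F (g + k) (\<rho> g y)) \<in> borel_measurable \<mu>"
        by (rule weakly_measurableD[OF weakly_measurable_compose[OF F_meas]]) measurable
      show "AE k in \<mu>. F (g + k) (\<rho> g y) = x (\<rho> (- k) y)"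
        using g(2) by eventually_elim (simp add: rep_minus_add)
    qed measurable
    finally show ?thesis ..
  qed
  with x_dual have x: "x \<in> \<H>" by (simp add: harmonic_iff)
  have F_path: "AE w in Q. F (w n) = adjoint_representation \<rho> (w n) x" for n
  proof -
    have "AE \<xi> in increments. AE g in \<beta>. F (walk_path g \<xi> n) = adjoint_representation \<rho> (walk_path g \<xi> n) x"
      using AE_right_translate[OF F_x, of "walk_path 0 _ n"] by (simp add: walk_path_eq_add[symmetric])
    moreover have "{z \<in> space (\<beta> \<Otimes>\<^sub>M increments). F (walk_path (fst z) (snd z) n)
        = adjoint_representation \<rho> (walk_path (fst z) (snd z) n) x} \<in> sets (\<beta> \<Otimes>\<^sub>M increments)"
      by (intro sets_Collect_weakly_measurable_eq adj_x weakly_measurable_compose[OF F_meas]) measurable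
    note inc_pair.AE_commute[OF this]
    ultimately have "AE g in \<beta>. AE \<xi> in increments. F (walk_path g \<xi> n) = adjoint_representation \<rho> (walk_path g \<xi> n) x"
      by simp
    moreover have "Measurable.pred path_space (\<lambda>w. F (w n) = adjoint_representation \<rho> (w n) x)"
      unfolding pred_def
      by (intro sets_Collect_weakly_measurable_eq adj_x weakly_measurable_compose[OF F_meas]) measurable
    ultimately show ?thesis by (simp add: AE_Q_iff)
  qed
  have f_int: "integrable Q (\<lambda>w. f w (\<phi> w))" if "integrable Q \<phi>" for \<phi>
    by (rule integrable_eval[where C = C, OF weakly_measurable_Q[OF f_path] _ that]) (simp add: bound)
  have eq_stopped: "(\<integral>w. f w (Z w) \<partial>Q) = (\<integral>w. boundary_fun x w (Z w) \<partial>Q)"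
    if Z: "\<And>w. Z (stopped n w) = Z w" "integrable Q Z" for n Z
  proof -
    have [measurable]: "Z \<in> borel_measurable path_space"
      using borel_measurable_integrable[OF Z(2)] by simp
    have f_after: "f (after n w) = f w" for w
      by (rule shift_invariant_after) (simp add: fun_eq_iff f_shift)
    \<comment> \<open>the values of \<open>f\<close> and \<open>Z\<close> are read from the future and the past of the path\<close>
    let ?H = "\<lambda>z. f (snd z) (Z (fst z))"
    have H: "?H \<in> borel_measurable (path_space \<Otimes>\<^sub>M path_space)"
      by (intro weakly_measurable_eval weakly_measurable_compose[OF f_path]) measurable
    have "(\<integral>w. f w (Z w) \<partial>Q) = (\<integral>w. ?H (stopped n w, after n w) \<partial>Q)"
      by (simp add: Z(1) f_after)
    also have "\<dots> = (\<integral>w. \<integral>\<xi>. ?H (stopped n w, walk_path (w n) \<xi>) \<partial>increments \<partial>Q)"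
      using f_int[OF Z(2)] by (intro markov_integral H) (simp add: Z(1) f_after)
    also have "\<dots> = (\<integral>w. F (w n) (Z w) \<partial>Q)"
      by (simp add: Z(1) F_apply)
    also have "\<dots> = (\<integral>w. x (\<rho> (- w n) (Z w)) \<partial>Q)"
    proof (rule integral_cong_AE)
      show "(\<lambda>w. F (w n) (Z w)) \<in> borel_measurable Q"
        by (intro weakly_measurable_eval weakly_measurable_compose[OF F_meas]) measurable
      show "AE w in Q. F (w n) (Z w) = x (\<rho> (- w n) (Z w))"
        using F_path[of n] by eventually_elim simp
    qed measurable
    also have "\<dots> = x (\<integral>w. \<rho> (- w n) (Z w) \<partial>Q)"
      by (rule integral_bounded_linear[OF blinfun.bounded_linear_right integrable_rep(1)[OF Z(2)]])
    also have "\<dots> = (\<integral>w. boundary_fun x w (Z w) \<partial>Q)"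
      by (rule integral_boundary_fun[OF x Z(2,1), symmetric])
    finally show ?thesis .
  qed
  let ?d = "\<lambda>w. f w - boundary_fun x w"
  have d_path: "weakly_measurable path_space ?d"
    using weakly_measurable_boundary_fun[of x] f_path
    by (simp add: weakly_measurable_def blinfun.diff_left borel_measurable_diff)
  have d_bound: "norm (?d w) \<le> C + norm x" for w
    using norm_triangle_ineq4[of "f w" "boundary_fun x w"] bound[of w] norm_boundary_fun_le[of x w]
    by linarith
  have C: "0 \<le> C + norm x"
    using d_bound[of undefined] norm_ge_zero order_trans by blast
  have d_zero: "(\<integral>w. ?d w (\<phi> w) \<partial>Q) = 0" if \<phi>: "integrable Q \<phi>" for \<phi>
  proof -
    have "norm (\<integral>w. ?d w (\<phi> w) \<partial>Q) \<le> 0 + e" if "e > 0" for e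
    proof -
      have "e / (C + norm x + 1) > 0" using C that by (simp add: add_nonneg_pos)
      from L1_approx_stopped[OF Q.finite_measure_axioms sets_Q \<phi> this]
      obtain n Z where Z: "\<And>w. Z (stopped n w) = Z w" "integrable Q Z"
        "(\<integral>w. norm (\<phi> w - Z w) \<partial>Q) < e / (C + norm x + 1)" by blast
      have i: "integrable Q (\<lambda>w. ?d w (\<psi> w))" if "integrable Q \<psi>" for \<psi>
        by (rule integrable_eval[where C = "C + norm x", OF weakly_measurable_Q[OF d_path] _ that]) (simp add: d_bound)
      have "(\<integral>w. ?d w (Z w) \<partial>Q) = 0"
        using eq_stopped[OF Z(1,2)] f_int[OF Z(2)] integrable_boundary_fun[OF Z(2), of x]
        by (simp add: blinfun.diff_left)
      then have "(\<integral>w. ?d w (\<phi> w) \<partial>Q) = (\<integral>w. ?d w (\<phi> w - Z w) \<partial>Q)"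
        unfolding blinfun.diff_right using i[OF \<phi>] i[OF Z(2)] by simp
      also have "norm \<dots> \<le> (C + norm x) * (\<integral>w. norm (\<phi> w - Z w) \<partial>Q)"
        using \<phi> Z(2) by (intro norm_integral_eval_le[OF weakly_measurable_Q[OF d_path]] d_bound) simp
      also have "\<dots> \<le> (C + norm x + 1) * (e / (C + norm x + 1))"
        using Z(3) C by (intro mult_mono) auto
      also have "\<dots> = e" using C by simp
      finally show ?thesis by simp
    qed
    then have "norm (\<integral>w. ?d w (\<phi> w) \<partial>Q) \<le> 0" by (rule field_le_epsilon)
    then show ?thesis by simp
  qed
  have "AE w in Q. ?d w y \<bullet> b = 0" if b: "b \<in> Basis" for y b
  proof -
    \<comment> \<open>pairing the difference with \<open>?u w *\<^sub>R y\<close> produces the square of its component \<open>?u\<close>\<close>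
    let ?u = "\<lambda>w. ?d w y \<bullet> b"
    have [measurable]: "(\<lambda>w. ?d w y) \<in> borel_measurable path_space"
      by (rule weakly_measurableD[OF d_path])
    have u_bound: "\<bar>?u w\<bar> \<le> (C + norm x) * norm y" for w
      using Basis_le_norm[OF b, of "?d w y"] norm_blinfun[of "?d w" y]
        mult_right_mono[OF d_bound[of w] norm_ge_zero[of y]] by linarith
    have "integrable Q ?u"
      using u_bound by (intro Q.integrable_const_bound[of _ "(C + norm x) * norm y"]) auto
    then have \<phi>: "integrable Q (\<lambda>w. ?u w *\<^sub>R y)" by simp
    have i: "integrable Q (\<lambda>w. ?d w (?u w *\<^sub>R y))"
      by (rule integrable_eval[where C = "C + norm x", OF weakly_measurable_Q[OF d_path] _ \<phi>]) (simp add: d_bound)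
    have sq: "?d w (?u w *\<^sub>R y) \<bullet> b = ?u w * ?u w" for w
      by (simp add: blinfun.scaleR_right)
    have "(\<integral>w. ?u w * ?u w \<partial>Q) = 0"
      using integral_inner_left[OF i, of b] d_zero[OF \<phi>] unfolding sq by simp
    moreover have "integrable Q (\<lambda>w. ?u w * ?u w)"
      using integrable_inner_left[OF i, of b] unfolding sq .
    ultimately have "AE w in Q. ?u w * ?u w = 0"
      by (subst (asm) integral_nonneg_eq_0_iff_AE) auto
    then show ?thesis by simp
  qed
  then have "AE w in Q. \<forall>i. \<forall>b\<in>Basis. ?d w (dense_seq i) \<bullet> b = 0"
    unfolding AE_all_countable by (intro allI AE_finite_allI) simp_all
  then have "AE w in Q. f w = boundary_fun x w"
  proof eventually_elim
    case (elim w)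
    show ?case
      unfolding blinfun_eq_iff_dense
    proof
      fix i
      show "f w (dense_seq i) = boundary_fun x w (dense_seq i)"
      proof (rule euclidean_eqI)
        fix b :: 'k assume "b \<in> Basis"
        then have "?d w (dense_seq i) \<bullet> b = 0" using elim by blast
        then show "f w (dense_seq i) \<bullet> b = boundary_fun x w (dense_seq i) \<bullet> b"
          by (simp add: blinfun.diff_left inner_diff_left)
      qed
    qed
  qed
  with x show thesis by (rule that)
qed

end

section \<open>Integration against the law of the walk started at the identity\<close>

context walk_rep
begin

lemma harmonic_diff:
  assumes "x \<in> \<H>" "x' \<in> \<H>"
  shows "x - x' \<in> \<H>"
proof -
  have int: "integrable \<mu> (\<lambda>k. z (\<rho> (- k) y))" for z :: "'a \<Rightarrow>\<^sub>L 'k" and y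
    by (rule integrable_const_bound[of _ "norm z * norm y"]) (simp_all add: norm_eval_rep_le)
  have "(\<integral>k. (x - x') (\<rho> (- k) y) \<partial>\<mu>) = (x - x') y" for y
    using assms int by (simp add: blinfun.diff_left harmonic_iff)
  then show ?thesis
    using assms by (simp add: harmonic_iff dual_space_def blinfun.diff_left right_diff_distrib)
qed

abbreviation "\<S> \<equiv> strict_equivariant_functions smul \<rho>"

lemma strict_equivariantD:
  fixes f :: "(nat \<Rightarrow> 'g) \<Rightarrow> 'a \<Rightarrow>\<^sub>L 'k"
  assumes "f \<in> \<S>"
  shows "weakly_measurable invariant_algebra f" "f w \<in> dual_space smul"
    "f (path_translate g w) = adjoint_representation \<rho> g (f w)"
    "f \<in> invariant_algebra \<rightarrow>\<^sub>M weak_star_borel smul" "\<exists>C. \<forall>w. norm (f w) \<le> C"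
  using assms weak_star_measurableD[of f invariant_algebra smul]
  by (auto simp: strict_equivariant_functions_def bounded_iff)

lemma weakly_measurable_path_spaceI: "weakly_measurable invariant_algebra f \<Longrightarrow> weakly_measurable path_space f"
  unfolding weakly_measurable_def by (blast intro: measurable_invariantD)

lemma weak_star_integral_walk_law_apply:
  fixes f :: "(nat \<Rightarrow> 'g) \<Rightarrow> 'a \<Rightarrow>\<^sub>L 'k"
  assumes f: "weakly_measurable path_space f" and bound: "\<And>w. norm (f w) \<le> C"
  shows "weak_star_integral (walk_law \<mu> g) f y = (\<integral>\<xi>. f (walk_path g \<xi>) y \<partial>increments)"
proof -
  interpret L: prob_space "walk_law \<mu> g"
    unfolding walk_law_eq by (rule inc.prob_space_distr) simp
  have "weakly_measurable (walk_law \<mu> g) f"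
    using f by (simp add: weakly_measurable_def measurable_cong_sets[OF sets_walk_law refl])
  from L.weak_star_integral_apply[OF this bound]
  have "weak_star_integral (walk_law \<mu> g) f y = (\<integral>w. f w y \<partial>walk_law \<mu> g)" .
  also have "\<dots> = (\<integral>\<xi>. f (walk_path g \<xi>) y \<partial>increments)"
    unfolding walk_law_eq using f by (intro integral_distr) (simp_all add: weakly_measurable_def)
  finally show ?thesis .
qed

lemma weak_star_integral_boundary_fun:
  assumes x: "x \<in> \<H>"
  shows "weak_star_integral (walk_law \<mu> 0) (boundary_fun x) = x"
proof (rule blinfun_eqI)
  fix y
  interpret start: prob_space "return borel (0 :: 'g)"
    by (rule prob_space_return) simp
  interpret S: walk_rep_start \<mu> "return borel 0" smul \<rho>
    by unfold_locales simp
  note law = walk_measure_return[of 0]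
  have "weak_star_integral (walk_law \<mu> 0) (boundary_fun x) y
      = (\<integral>w. boundary_fun x w y \<partial>walk_law \<mu> 0)"
  proof -
    have "(\<lambda>w. boundary_fun x w y) \<in> borel_measurable path_space"
      by (rule weakly_measurableD[OF weakly_measurable_boundary_fun])
    then have "(\<integral>w. boundary_fun x w y \<partial>walk_law \<mu> 0) = (\<integral>\<xi>. boundary_fun x (walk_path 0 \<xi>) y \<partial>increments)"
      unfolding walk_law_eq by (intro integral_distr) simp_all
    then show ?thesis
      by (simp only: weak_star_integral_walk_law_apply[OF weakly_measurable_boundary_fun norm_boundary_fun_le])
  qed
  also have "\<dots> = x (\<integral>w. \<rho> (- w 0) y \<partial>walk_law \<mu> 0)"
    using S.integral_boundary_fun[OF x, of "\<lambda>_. y" 0] S.Q.integrable_const[of y] by (simp add: law)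
  also have "(\<integral>w. \<rho> (- w 0) y \<partial>walk_law \<mu> 0) = y"
    unfolding walk_law_eq by (subst integral_distr) simp_all
  finally show "weak_star_integral (walk_law \<mu> 0) (boundary_fun x) y = x y" .
qed

end

context walk_quasi_haar
begin

abbreviation "\<F> \<equiv> Linf_functions smul \<mu> haar"
abbreviation "cls \<equiv> Linf_class smul \<mu> haar"
abbreviation "\<L> \<equiv> equivariant_Linf smul \<mu> haar \<rho>"

abbreviation "\<R> \<equiv> boundary_map smul \<mu> haar \<rho>"

lemma Linf_functions_iff:
  "f \<in> \<F> \<longleftrightarrow> f \<in> invariant_algebra \<rightarrow>\<^sub>M weak_star_borel smul \<and> (\<exists>C. AE w in Q. norm (f w) \<le> C)"
  by (simp add: Linf_functions_def AE_walk_haar)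

lemma Linf_functionsD:
  assumes "f \<in> \<F>"
  shows "weakly_measurable invariant_algebra f" "f w \<in> dual_space smul"
  using assms weak_star_measurableD[of f invariant_algebra smul] by (auto simp: Linf_functions_iff)

lemma mem_Linf_class_iff: "f' \<in> cls f \<longleftrightarrow> f \<in> \<F> \<and> f' \<in> \<F> \<and> (AE w in Q. f w = f' w)"
  by (simp add: Linf_class_def ae_relation_def AE_walk_haar)

lemma Linf_class_eq:
  assumes "AE w in Q. f w = f' w" "f \<in> \<F>" "f' \<in> \<F>"
  shows "cls f = cls f'"
proof -
  have "(AE w in Q. f w = h w) \<longleftrightarrow> (AE w in Q. f' w = h w)" for h
  proof
    assume "AE w in Q. f w = h w"
    with assms(1) show "AE w in Q. f' w = h w" by eventually_elim simp
  next
    assume "AE w in Q. f' w = h w"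
    with assms(1) show "AE w in Q. f w = h w" by eventually_elim simp
  qed
  then show ?thesis
    using assms by (auto simp: mem_Linf_class_iff)
qed

lemma Linf_class_eqD:
  assumes "cls f = cls f'" "f' \<in> \<F>"
  shows "AE w in Q. f w = f' w"
proof -
  have "f' \<in> cls f" using assms by (simp add: mem_Linf_class_iff)
  then show ?thesis by (simp add: mem_Linf_class_iff)
qed

lemma representative_mem: "f \<in> \<F> \<Longrightarrow> representative (cls f) \<in> cls f"
  unfolding representative_def by (rule someI[of _ f]) (simp add: mem_Linf_class_iff)

lemma strict_Linf_functions:
  assumes "f \<in> \<S>"
  shows "f \<in> \<F>"
  using strict_equivariantD(4,5)[OF assms] by (auto simp: Linf_functions_iff)

lemma boundary_fun_Linf: "x \<in> \<H> \<Longrightarrow> boundary_fun x \<in> \<F>"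
  by (intro strict_Linf_functions boundary_fun_strict) (simp add: harmonic_iff)

lemma strict_class_equivariant:
  assumes "f \<in> \<S>"
  shows "cls f \<in> \<L>"
  unfolding equivariant_Linf_def
  using strict_Linf_functions[OF assms] strict_equivariantD(3)[OF assms] by auto

text \<open>Truncating a representative at an essential bound keeps it equivariant, since the representation is
  isometric.\<close>

lemma equivariant_class_cases:
  assumes "c \<in> \<L>"
  obtains x where "x \<in> \<H>" "c = cls (boundary_fun x)"
proof -
  obtain f where c: "c = cls f" and f: "f \<in> \<F>"
    and eqv: "\<And>g. AE w in Q. f (path_translate g w) = adjoint_representation \<rho> g (f w)"
    using assms by (auto simp: equivariant_Linf_def AE_walk_haar)
  obtain C where C: "AE w in Q. norm (f w) \<le> C" using f by (auto simp: Linf_functions_iff)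
  have wm: "weakly_measurable invariant_algebra f" and dual: "\<And>w. f w \<in> dual_space smul"
    using f by (rule Linf_functionsD)+
  define f' where "f' w = (if norm (f w) \<le> C then f w else 0)" for w
  have [measurable]: "(\<lambda>w. norm (f w)) \<in> borel_measurable invariant_algebra"
    by (rule weakly_measurable_norm[OF wm])
  have "weakly_measurable invariant_algebra f'"
    unfolding weakly_measurable_def
  proof
    fix y
    have [measurable]: "(\<lambda>w. f w y) \<in> borel_measurable invariant_algebra"
      by (rule weakly_measurableD[OF wm])
    have "(\<lambda>w. if norm (f w) \<le> C then f w y else 0) \<in> borel_measurable invariant_algebra"
      by measurable
    moreover have "f' w y = (if norm (f w) \<le> C then f w y else 0)" for w
      by (simp add: f'_def)
    ultimately show "(\<lambda>w. f' w y) \<in> borel_measurable invariant_algebra" by simp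
  qed
  moreover have "norm (f' w) \<le> max C 0" for w
    by (auto simp: f'_def le_max_iff_disj)
  moreover have "f' w \<in> dual_space smul" for w
    using dual by (simp add: f'_def dual_space_def)
  moreover have "AE w in Q. f' (path_translate g w) = adjoint_representation \<rho> g (f' w)" for g
    using eqv[of g]
  proof eventually_elim
    case (elim w)
    then have "norm (f (path_translate g w)) = norm (f w)" by simp
    moreover have "adjoint_representation \<rho> g (0 :: 'a \<Rightarrow>\<^sub>L 'k) = 0" by (rule blinfun_eqI) simp
    ultimately show ?case using elim by (simp add: f'_def)
  qed
  ultimately obtain x where x: "x \<in> \<H>" "AE w in Q. f' w = boundary_fun x w"
    by (rule equivariant_eq_boundary_fun)
  from C x(2) have "AE w in Q. f w = boundary_fun x w"
    by eventually_elim (simp add: f'_def)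
  then have "c = cls (boundary_fun x)"
    unfolding c using f boundary_fun_Linf[OF x(1)] by (rule Linf_class_eq)
  with x(1) show thesis by (rule that)
qed

text \<open>Almost every starting point sees the two functions agree almost surely. One such point can be moved to
  the identity by a translation, under which both functions transform alike.\<close>

lemma strict_integral_cong:
  assumes f: "f \<in> \<S>" and f': "f' \<in> \<S>"
    and eq: "AE w in Q. f w = f' w"
  shows "weak_star_integral (walk_law \<mu> 0) f = weak_star_integral (walk_law \<mu> 0) f'"
proof (rule blinfun_eqI)
  fix y
  have wm: "weakly_measurable path_space f" "weakly_measurable path_space f'"
    using strict_equivariantD(1)[OF f] strict_equivariantD(1)[OF f'] by (simp_all add: weakly_measurable_path_spaceI)
  obtain C C' where C: "\<And>w. norm (f w) \<le> C" "\<And>w. norm (f' w) \<le> C'"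
    using strict_equivariantD(5)[OF f] strict_equivariantD(5)[OF f'] by blast
  from AE_Q_walk_path[OF eq] obtain h where h: "AE \<xi> in increments. f (walk_path h \<xi>) = f' (walk_path h \<xi>)"
    by (rule AE_\<beta>_obtain)
  have tr: "k (walk_path 0 \<xi>) = adjoint_representation \<rho> (- h) (k (walk_path h \<xi>))"
    if "k \<in> \<S>" for k and \<xi>
    using strict_equivariantD(3)[OF that, of "- h" "walk_path h \<xi>"] by (simp add: walk_path_translate)
  have "(\<integral>\<xi>. f (walk_path 0 \<xi>) y \<partial>increments) = (\<integral>\<xi>. f' (walk_path 0 \<xi>) y \<partial>increments)"
  proof (rule integral_cong_AE)
    show "AE \<xi> in increments. f (walk_path 0 \<xi>) y = f' (walk_path 0 \<xi>) y"
      using h by eventually_elim (simp add: tr[OF f] tr[OF f'])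
  qed (rule weakly_measurableD[OF weakly_measurable_compose[OF wm(1)]] weakly_measurableD[OF weakly_measurable_compose[OF wm(2)]], simp)+
  then show "weak_star_integral (walk_law \<mu> 0) f y = weak_star_integral (walk_law \<mu> 0) f' y"
    by (simp add: weak_star_integral_walk_law_apply[OF wm(1) C(1)] weak_star_integral_walk_law_apply[OF wm(2) C(2)])
qed

lemma boundary_map_strict:
  assumes f: "f \<in> \<S>"
  shows "\<R> (cls f) = weak_star_integral (walk_law \<mu> 0) f"
proof -
  define f' where "f' = (SOME f'. f' \<in> \<S> \<and> cls f' = cls f)"
  have f': "f' \<in> \<S>" "cls f' = cls f"
    using someI[of "\<lambda>f'. f' \<in> \<S> \<and> cls f' = cls f" f] f
    by (auto simp: f'_def)
  have "AE w in Q. f' w = f w"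
    using f'(2) strict_Linf_functions[OF f] by (rule Linf_class_eqD)
  from strict_integral_cong[OF f'(1) f this] show ?thesis
    by (simp add: boundary_map_def f'_def)
qed

lemma boundary_map_boundary_fun:
  assumes x: "x \<in> \<H>"
  shows "\<R> (cls (boundary_fun x)) = x"
  using boundary_map_strict[OF boundary_fun_strict, of x] weak_star_integral_boundary_fun[OF x] x
  by (simp add: harmonic_iff)

lemma Linf_pairing_boundary_fun:
  assumes x: "x \<in> \<H>" and \<phi>: "integrable R \<phi>"
  shows "Linf_pairing \<mu> \<beta> \<phi> (cls (boundary_fun x)) = (\<integral>w. boundary_fun x w (\<phi> w) \<partial>R)"
proof -
  let ?r = "representative (cls (boundary_fun x))"
  have r: "?r \<in> \<F>" "AE w in Q. boundary_fun x w = ?r w"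
    using representative_mem[OF boundary_fun_Linf[OF x]] by (simp_all add: mem_Linf_class_iff)
  have r_meas: "weakly_measurable invariant_algebra ?r"
    using r(1) by (rule Linf_functionsD)
  have \<phi>_meas: "\<phi> \<in> borel_measurable invariant_algebra"
    using borel_measurable_integrable[OF \<phi>] by simp
  show ?thesis
    unfolding Linf_pairing_def
  proof (rule integral_cong_AE)
    show "(\<lambda>w. ?r w (\<phi> w)) \<in> borel_measurable R"
      unfolding measurable_R by (rule weakly_measurable_eval[OF r_meas \<phi>_meas])
    show "(\<lambda>w. boundary_fun x w (\<phi> w)) \<in> borel_measurable R"
      unfolding measurable_R by (rule weakly_measurable_eval[OF borel_measurable_boundary_fun_inv \<phi>_meas])
    have "AE w in R. boundary_fun x w = ?r w"
    proof (rule AE_restr_to_subalg2[OF subalgebra_Q r(2)])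
      show "Measurable.pred invariant_algebra (\<lambda>w. boundary_fun x w = ?r w)"
        unfolding pred_def by (rule sets_Collect_weakly_measurable_eq[OF borel_measurable_boundary_fun_inv r_meas])
    qed
    then show "AE w in R. ?r w (\<phi> w) = boundary_fun x w (\<phi> w)"
      by eventually_elim simp
  qed
qed

lemma topspace_equivariant_Linf: "topspace (equivariant_Linf_topology smul \<mu> haar \<beta> \<rho>) = \<L>"
proof -
  have "\<L> \<subseteq> Linf smul \<mu> haar"
    by (auto simp: equivariant_Linf_def Linf_def Linf_class_def quotient_def)
  then show ?thesis
    by (auto simp: equivariant_Linf_topology_def Linf_weak_star_topology_def topspace_pullback_topology)
qed

lemma topspace_harmonic: "topspace (harmonic_topology smul \<mu> \<rho>) = \<H>"
  by (auto simp: harmonic_topology_def weak_star_topology_def strong_operator_topology_topspace harmonic_elements_def)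

lemma continuous_boundary_map:
  "continuous_map (equivariant_Linf_topology smul \<mu> haar \<beta> \<rho>) (harmonic_topology smul \<mu> \<rho>)
    (\<R>)"
proof -
  let ?X = "equivariant_Linf_topology smul \<mu> haar \<beta> \<rho>"
  have "continuous_map ?X euclidean (\<lambda>c. \<R> c y)" for y
  proof -
    obtain \<phi> where \<phi>: "integrable R \<phi>"
      "\<And>x. x \<in> \<H> \<Longrightarrow> x y = (\<integral>w. boundary_fun x w (\<phi> w) \<partial>R)"
      using evaluation_eq_pairing[of y] by blast
    have mem: "\<phi> \<in> predual_functions \<mu> \<beta>"
      using \<phi>(1) by (simp add: predual_functions_def)
    have "continuous_map (Linf_weak_star_topology smul \<mu> haar \<beta>) euclidean
       ((\<lambda>z. z \<phi>) \<circ> (\<lambda>c. \<lambda>\<phi>\<in>predual_functions \<mu> \<beta>. Linf_pairing \<mu> \<beta> \<phi> c))"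
      unfolding Linf_weak_star_topology_def
      by (rule continuous_map_pullback, rule continuous_map_product_projection) (rule mem)
    then have "continuous_map ?X euclidean (\<lambda>c. Linf_pairing \<mu> \<beta> \<phi> c)"
      unfolding equivariant_Linf_topology_def using mem
      by (intro continuous_map_from_subtopology) (simp add: comp_def)
    then show ?thesis
    proof (rule continuous_map_eq)
      fix c assume "c \<in> topspace ?X"
      then have "c \<in> \<L>" by (simp add: topspace_equivariant_Linf)
      then obtain x where "x \<in> \<H>" "c = cls (boundary_fun x)" by (rule equivariant_class_cases)
      then show "Linf_pairing \<mu> \<beta> \<phi> c = \<R> c y"
        by (simp add: boundary_map_boundary_fun Linf_pairing_boundary_fun \<phi>)
    qed
  qed
  moreover have "\<R> c \<in> \<H>" if "c \<in> \<L>" for c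
    using that by (rule equivariant_class_cases) (simp add: boundary_map_boundary_fun)
  ultimately show ?thesis
    unfolding harmonic_topology_def weak_star_topology_def
    by (auto simp: continuous_map_in_subtopology continuous_on_strong_operator_topo_iff_coordinatewise
        topspace_equivariant_Linf harmonic_iff)
qed

lemma continuous_class_boundary_fun:
  "continuous_map (harmonic_topology smul \<mu> \<rho>) (equivariant_Linf_topology smul \<mu> haar \<beta> \<rho>)
    (\<lambda>x. cls (boundary_fun x))"
proof -
  let ?Y = "harmonic_topology smul \<mu> \<rho>"
  let ?pair = "\<lambda>c. \<lambda>\<phi>\<in>predual_functions \<mu> \<beta>. Linf_pairing \<mu> \<beta> \<phi> c"
  have "continuous_map ?Y euclidean (\<lambda>x. Linf_pairing \<mu> \<beta> \<phi> (cls (boundary_fun x)))"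
    if "\<phi> \<in> predual_functions \<mu> \<beta>" for \<phi>
  proof -
    have \<phi>: "integrable R \<phi>" using that by (simp add: predual_functions_def)
    obtain y where y: "\<And>x. x \<in> \<H> \<Longrightarrow> (\<integral>w. boundary_fun x w (\<phi> w) \<partial>Q) = x y"
      using pairing_eq_evaluation[OF integrable_from_subalg[OF subalgebra_Q \<phi>]] by blast
    have "continuous_map ?Y euclidean (\<lambda>x. blinfun_apply x y)"
      unfolding harmonic_topology_def weak_star_topology_def
      by (intro continuous_map_from_subtopology strong_operator_topology_continuous_evaluation)
    then show ?thesis
    proof (rule continuous_map_eq)
      fix x assume "x \<in> topspace ?Y"
      then have x: "x \<in> \<H>" by (simp add: topspace_harmonic)
      have "(\<integral>w. boundary_fun x w (\<phi> w) \<partial>R) = (\<integral>w. boundary_fun x w (\<phi> w) \<partial>Q)"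
      proof (rule integral_subalgebra2[OF subalgebra_Q])
        show "(\<lambda>w. boundary_fun x w (\<phi> w)) \<in> borel_measurable invariant_algebra"
          using borel_measurable_integrable[OF \<phi>]
          by (intro weakly_measurable_eval borel_measurable_boundary_fun_inv) simp
      qed
      then show "x y = Linf_pairing \<mu> \<beta> \<phi> (cls (boundary_fun x))"
        by (simp add: Linf_pairing_boundary_fun[OF x \<phi>] y[OF x])
    qed
  qed
  then have "continuous_map ?Y (product_topology (\<lambda>_. euclidean) (predual_functions \<mu> \<beta>))
      (?pair \<circ> (\<lambda>x. cls (boundary_fun x)))"
    by (auto simp: continuous_map_componentwise comp_def)
  moreover have cls: "cls (boundary_fun x) \<in> \<L>" if "x \<in> \<H>" for x
    using that by (intro strict_class_equivariant boundary_fun_strict) (simp add: harmonic_iff)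
  moreover have "cls (boundary_fun x) \<in> Linf smul \<mu> haar" if "x \<in> \<H>" for x
    using boundary_fun_Linf[OF that] by (auto simp: Linf_def Linf_class_def quotient_def)
  ultimately show ?thesis
    unfolding equivariant_Linf_topology_def continuous_map_in_subtopology Linf_weak_star_topology_def
    by (auto simp: topspace_harmonic intro!: continuous_map_pullback')
qed

lemma homeomorphic_boundary_map:
  "homeomorphic_map (equivariant_Linf_topology smul \<mu> haar \<beta> \<rho>) (harmonic_topology smul \<mu> \<rho>)
    (\<R>)"
  unfolding homeomorphic_map_maps homeomorphic_maps_def
proof (intro exI conjI ballI)
  show "cls (boundary_fun (\<R> c)) = c"
    if "c \<in> topspace (equivariant_Linf_topology smul \<mu> haar \<beta> \<rho>)" for c
    using that unfolding topspace_equivariant_Linf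
    by (rule equivariant_class_cases) (simp add: boundary_map_boundary_fun)
  show "\<R> (cls (boundary_fun x)) = x"
    if "x \<in> topspace (harmonic_topology smul \<mu> \<rho>)" for x
    using that by (simp add: topspace_harmonic boundary_map_boundary_fun)
qed (rule continuous_boundary_map continuous_class_boundary_fun)+

text \<open>The norm of a boundary function is invariant under translations, so the bound passes from the walks
  with some starting point to the walk from the identity, whose mean is \<open>x\<close>.\<close>

lemma norm_harmonic_le:
  assumes x: "x \<in> \<H>" and le: "AE w in Q. norm (boundary_fun x w) \<le> r"
  shows "norm x \<le> r"
proof -
  from AE_Q_walk_path[OF le] obtain h where h: "AE \<xi> in increments. norm (boundary_fun x (walk_path h \<xi>)) \<le> r"
    by (rule AE_\<beta>_obtain)
  have "norm (boundary_fun x (walk_path h \<xi>)) = norm (boundary_fun x (walk_path 0 \<xi>))" for \<xi>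
    using boundary_fun_translate[where x = x and g = h and w = "walk_path 0 \<xi>"] by (simp add: walk_path_translate)
  then have ae: "AE \<xi> in increments. norm (boundary_fun x (walk_path 0 \<xi>)) \<le> r"
    using h by simp
  have "\<exists>\<xi>. norm (boundary_fun x (walk_path 0 \<xi>)) \<le> r"
  proof (rule ccontr)
    assume "\<not> (\<exists>\<xi>. norm (boundary_fun x (walk_path 0 \<xi>)) \<le> r)"
    then have "AE \<xi> in increments. False" using ae by simp
    then show False by simp
  qed
  then have "r \<ge> 0" using norm_ge_zero order_trans by blast
  then show ?thesis
  proof (rule norm_blinfun_bound)
    fix y
    note wm = weakly_measurable_boundary_fun
    have wm': "weakly_measurable increments (\<lambda>\<xi>. boundary_fun x (walk_path 0 \<xi>))"
      by (rule weakly_measurable_compose[OF wm]) simp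
    have "x y = (\<integral>\<xi>. boundary_fun x (walk_path 0 \<xi>) y \<partial>increments)"
      using weak_star_integral_walk_law_apply[OF wm[of x] norm_boundary_fun_le, where g = 0 and y = y]
      by (simp add: weak_star_integral_boundary_fun[OF x])
    then have "norm (x y) \<le> (\<integral>\<xi>. norm (boundary_fun x (walk_path 0 \<xi>) y) \<partial>increments)"
      by simp
    also have "\<dots> \<le> (\<integral>\<xi>. r * norm y \<partial>increments)"
    proof (rule integral_mono_AE)
      show "integrable increments (\<lambda>\<xi>. norm (boundary_fun x (walk_path 0 \<xi>) y))"
        by (intro integrable_norm integrable_eval[OF wm', of "norm x"]) (simp_all add: norm_boundary_fun_le)
      show "AE \<xi> in increments. norm (boundary_fun x (walk_path 0 \<xi>) y) \<le> r * norm y"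
        using ae
      proof eventually_elim
        case (elim \<xi>)
        show ?case
          by (rule order_trans[OF norm_blinfun mult_right_mono[OF elim norm_ge_zero]])
      qed
    qed simp
    finally show "norm (x y) \<le> r * norm y" by simp
  qed
qed

text \<open>Boundary functions depend linearly on the harmonic element up to null sets, which reduces the distance
  to the norm of one boundary function.\<close>

lemma Linf_dist_boundary_fun:
  assumes x: "x \<in> \<H>" and x': "x' \<in> \<H>"
  shows "Linf_dist \<mu> haar (cls (boundary_fun x)) (cls (boundary_fun x')) = ereal (norm (x - x'))"
proof -
  let ?r = "representative (cls (boundary_fun x))" and ?r' = "representative (cls (boundary_fun x'))"
  have r: "?r \<in> \<F>" "AE w in Q. boundary_fun x w = ?r w"
    and r': "?r' \<in> \<F>" "AE w in Q. boundary_fun x' w = ?r' w"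
    using representative_mem[OF boundary_fun_Linf[OF x]] representative_mem[OF boundary_fun_Linf[OF x']]
    by (simp_all add: mem_Linf_class_iff)
  have z: "x - x' \<in> \<H>" by (rule harmonic_diff[OF x x'])
  have "AE w in Q. boundary_fun (x - x') w = boundary_fun x w - boundary_fun x' w"
    using AE_boundary_fun_tendsto[OF x] AE_boundary_fun_tendsto[OF x'] AE_boundary_fun_tendsto[OF z]
  proof eventually_elim
    case (elim w)
    show ?case
    proof (rule blinfun_eqI)
      fix y
      have "(\<lambda>n. x (\<rho> (- w n) y) - x' (\<rho> (- w n) y)) \<longlonglongrightarrow> boundary_fun x w y - boundary_fun x' w y"
        using elim by (intro tendsto_diff) auto
      moreover have "(\<lambda>n. x (\<rho> (- w n) y) - x' (\<rho> (- w n) y)) \<longlonglongrightarrow> boundary_fun (x - x') w y"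
        using elim by (simp add: blinfun.diff_left)
      ultimately show "boundary_fun (x - x') w y = (boundary_fun x w - boundary_fun x' w) y"
        using LIMSEQ_unique by (simp add: blinfun.diff_left) blast
    qed
  qed
  with r(2) r'(2) have u: "AE w in Q. norm (?r w - ?r' w) = norm (boundary_fun (x - x') w)"
    by eventually_elim simp
  have "weakly_measurable path_space ?r" "weakly_measurable path_space ?r'"
    using r(1) r'(1) by (blast intro: Linf_functionsD weakly_measurable_path_spaceI)+
  then have "weakly_measurable path_space (\<lambda>w. ?r w - ?r' w)"
    by (simp add: weakly_measurable_def blinfun.diff_left borel_measurable_diff)
  from weakly_measurable_norm[OF this]
  have meas: "(\<lambda>w. ereal (norm (?r w - ?r' w))) \<in> borel_measurable (walk_measure \<mu> haar)"
    using sets_walk_measure[OF sets_haar] by (simp cong: measurable_cong_sets)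
  let ?s = "esssup (walk_measure \<mu> haar) (\<lambda>w. ereal (norm (?r w - ?r' w)))"
  have "?s \<le> ereal (norm (x - x'))"
  proof (rule esssup_I[OF meas])
    show "AE w in walk_measure \<mu> haar. ereal (norm (?r w - ?r' w)) \<le> ereal (norm (x - x'))"
      unfolding AE_walk_haar using u by eventually_elim (simp add: norm_boundary_fun_le)
  qed
  moreover have "ereal (norm (x - x')) \<le> ?s"
  proof (rule ccontr)
    assume "\<not> ereal (norm (x - x')) \<le> ?s"
    then have "?s < ereal (norm (x - x'))" by simp
    from ereal_dense2[OF this] obtain t where t: "?s < ereal t" "ereal t < ereal (norm (x - x'))" by blast
    have "AE w in Q. ereal (norm (?r w - ?r' w)) \<le> ?s"
      unfolding AE_walk_haar[symmetric] by (rule esssup_AE)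
    with u have "AE w in Q. norm (boundary_fun (x - x') w) \<le> t"
    proof eventually_elim
      case (elim w)
      then have "ereal (norm (boundary_fun (x - x') w)) \<le> ?s" by simp
      also have "\<dots> \<le> ereal t" using t(1) by (rule less_imp_le)
      finally show ?case by simp
    qed
    from norm_harmonic_le[OF z this] t(2) show False by simp
  qed
  ultimately show ?thesis
    unfolding Linf_dist_def by simp
qed

end

theorem theorem6p5:
  fixes smul :: "'k::{real_normed_field, euclidean_space} \<Rightarrow>
      'a::{banach, second_countable_topology} \<Rightarrow> 'a"
    and \<mu> haar \<beta> :: "'g::{topological_group_add, t2_space, second_countable_topology} measure"
    and \<rho> :: "'g \<Rightarrow> 'a \<Rightarrow>\<^sub>L 'a"
  assumes "locally_compact_space (euclidean :: 'g topology)"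
    and "prob_space \<mu>" and "sets \<mu> = sets borel"
    and "left_haar_measure haar"
    and "finite_measure \<beta>" and "sets \<beta> = sets borel"
    and "absolutely_continuous haar \<beta>" and "absolutely_continuous \<beta> haar"
    and "normed_space_over smul"
    and "isometric_representation smul \<rho>"
  shows "(\<forall>f\<in>strict_equivariant_functions smul \<rho>.
            boundary_map smul \<mu> haar \<rho> (Linf_class smul \<mu> haar f)
              = weak_star_integral (walk_law \<mu> 0) f) \<and>
         homeomorphic_map (equivariant_Linf_topology smul \<mu> haar \<beta> \<rho>)
           (harmonic_topology smul \<mu> \<rho>) (boundary_map smul \<mu> haar \<rho>) \<and>
         (\<forall>c\<in>equivariant_Linf smul \<mu> haar \<rho>. \<forall>c'\<in>equivariant_Linf smul \<mu> haar \<rho>.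
            ereal (norm (boundary_map smul \<mu> haar \<rho> c - boundary_map smul \<mu> haar \<rho> c'))
              = Linf_dist \<mu> haar c c')"
proof -
  interpret walk_quasi_haar \<mu> \<beta> smul \<rho> haar
    using assms
    by (intro walk_quasi_haar.intro walk_rep_start.intro walk_rep.intro random_walk_start.intro random_walk.intro
        isometric_rep.intro random_walk_axioms.intro random_walk_start_axioms.intro walk_quasi_haar_axioms.intro)
  show ?thesis
  proof (intro conjI ballI)
    fix c c' assume "c \<in> equivariant_Linf smul \<mu> haar \<rho>" "c' \<in> equivariant_Linf smul \<mu> haar \<rho>"
    then obtain x x' where "x \<in> \<H>" "c = cls (boundary_fun x)" "x' \<in> \<H>" "c' = cls (boundary_fun x')"
      by (metis equivariant_class_cases)
    then show "ereal (norm (boundary_map smul \<mu> haar \<rho> c - boundary_map smul \<mu> haar \<rho> c')) = Linf_dist \<mu> haar c c'"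
      by (simp add: boundary_map_boundary_fun Linf_dist_boundary_fun)
  qed (simp_all add: boundary_map_strict homeomorphic_boundary_map)
qed

end
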